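(* Let $\Gamma=\partial D$ be analytic with radial parameterization $p$ (i.e. $\Gamma=\{p(\hat x)\hat x:\hat x\in\mathbb S\}$). Assume that there is a sufficiently small closed neighborhood $U$ of $\Gamma$ such that, for all sufficiently small $\delta$, $$\left|\frac{\partial\boldsymbol u_N^\delta}{\partial\hat x}\Big|_{\tilde\Gamma}\right|\ge2\varepsilon\qquad\text{for all curves }\tilde\Gamma\in U .$$ Consider the Newton iteration $$p_{m+1}^\delta=p_m^\delta-\Re\left(\boldsymbol u_N^\delta\Big/\frac{\partial\boldsymbol u_N^\delta}{\partial\hat x}\right)\Big|_{\Gamma_m^\delta},\qquad \Gamma_m^\delta=\{p_m^\delta(\hat x)\hat x:\hat x\in\mathbb S\},\quad m=0,1,\dots,$$ stopped when two successive approximations satisfy $$\|p_{m+1}^\delta-p_m^\delta\|_{L^2(\mathbb S)}\le C_1(\delta),\qquad C_1(\delta)=\frac{4\xi_2(\delta)}{\varepsilon-2\xi_3(\delta)},$$ and put $p_\delta:=p_{m+1}^\delta$ when this stopping criterion is fulfilled. Then the iteration is locally convergent (i.e. for initial guesses sufficiently close to $p$) in the sense that $$\|p_\delta-p\|\to0\quad\text{as }\delta\to0 .$$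
   Context: Scattering problem. $D\subset\mathbb R^2$ is a bounded simply connected domain with $C^2$ boundary, $\rho>0$, $B_\rho=\{x\in\mathbb R^2:|x|<\rho\}$, $\Gamma_\rho=\partial B_\rho$, $D\subset B_\rho$, and $B_\rho\setminus\overline D$ is connected. The Lamé constants satisfy $\mu>0$, $\lambda+\mu>0$; $\omega>0$; $k_p=\omega/\sqrt{\lambda+2\mu}$, $k_s=\omega/\sqrt\mu$; $\Delta^*\boldsymbol u=\mu\Delta\boldsymbol u+(\lambda+\mu)\nabla\nabla\cdot\boldsymbol u$. Fix a source point $z\in\Gamma_\rho$ and a polarization $\boldsymbol p\in\mathbb S=\{x\in\mathbb R^2:|x|=1\}$ (unrelated to the parameterizations $p,p_m^\delta$). The incident field is $\boldsymbol u^i(x)=\mathbb G(x,z)\boldsymbol p$, with $\mathbb G(x,y)=\frac1\mu\Phi_s(x,y)\mathbb I+\frac1{\omega^2}\nabla_x\nabla_x^\top(\Phi_s(x,y)-\Phi_p(x,y))$, $\Phi_\xi(x,y)=\frac{\mathrm i}{4}H_0^{(1)}(k_\xi|x-y|)$ for $\xi\in\{p,s\}$, and $H_n^{(1)}$ the Hankel function of the first kind of order $n$. The scattered field $\boldsymbol v$ satisfies $\Delta^*\boldsymbol v+\omega^2\boldsymbol v=0$ in $\mathbb R^2\setminus\overline D$, $\boldsymbol u:=\boldsymbol u^i+\boldsymbol v=0$ on $\partial D$, and the Kupradze–Sommerfeld radiation condition $\lim_{r\to\infty}\sqrt r(\partial_r\boldsymbol v_\xi-\mathrm ik_\xi\boldsymbol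 v_\xi)=0$, $\xi\in\{p,s\}$, $r=|x|$, where $\boldsymbol v_p=-k_p^{-2}\,\mathrm{grad}\,\mathrm{div}\,\boldsymbol v$, $\boldsymbol v_s=-k_s^{-2}\,\mathrm{grad}^\perp\mathrm{div}^\perp\boldsymbol v$, $\mathrm{grad}^\perp=(-\partial_2,\partial_1)^\top$, $\mathrm{div}^\perp=(-\partial_2,\partial_1)$. Expansion. Write $\boldsymbol v=\nabla\phi_p+\mathbf{curl}\,\phi_s$ with scalar potentials $\phi_\xi$ satisfying $\Delta\phi_\xi+k_\xi^2\phi_\xi=0$ and the Sommerfeld radiation condition; in polar coordinates $\mathbf{curl}\,w=\frac1r\partial_\theta w\,\boldsymbol e_r-\partial_r w\,\boldsymbol e_\theta$, with $\boldsymbol e_r=(\cos\theta,\sin\theta)^\top$, $\boldsymbol e_\theta=(-\sin\theta,\cos\theta)^\top$. Fix $R>0$ with $B_R=\{|x|<R\}\subset D$, and set $\Gamma_R=\partial B_R$. Standing assumption: the potentials extend to the exterior of $B_R$, with $\phi_p,\phi_s\in L^2(\Gamma_R)$ on $\Gamma_R$, and are represented there by $\phi_\xi=\sum_{n\in\mathbb Z}\frac{H_n^{(1)}(k_\xi r)}{H_n^{(1)}(k_\xi R)}\hat\phi_{\xi,n}\mathrm e^{\mathrm in\theta}$; thus $\boldsymbol v$ and $\boldsymbol u$ are analytically extended to the iterative curves. Notation: $\boldsymbol U_n(\theta)=\mathrm e^{\mathrm in\theta}\boldsymbol e_r$, $\boldsymbol V_n(\theta)=\mathrm e^{\mathrm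 in\theta}\boldsymbol e_\theta$, $\alpha_{\xi,n}(r)=\frac{k_\xi H_n^{(1)\prime}(k_\xi r)}{H_n^{(1)}(k_\xi R)}$, $\beta_{\xi,n}(r)=\frac{H_n^{(1)}(k_\xi r)}{H_n^{(1)}(k_\xi R)}$, and $\alpha_{\xi,n}=\alpha_{\xi,n}(\rho)$, $\beta_{\xi,n}=\beta_{\xi,n}(\rho)$, with $H_n^{(1)}(k_\xi\rho)\ne0$ assumed. Noisy approximation. The data $\boldsymbol v^\delta\in(L^2(\Gamma_\rho))^2$ satisfy $\|\boldsymbol v-\boldsymbol v^\delta\|_{(L^2(\Gamma_\rho))^2}\le\delta\|\boldsymbol v\|_{(L^2(\Gamma_\rho))^2}$, $\delta\in(0,1)$. The coefficients $\hat\phi^\delta_{p,n},\hat\phi^\delta_{s,n}$ solve the (uniquely solvable) system $$\begin{bmatrix}\alpha_{p,n}&\frac{\mathrm in}{\rho}\beta_{s,n}\\ \frac{\mathrm in}{\rho}\beta_{p,n}&-\alpha_{s,n}\end{bmatrix}\begin{bmatrix}\hat\phi^\delta_{p,n}\\ \hat\phi^\delta_{s,n}\end{bmatrix}=\frac1{2\pi\rho}\begin{bmatrix}\int_{\Gamma_\rho}\boldsymbol v^\delta\cdot\overline{\boldsymbol U_n}\,\mathrm ds\\ \int_{\Gamma_\rho}\boldsymbol v^\delta\cdot\overline{\boldsymbol V_n}\,\mathrm ds\end{bmatrix},$$ and $$\boldsymbol v_N^\delta(x)=\sum_{n=-N}^{N}\Big[\Big(\alpha_{p,n}(r)\hat\phi^\delta_{p,n}+\tfrac{\mathrm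 i n}{r}\beta_{s,n}(r)\hat\phi^\delta_{s,n}\Big)\boldsymbol U_n(\theta)+\Big(\tfrac{\mathrm i n}{r}\beta_{p,n}(r)\hat\phi^\delta_{p,n}-\alpha_{s,n}(r)\hat\phi^\delta_{s,n}\Big)\boldsymbol V_n(\theta)\Big],\qquad \boldsymbol u_N^\delta=\boldsymbol u^i+\boldsymbol v_N^\delta .$$ The truncation is $N=[\ln\delta^{-1}/\ln\tau_2]$, where $\tau_2=(R+\gamma)/R$ and $[X]$ is the largest integer smaller than $X+1$; throughout $N\ge4k_s\rho+1$. Standing assumptions. Assumption 1: the curves are star-shaped and the shifts are radial, $h(\hat x)=h\hat x$, so $\partial/\partial\hat x=\partial_r$ is the radial derivative. Assumption 2: for some $\varepsilon>0$ (the $\varepsilon$ of the claim), $|\partial\boldsymbol u/\partial\hat x|\ge4\varepsilon$ on every curve in the small closed neighborhood $U$ of $\partial D$ (with $|\Re(\partial\boldsymbol u/\partial\hat x)|>4\varepsilon$ in its place when real parts are taken in the update). Assumption 3: there is $\gamma>0$ such that all points $x$ of the curves satisfy $|x|\ge R+\gamma$. Error functions. $\xi_2,\xi_3$ are functions of $\delta$ with $\xi_\ell(\delta)\to0$ as $\delta\to0$ such that on the iterative curves $$\|\boldsymbol v-\boldsymbol v_N^\delta\|_{(L^2(\Gamma_m^\delta))^2}\le\xi_2(\delta),\qquad \Big\|\frac{\partial\boldsymbol v}{\partial\hat x}-\frac{\partial\boldsymbol v_N^\delta}{\partial\hat x}\Big\|_{(L^2(\Gamma_m^\delta))^2}\le\xi_3(\delta).$$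 Conventions. For vector fields $\boldsymbol a,\boldsymbol b$ with values in $\mathbb C^2$, $\boldsymbol b\ne0$, the pointwise quotient $\boldsymbol a/\boldsymbol b$ is understood as the least-squares solution $h$ of $\boldsymbol a=h\boldsymbol b$, i.e. $(\boldsymbol a\cdot\overline{\boldsymbol b})/|\boldsymbol b|^2$. Norms of parameterizations are in $L^2(\mathbb S)$. *)

theory Defs
  imports "HOL-Analysis.Analysis"
begin

definition bessel_J :: "nat \<Rightarrow> real \<Rightarrow> real" where
  "bessel_J n x = (\<Sum>m. (-1) ^ m / (fact m * fact (m + n)) * (x / 2) ^ (2 * m + n))"

text \<open>Neumann's expansion of the Bessel function of the second kind, for positive argument.\<close>

definition bessel_Y :: "nat \<Rightarrow> real \<Rightarrow> real" where
  "bessel_Y n x =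
     2 / pi * ln (x / 2) * bessel_J n x
     - 1 / pi * (\<Sum>m<n. fact (n - m - 1) / fact m * (x / 2) powi (2 * int m - int n))
     - 1 / pi * (\<Sum>m. (Digamma (real (m + 1)) + Digamma (real (n + m + 1)))
                      * ((-1) ^ m / (fact m * fact (n + m))) * (x / 2) ^ (2 * m + n))"

text \<open>Negative orders use the reflection formulas, which multiply both Bessel functions of
  order \<open>-n\<close> by the same sign \<open>(-1) ^ n\<close>.\<close>

definition hankel1 :: "int \<Rightarrow> real \<Rightarrow> complex" where
  "hankel1 n x =
     (if n < 0 then (-1) ^ nat (- n) else 1) * Complex (bessel_J (nat \<bar>n\<bar>) x) (bessel_Y (nat \<bar>n\<bar>) x)"

definition hankel1_deriv :: "int \<Rightarrow> real \<Rightarrow> complex" where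
  "hankel1_deriv n x = vector_derivative (hankel1 n) (at x)"

definition pderiv_at :: "2 \<Rightarrow> (real^2 \<Rightarrow> 'a::real_normed_vector) \<Rightarrow> real^2 \<Rightarrow> 'a" where
  "pderiv_at i f x = frechet_derivative f (at x) (axis i 1)"

definition C1_on :: "(real^2) set \<Rightarrow> (real^2 \<Rightarrow> 'a::real_normed_vector) \<Rightarrow> bool" where
  "C1_on S f \<longleftrightarrow> (\<forall>x\<in>S. f differentiable (at x)) \<and> (\<forall>i. continuous_on S (pderiv_at i f))"

definition C2_on :: "(real^2) set \<Rightarrow> (real^2 \<Rightarrow> 'a::real_normed_vector) \<Rightarrow> bool" where
  "C2_on S f \<longleftrightarrow> C1_on S f \<and> (\<forall>i. C1_on S (pderiv_at i f))"

definition laplacian :: "(real^2 \<Rightarrow> 'a::real_normed_vector) \<Rightarrow> real^2 \<Rightarrow> 'a" where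
  "laplacian f x = (\<Sum>i\<in>UNIV. pderiv_at i (pderiv_at i f) x)"

definition grad :: "(real^2 \<Rightarrow> complex) \<Rightarrow> real^2 \<Rightarrow> complex^2" where
  "grad w x = (\<chi> i. pderiv_at i w x)"

definition divg :: "(real^2 \<Rightarrow> complex^2) \<Rightarrow> real^2 \<Rightarrow> complex" where
  "divg v x = (\<Sum>i\<in>UNIV. pderiv_at i (\<lambda>y. v y $ i) x)"

definition grad_perp :: "(real^2 \<Rightarrow> complex) \<Rightarrow> real^2 \<Rightarrow> complex^2" where
  "grad_perp w x = vector [- pderiv_at 2 w x, pderiv_at 1 w x]"

definition div_perp :: "(real^2 \<Rightarrow> complex^2) \<Rightarrow> real^2 \<Rightarrow> complex" where
  "div_perp v x = - pderiv_at 2 (\<lambda>y. v y $ 1) x + pderiv_at 1 (\<lambda>y. v y $ 2) x"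

definition cvec :: "real^2 \<Rightarrow> complex^2" where
  "cvec x = (\<chi> i. complex_of_real (x $ i))"

definition e_r :: "real \<Rightarrow> real^2" where
  "e_r \<theta> = vector [cos \<theta>, sin \<theta>]"

definition e_theta :: "real \<Rightarrow> real^2" where
  "e_theta \<theta> = vector [- sin \<theta>, cos \<theta>]"

definition polar :: "real \<Rightarrow> real \<Rightarrow> real^2" where
  "polar r \<theta> = r *\<^sub>R e_r \<theta>"

definition d_r :: "(real^2 \<Rightarrow> 'a::real_normed_vector) \<Rightarrow> real^2 \<Rightarrow> 'a" where
  "d_r f x = frechet_derivative f (at x) (x /\<^sub>R norm x)"

text \<open>The polar form \<open>(1/r) \<partial>\<^sub>\<theta>w e\<^sub>r - \<partial>\<^sub>r w e\<^sub>\<theta>\<close> of the curl of a scalar, in Cartesian components.\<close>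

definition curl :: "(real^2 \<Rightarrow> complex) \<Rightarrow> real^2 \<Rightarrow> complex^2" where
  "curl w x = vector [pderiv_at 2 w x, - pderiv_at 1 w x]"

definition fund_sol :: "real \<Rightarrow> real^2 \<Rightarrow> real^2 \<Rightarrow> complex" where
  "fund_sol k x y = \<i> / 4 * hankel1 0 (k * norm (x - y))"

definition green_tensor ::
  "real \<Rightarrow> real \<Rightarrow> real \<Rightarrow> real \<Rightarrow> real^2 \<Rightarrow> real^2 \<Rightarrow> complex^2^2" where
  "green_tensor \<mu> \<omega> kp ks x y =
     (\<chi> i j. (if i = j then complex_of_real (1 / \<mu>) * fund_sol ks x y else 0)
        + complex_of_real (1 / \<omega>\<^sup>2)
          * pderiv_at i (pderiv_at j (\<lambda>x'. fund_sol ks x' y - fund_sol kp x' y)) x)"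

definition incident_field ::
  "real \<Rightarrow> real \<Rightarrow> real \<Rightarrow> real \<Rightarrow> real^2 \<Rightarrow> real^2 \<Rightarrow> real^2 \<Rightarrow> complex^2" where
  "incident_field \<mu> \<omega> kp ks z pol x = green_tensor \<mu> \<omega> kp ks x z *v cvec pol"

definition lame_op :: "real \<Rightarrow> real \<Rightarrow> (real^2 \<Rightarrow> complex^2) \<Rightarrow> real^2 \<Rightarrow> complex^2" where
  "lame_op lam \<mu> v x = \<mu> *\<^sub>R laplacian v x + (lam + \<mu>) *\<^sub>R grad (divg v) x"

definition navier_on ::
  "real \<Rightarrow> real \<Rightarrow> real \<Rightarrow> (real^2) set \<Rightarrow> (real^2 \<Rightarrow> complex^2) \<Rightarrow> bool" where
  "navier_on lam \<mu> \<omega> S v \<longleftrightarrow> C2_on S v \<and> (\<forall>x\<in>S. lame_op lam \<mu> v x + \<omega>\<^sup>2 *\<^sub>R v x = 0)"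

definition helmholtz_on :: "real \<Rightarrow> (real^2) set \<Rightarrow> (real^2 \<Rightarrow> complex) \<Rightarrow> bool" where
  "helmholtz_on k S f \<longleftrightarrow> C2_on S f \<and> (\<forall>x\<in>S. laplacian f x + k\<^sup>2 *\<^sub>R f x = 0)"

text \<open>The filter \<open>at_infinity\<close> makes the radiation conditions uniform in the direction.\<close>

definition sommerfeld :: "real \<Rightarrow> (real^2 \<Rightarrow> complex) \<Rightarrow> bool" where
  "sommerfeld k f \<longleftrightarrow>
     ((\<lambda>x. sqrt (norm x) *\<^sub>R (d_r f x - \<i> * complex_of_real k * f x)) \<longlongrightarrow> 0) at_infinity"

definition sommerfeld_vec :: "real \<Rightarrow> (real^2 \<Rightarrow> complex^2) \<Rightarrow> bool" where
  "sommerfeld_vec k f \<longleftrightarrow>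
     ((\<lambda>x. sqrt (norm x) *\<^sub>R (d_r f x - (\<i> * complex_of_real k) *s f x)) \<longlongrightarrow> 0) at_infinity"

definition kupradze_sommerfeld :: "real \<Rightarrow> real \<Rightarrow> (real^2 \<Rightarrow> complex^2) \<Rightarrow> bool" where
  "kupradze_sommerfeld kp ks v \<longleftrightarrow>
     sommerfeld_vec kp (\<lambda>x. - (1 / kp\<^sup>2) *\<^sub>R grad (divg v) x) \<and>
     sommerfeld_vec ks (\<lambda>x. - (1 / ks\<^sup>2) *\<^sub>R grad_perp (div_perp v) x)"

definition alpha :: "real \<Rightarrow> real \<Rightarrow> int \<Rightarrow> real \<Rightarrow> complex" where
  "alpha k R n r = complex_of_real k * hankel1_deriv n (k * r) / hankel1 n (k * R)"

definition beta :: "real \<Rightarrow> real \<Rightarrow> int \<Rightarrow> real \<Rightarrow> complex" where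
  "beta k R n r = hankel1 n (k * r) / hankel1 n (k * R)"

definition U_mode :: "int \<Rightarrow> real \<Rightarrow> complex^2" where
  "U_mode n \<theta> = cis (of_int n * \<theta>) *s cvec (e_r \<theta>)"

definition V_mode :: "int \<Rightarrow> real \<Rightarrow> complex^2" where
  "V_mode n \<theta> = cis (of_int n * \<theta>) *s cvec (e_theta \<theta>)"

definition cdot :: "complex^2 \<Rightarrow> complex^2 \<Rightarrow> complex" where
  "cdot a b = (\<Sum>i\<in>UNIV. a $ i * cnj (b $ i))"

definition square_integrable_0_2pi :: "(real \<Rightarrow> 'a::{banach,second_countable_topology}) \<Rightarrow> bool" where
  "square_integrable_0_2pi f \<longleftrightarrow>
     set_borel_measurable lborel {0..2*pi} f \<and> set_integrable lborel {0..2*pi} (\<lambda>\<theta>. (norm (f \<theta>))\<^sup>2)"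

definition fourier_coeff :: "real \<Rightarrow> (real^2 \<Rightarrow> complex) \<Rightarrow> int \<Rightarrow> complex" where
  "fourier_coeff R f n =
     complex_of_real (1 / (2 * pi)) * (LBINT \<theta>:{0..2*pi}. f (polar R \<theta>) * cis (- (of_int n * \<theta>)))"

text \<open>The standing assumption on a potential: it is a radiating solution in the exterior of the disc
  of radius \<open>R\<close>, square integrable on the circle of radius \<open>R\<close>, and given by its Hankel series.\<close>

definition radiating_potential :: "real \<Rightarrow> real \<Rightarrow> (real^2 \<Rightarrow> complex) \<Rightarrow> bool" where
  "radiating_potential k R \<phi> \<longleftrightarrow>
     helmholtz_on k {x. R < norm x} \<phi> \<and> sommerfeld k \<phi> \<and>
     square_integrable_0_2pi (\<lambda>\<theta>. \<phi> (polar R \<theta>)) \<and>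
     (\<forall>r>R. \<forall>\<theta>. ((\<lambda>n. beta k R n r * fourier_coeff R \<phi> n * cis (of_int n * \<theta>))
                    has_sum \<phi> (polar r \<theta>)) (UNIV :: int set))"

definition mode_system ::
  "real \<Rightarrow> real \<Rightarrow> real \<Rightarrow> real \<Rightarrow> int \<Rightarrow> complex^2^2" where
  "mode_system kp ks R \<rho> n =
     vector [vector [alpha kp R n \<rho>, \<i> * of_int n / complex_of_real \<rho> * beta ks R n \<rho>],
             vector [\<i> * of_int n / complex_of_real \<rho> * beta kp R n \<rho>, - alpha ks R n \<rho>]]"

text \<open>Data on the circle of radius \<open>\<rho>\<close> are functions of the angle, so \<open>ds = \<rho> d\<theta>\<close>.\<close>

definition mode_data :: "real \<Rightarrow> (real \<Rightarrow> complex^2) \<Rightarrow> int \<Rightarrow> complex^2" where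
  "mode_data \<rho> g n = complex_of_real (1 / (2 * pi * \<rho>)) *s
     vector [LBINT \<theta>:{0..2*pi}. cdot (g \<theta>) (U_mode n \<theta>) * complex_of_real \<rho>,
             LBINT \<theta>:{0..2*pi}. cdot (g \<theta>) (V_mode n \<theta>) * complex_of_real \<rho>]"

text \<open>Fields near the curves are written as functions of the polar coordinates \<open>r\<close> and \<open>\<theta>\<close>.\<close>

definition mode_sum ::
  "real \<Rightarrow> real \<Rightarrow> real \<Rightarrow> int \<Rightarrow> (int \<Rightarrow> complex^2) \<Rightarrow> real \<Rightarrow> real \<Rightarrow> complex^2" where
  "mode_sum kp ks R N c r \<theta> = (\<Sum>n = -N..N.
       (alpha kp R n r * c n $ 1 + \<i> * of_int n / complex_of_real r * beta ks R n r * c n $ 2) *s U_mode n \<theta>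
     + (\<i> * of_int n / complex_of_real r * beta kp R n r * c n $ 1 - alpha ks R n r * c n $ 2) *s V_mode n \<theta>)"

text \<open>The largest integer smaller than \<open>X + 1\<close> is the ceiling of \<open>X\<close>.\<close>

definition truncation :: "real \<Rightarrow> real \<Rightarrow> real \<Rightarrow> int" where
  "truncation R \<gamma> \<delta> = \<lceil>ln (1 / \<delta>) / ln ((R + \<gamma>) / R)\<rceil>"

definition real_analytic :: "(real \<Rightarrow> real) \<Rightarrow> bool" where
  "real_analytic f \<longleftrightarrow>
     (\<forall>t. \<exists>a. \<exists>e>0. \<forall>s. \<bar>s - t\<bar> < e \<longrightarrow> (\<lambda>n. a n * (s - t) ^ n) sums f s)"

text \<open>A star-shaped curve is given by its radial function of the angle. Neighbourhoods are taken in
  the \<open>C\<^sup>1\<close> sense, so that the arc length of the curves in a neighbourhood is bounded.\<close>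

definition curve_nbhd :: "(real \<Rightarrow> real) \<Rightarrow> real \<Rightarrow> (real \<Rightarrow> real) set" where
  "curve_nbhd p \<kappa> = {q. (\<forall>\<theta>. q (\<theta> + 2 * pi) = q \<theta>) \<and> q C1_differentiable_on UNIV \<and>
     (\<forall>\<theta>. \<bar>q \<theta> - p \<theta>\<bar> \<le> \<kappa> \<and> \<bar>deriv q \<theta> - deriv p \<theta>\<bar> \<le> \<kappa>)}"

definition radial_deriv :: "(real \<Rightarrow> real \<Rightarrow> complex^2) \<Rightarrow> real \<Rightarrow> real \<Rightarrow> complex^2" where
  "radial_deriv f r \<theta> = vector_derivative (\<lambda>s. f s \<theta>) (at r)"

definition L2_curve :: "(real \<Rightarrow> real) \<Rightarrow> (real \<Rightarrow> real \<Rightarrow> complex^2) \<Rightarrow> real" where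
  "L2_curve q f =
     sqrt (LBINT \<theta>:{0..2*pi}. (norm (f (q \<theta>) \<theta>))\<^sup>2 * sqrt ((q \<theta>)\<^sup>2 + (deriv q \<theta>)\<^sup>2))"

definition L2_circle :: "(real \<Rightarrow> real) \<Rightarrow> real" where
  "L2_circle f = sqrt (LBINT \<theta>:{0..2*pi}. (f \<theta>)\<^sup>2)"

definition vquot :: "complex^2 \<Rightarrow> complex^2 \<Rightarrow> complex" where
  "vquot a b = cdot a b / complex_of_real ((norm b)\<^sup>2)"

primrec newton :: "(real \<Rightarrow> real \<Rightarrow> complex^2) \<Rightarrow> (real \<Rightarrow> real) \<Rightarrow> nat \<Rightarrow> real \<Rightarrow> real" where
  "newton u p0 0 = p0"
| "newton u p0 (Suc m) =
     (\<lambda>\<theta>. newton u p0 m \<theta>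
        - Re (vquot (u (newton u p0 m \<theta>) \<theta>) (radial_deriv u (newton u p0 m \<theta>) \<theta>)))"

definition stop_crit ::
  "(real \<Rightarrow> real \<Rightarrow> complex^2) \<Rightarrow> (real \<Rightarrow> real) \<Rightarrow> real \<Rightarrow> nat \<Rightarrow> bool" where
  "stop_crit u p0 tol m \<longleftrightarrow> L2_circle (\<lambda>\<theta>. newton u p0 (Suc m) \<theta> - newton u p0 m \<theta>) \<le> tol"

definition newton_stopped ::
  "(real \<Rightarrow> real \<Rightarrow> complex^2) \<Rightarrow> (real \<Rightarrow> real) \<Rightarrow> real \<Rightarrow> real \<Rightarrow> real" where
  "newton_stopped u p0 tol = newton u p0 (Suc (LEAST m. stop_crit u p0 tol m))"

end

theory Submission
  imports Defs
begin

text \<open>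
  In polar coordinates the iteration decouples. For every angle \<open>\<theta>\<close> it is a Gauss-Newton iteration in
  one real variable \<open>r\<close> for the function \<open>g(r) = u\<^sub>N(r, \<theta>)\<close> with values in \<open>\<complex>\<^sup>2\<close>. The derivative of
  its step map is \<open>O(|g| |g''| / |g'|\<^sup>2)\<close>. So if \<open>|g'| \<ge> 2 \<epsilon>\<close> and \<open>|g'|, |g''| \<le> B\<close> near \<open>p(\<theta>)\<close>, and
  if \<open>g(p(\<theta>))\<close> is small, then the step map is a contraction with factor \<open>1/2\<close> on a fixed interval around
  \<open>p(\<theta>)\<close> and moves \<open>p(\<theta>)\<close> by at most \<open>|g(p(\<theta>))| / (2 \<epsilon>)\<close> (lemma \<open>newton_map_contraction\<close>). Successive
  iterates then differ by \<open>O(2\<^sup>-\<^sup>m)\<close>, uniformly in \<open>\<theta>\<close>, so a positive tolerance is reached. At any step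
  the distance to \<open>p\<close> is at most the last increment plus a multiple of \<open>|g(p)|\<close>
  (lemma \<open>contraction_iterates\<close>). When the criterion stops the iteration, the increment is bounded in
  \<open>L\<^sup>2\<close> by the tolerance, and both quantities tend to zero with \<open>\<delta>\<close>.

  This argument needs bounds on \<open>u\<^sub>N\<close> and on two of its radial derivatives that are uniform in \<open>\<theta>\<close> and
  \<open>\<delta>\<close>, and it needs \<open>u\<^sub>N \<rightarrow> 0\<close> uniformly on the boundary curve, whereas the error functions control only \<open>L\<^sup>2\<close>
  norms along curves. The gap is closed by interior regularity. The error estimate for the zeroth
  iterate holds for every starting curve in the neighbourhood, in particular for all parallel curves \<open>p + t\<close>;
  integrating it over \<open>t\<close> bounds the integral of \<open>|v - v\<^sub>N|\<close> over a two-dimensional tube around the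
  boundary (lemmas \<open>tube_integral_le\<close> and \<open>curve_L1_le_L2\<close>). Each Cartesian component of the fields is
  the sum of two Helmholtz fields with the wave numbers \<open>k\<^sub>p < k\<^sub>s\<close>. The mean of a Helmholtz field over a small
  circle is a fixed multiple of its value at the centre (lemma \<open>circle_integral_eq\<close>), so a suitable
  compactly supported \<open>C\<^sup>2\<close> kernel reproduces fields of both wave numbers at once
  (lemma \<open>two_wave_reproducing\<close>). Differentiating the kernel bounds the field and its first two
  radial derivatives by the integral of its modulus (theorem \<open>two_wave_radial_estimate\<close>).

  For the truncated field \<open>v\<^sub>N\<close>, with noisy coefficients, the decomposition into Helmholtz fields rests on the
  Helmholtz equation for the single modes \<open>H\<^sub>n(k r) e\<^sup>i\<^sup>n\<^sup>\<theta>\<close>, that is, on Bessel's equation for the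
  series that define the Hankel functions (lemmas \<open>reduced_hankel_ode\<close> and \<open>cylinder_wave_helmholtz\<close>).
\<close>

section \<open>Bessel's equation for the Hankel functions\<close>

text \<open>Both Bessel functions of order \<open>n\<close> are \<open>(x / 2)\<^sup>n\<close> times a function \<open>h\<close> of \<open>y = (x / 2)\<^sup>2\<close>, and Bessel's
  equation becomes \<open>y h'' + (n + 1) h' + h = 0\<close>. This form suits the plane: the factor \<open>r\<^sup>n\<close> joins
  \<open>e\<^sup>i\<^sup>n\<^sup>\<theta>\<close> to form the polynomial \<open>(x\<^sub>1 + i x\<^sub>2)\<^sup>n\<close>, and the other factor depends on \<open>r\<^sup>2\<close> only.\<close>

definition bessel_coeff :: "nat \<Rightarrow> nat \<Rightarrow> real" where
  "bessel_coeff n m = (-1) ^ m / (fact m * fact (m + n))"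

definition log_coeff :: "nat \<Rightarrow> nat \<Rightarrow> real" where
  "log_coeff n m = (Digamma (real (m + 1)) + Digamma (real (n + m + 1))) * bessel_coeff n m"

definition principal_part :: "nat \<Rightarrow> real \<Rightarrow> real" where
  "principal_part n y = (\<Sum>m<n. fact (n - m - 1) / fact m * y powi (int m - int n))"

definition reduced_J :: "nat \<Rightarrow> real \<Rightarrow> real" where
  "reduced_J n y = (\<Sum>m. bessel_coeff n m * y ^ m)"

definition reduced_Y :: "nat \<Rightarrow> real \<Rightarrow> real" where
  "reduced_Y n y = (ln y * reduced_J n y - principal_part n y - (\<Sum>m. log_coeff n m * y ^ m)) / pi"

definition reduced_hankel :: "nat \<Rightarrow> real \<Rightarrow> complex" where
  "reduced_hankel n y = Complex (reduced_J n y) (reduced_Y n y)"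

lemma bessel_coeff_rec: "real (Suc m) * real (m + n + 1) * bessel_coeff n (Suc m) = - bessel_coeff n m"
proof -
  have "bessel_coeff n (Suc m)
      = - ((-1) ^ m / ((real (Suc m) * fact m) * (real (m + n + 1) * fact (m + n))))"
    by (simp add: bessel_coeff_def)
  thus ?thesis unfolding bessel_coeff_def
    by (simp add: divide_simps del: of_nat_Suc of_nat_add)
qed

lemma norm_bessel_coeff: "norm (bessel_coeff n m * y ^ m) \<le> \<bar>y\<bar> ^ m / fact m"
proof -
  have "norm (bessel_coeff n m * y ^ m) = \<bar>y\<bar> ^ m / (fact m * fact (m + n))"
    by (simp add: bessel_coeff_def abs_mult power_abs)
  also have "\<dots> \<le> \<bar>y\<bar> ^ m / (fact m * 1)"
    by (intro divide_left_mono mult_left_mono) (auto simp: fact_ge_1)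
  finally show ?thesis by simp
qed

lemma summable_pow_fact: "summable (\<lambda>m. \<bar>y::real\<bar> ^ m / fact m)"
  using summable_exp[of "\<bar>y\<bar>"] by (simp add: field_simps)

lemma summable_bessel_coeff: "summable (\<lambda>m. bessel_coeff n m * y ^ m)"
  by (rule summable_comparison_test'[OF summable_pow_fact[of y]]) (rule norm_bessel_coeff)

text \<open>A linear bound on the digamma values is enough for the logarithmic series to converge everywhere.\<close>

lemma abs_Digamma_le: "\<bar>Digamma (real (m + 1))\<bar> \<le> \<bar>Digamma 1\<bar> + real m"
proof (induction m)
  case (Suc m)
  have "Digamma (real (Suc m + 1)) = Digamma (real (m + 1)) + 1 / real (m + 1)"
    using Digamma_plus1[of "real (m + 1)"] by (simp add: add.commute)
  moreover have "\<bar>1 / real (m + 1)\<bar> \<le> 1" by simp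
  ultimately have "\<bar>Digamma (real (Suc m + 1))\<bar> \<le> \<bar>Digamma (real (m + 1))\<bar> + 1"
    by linarith
  thus ?case using Suc by simp
qed simp

lemma summable_log_coeff: "summable (\<lambda>m. log_coeff n m * y ^ m)"
proof -
  define C where "C = 2 * \<bar>Digamma (1::real)\<bar> + real n + 2"
  have C: "C \<ge> 0" by (simp add: C_def)
  have "norm (log_coeff n m * y ^ m) \<le> C * (\<bar>2 * y\<bar> ^ m / fact m)" for m
  proof -
    have "\<bar>Digamma (real (m + 1)) + Digamma (real (n + m + 1))\<bar> \<le> C + 2 * real m"
      using abs_Digamma_le[of m] abs_Digamma_le[of "n + m"] unfolding C_def by (simp add: add_ac)
    also have "\<dots> \<le> C * (1 + real m)"
      using mult_right_mono[of 2 C "real m"] by (simp add: C_def algebra_simps)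
    also have "\<dots> \<le> C * 2 ^ m"
    proof (rule mult_left_mono)
      have "Suc m \<le> 2 ^ m" by (induction m) auto
      thus "1 + real m \<le> 2 ^ m" using of_nat_mono[of "Suc m" "2 ^ m", where 'a = real] by simp
    qed (rule C)
    finally have "norm (log_coeff n m * y ^ m) \<le> (C * 2 ^ m) * norm (bessel_coeff n m * y ^ m)"
      unfolding log_coeff_def mult.assoc[of _ "bessel_coeff n m"] norm_mult[of "_ + _"] real_norm_def[of "_ + _"]
      by (rule mult_right_mono) simp
    also have "\<dots> \<le> (C * 2 ^ m) * (\<bar>y\<bar> ^ m / fact m)"
      using C by (intro mult_left_mono norm_bessel_coeff) auto
    finally show ?thesis by (simp add: abs_mult power_mult_distrib)
  qed
  thus ?thesis
    by (intro summable_comparison_test'[OF summable_mult[OF summable_pow_fact]])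
qed

text \<open>On power series the operator \<open>y \<partial>\<^sup>2 + (n + 1) \<partial> + 1\<close> acts by a two-term recurrence on the coefficients,
  because \<open>y \<partial>\<^sup>2 + (n + 1) \<partial>\<close> lowers every power by exactly one.\<close>

lemma bessel_operator_powser:
  fixes c :: "nat \<Rightarrow> real"
  assumes c: "\<And>y. summable (\<lambda>m. c m * y ^ m)"
  shows "y * (\<Sum>m. diffs (diffs c) m * y ^ m) + real (n + 1) * (\<Sum>m. diffs c m * y ^ m)
           + (\<Sum>m. c m * y ^ m)
         = (\<Sum>m. (real (Suc m) * real (m + n + 1) * c (Suc m) + c m) * y ^ m)" (is "?l = ?r")
proof -
  have d1: "summable (\<lambda>m. diffs c m * y ^ m)" for y
    by (rule termdiff_converges_all) (rule c)
  have d2: "summable (\<lambda>m. diffs (diffs c) m * y ^ m)" for y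
    by (rule termdiff_converges_all) (rule d1)
  have "(\<lambda>m. y * (diffs (diffs c) m * y ^ m)) sums (y * (\<Sum>m. diffs (diffs c) m * y ^ m))"
    by (intro sums_mult summable_sums d2)
  also have "(\<lambda>m. y * (diffs (diffs c) m * y ^ m)) = (\<lambda>m. real (Suc m) * diffs c (Suc m) * y ^ Suc m)"
    by (simp add: diffs_def fun_eq_iff algebra_simps)
  finally have "(\<lambda>m. real m * diffs c m * y ^ m) sums (y * (\<Sum>m. diffs (diffs c) m * y ^ m))"
    by (subst (asm) sums_Suc_iff) simp
  from sums_add[OF sums_add[OF this sums_mult[OF summable_sums[OF d1], of "real (n + 1)"]]
      summable_sums[OF c]]
  have "(\<lambda>m. real m * diffs c m * y ^ m + real (n + 1) * (diffs c m * y ^ m) + c m * y ^ m) sums ?l" .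
  also have "(\<lambda>m. real m * diffs c m * y ^ m + real (n + 1) * (diffs c m * y ^ m) + c m * y ^ m)
     = (\<lambda>m. (real (Suc m) * real (m + n + 1) * c (Suc m) + c m) * y ^ m)"
    by (simp add: diffs_def fun_eq_iff algebra_simps)
  finally show ?thesis by (simp add: sums_iff)
qed

text \<open>For each exponent \<open>k\<close> the operator \<open>y \<partial>\<^sup>2 + (n + 1) \<partial> + 1\<close> maps \<open>y\<^sup>k\<close> to
  \<open>k (k + n) y\<^sup>k\<^sup>-\<^sup>1 + y\<^sup>k\<close>, so the terms of the principal part telescope to its last one.\<close>

lemma principal_part_ode:
  "\<exists>P' P''. (\<forall>t>0. (principal_part n has_field_derivative P' t) (at t)) \<and>
     (\<forall>t>0. (P' has_field_derivative P'' t) (at t)) \<and>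
     (\<forall>t>0. t * P'' t + real (n + 1) * P' t + principal_part n t = real n / (fact n * t))"
proof -
  define f :: "nat \<Rightarrow> real" where "f m = fact (n - m - 1) / fact m" for m
  define e :: "nat \<Rightarrow> int" where "e m = int m - int n" for m
  define P1 where "P1 t = (\<Sum>m<n. f m * (of_int (e m) * t powi (e m - 1)))" for t :: real
  define P2 where "P2 t = (\<Sum>m<n. f m * (of_int (e m) * (of_int (e m - 1) * t powi (e m - 1 - 1))))" for t :: real
  have 1: "(principal_part n has_field_derivative P1 t) (at t)" if "t > 0" for t
    unfolding principal_part_def P1_def f_def e_def
    using that by (auto intro!: derivative_eq_intros sum.cong)
  have 2: "(P1 has_field_derivative P2 t) (at t)" if "t > 0" for t
    unfolding P1_def P2_def using that by (auto intro!: derivative_eq_intros sum.cong)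
  have 3: "t * P2 t + real (n + 1) * P1 t + principal_part n t = real n / (fact n * t)" if t: "t > 0" for t
  proof -
    define s where "s m = (if m = 0 then 0 else f (m - 1) * t powi (e m - 1))" for m
    have "t * P2 t + real (n + 1) * P1 t + principal_part n t =
      (\<Sum>m<n. t * (f m * (of_int (e m) * (of_int (e m - 1) * t powi (e m - 1 - 1))))
         + real (n + 1) * (f m * (of_int (e m) * t powi (e m - 1))) + f m * t powi e m)"
      unfolding P2_def P1_def principal_part_def f_def e_def
      by (simp add: sum.distrib sum_distrib_left)
    also have "\<dots> = (\<Sum>m<n. s (Suc m) - s m)"
    proof (rule sum.cong)
      fix m assume m: "m \<in> {..<n}"
      have p: "t * t powi (e m - 1 - 1) = t powi (e m - 1)"
        using t power_int_add_1[of t "e m - 1 - 1"] by (simp add: mult.commute)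
      have "s m = real m * real (n - m) * f m * t powi (e m - 1)"
      proof (cases m)
        case (Suc k)
        have "n - k - 1 = Suc (n - m - 1)" using m Suc by simp
        hence "f k = real (Suc (n - m - 1)) * fact (n - m - 1) / fact k"
          unfolding f_def by (simp only: fact_Suc)
        moreover have "Suc (n - m - 1) = n - m" using m by auto
        ultimately have "f k = real m * real (n - m) * f m"
          unfolding f_def Suc by (simp add: divide_simps del: of_nat_Suc)
        thus ?thesis unfolding s_def using Suc by simp
      qed (simp add: s_def)
      moreover have "s (Suc m) = f m * t powi e m" by (simp add: s_def e_def)
      moreover have "t * (f m * (of_int (e m) * (of_int (e m - 1) * t powi (e m - 1 - 1))))
         = f m * of_int (e m) * of_int (e m - 1) * t powi (e m - 1)"
        by (simp add: p[symmetric])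
      ultimately show "t * (f m * (of_int (e m) * (of_int (e m - 1) * t powi (e m - 1 - 1))))
         + real (n + 1) * (f m * (of_int (e m) * t powi (e m - 1))) + f m * t powi e m = s (Suc m) - s m"
        using m by (simp add: e_def of_nat_diff algebra_simps)
    qed simp
    also have "\<dots> = s n" by (subst sum_lessThan_telescope) (simp add: s_def)
    also have "\<dots> = real n / (fact n * t)"
    proof (cases n)
      case (Suc k)
      have "real (Suc k) / (fact (Suc k) * t) = 1 / (fact k * t)"
        by (simp add: fact_Suc del: of_nat_Suc)
      thus ?thesis using Suc by (simp add: s_def f_def e_def power_int_minus divide_simps)
    qed (simp add: s_def)
    finally show ?thesis .
  qed
  from 1 2 3 show ?thesis by blast
qed

lemma reduced_J_ode:
  "\<exists>J' J''. (\<forall>y. (reduced_J n has_field_derivative J' y) (at y)) \<and>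
     (\<forall>y. (J' has_field_derivative J'' y) (at y)) \<and>
     (\<forall>y. y * J'' y + real (n + 1) * J' y + reduced_J n y = 0) \<and>
     (\<forall>y. J' y = (\<Sum>m. diffs (bessel_coeff n) m * y ^ m))"
proof -
  let ?a = "bessel_coeff n"
  have d: "summable (\<lambda>m. diffs ?a m * y ^ m)" for y
    by (rule termdiff_converges_all) (rule summable_bessel_coeff)
  have "real (Suc m) * real (m + n + 1) * ?a (Suc m) + ?a m = 0" for m
    using bessel_coeff_rec[of m n] by linarith
  hence "y * (\<Sum>m. diffs (diffs ?a) m * y ^ m) + real (n + 1) * (\<Sum>m. diffs ?a m * y ^ m)
      + reduced_J n y = 0" for y
    unfolding reduced_J_def bessel_operator_powser[OF summable_bessel_coeff]
    by (simp only: mult_zero_left suminf_zero)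
  moreover have "(reduced_J n has_field_derivative (\<Sum>m. diffs ?a m * y ^ m)) (at y)" for y
    unfolding reduced_J_def[abs_def]
    by (intro termdiffs_strong_converges_everywhere summable_bessel_coeff)
  moreover have "((\<lambda>y. \<Sum>m. diffs ?a m * y ^ m) has_field_derivative
      (\<Sum>m. diffs (diffs ?a) m * y ^ m)) (at y)" for y
    by (intro termdiffs_strong_converges_everywhere d)
  ultimately show ?thesis
    by (intro exI[of _ "\<lambda>y. \<Sum>m. diffs ?a m * y ^ m"]
        exI[of _ "\<lambda>y. \<Sum>m. diffs (diffs ?a) m * y ^ m"]) simp
qed

text \<open>The operator sends \<open>ln y\<close> times \<open>J\<close> to \<open>2 J' + n J / y\<close>. The logarithmic series yields the same
  expression except for the term \<open>n / (n! y)\<close>, which is what the principal part yields.\<close>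

lemma reduced_Y_ode:
  "\<exists>Y' Y''. (\<forall>y>0. (reduced_Y n has_field_derivative Y' y) (at y)) \<and>
     (\<forall>y>0. (Y' has_field_derivative Y'' y) (at y)) \<and>
     (\<forall>y>0. y * Y'' y + real (n + 1) * Y' y + reduced_Y n y = 0)"
proof -
  let ?a = "bessel_coeff n" and ?b = "log_coeff n"
  define B where "B y = (\<Sum>m. ?b m * y ^ m)" for y :: real
  define B1 where "B1 y = (\<Sum>m. diffs ?b m * y ^ m)" for y :: real
  define B2 where "B2 y = (\<Sum>m. diffs (diffs ?b) m * y ^ m)" for y :: real
  obtain J1 J2 where J: "\<And>y. (reduced_J n has_field_derivative J1 y) (at y)"
     "\<And>y. (J1 has_field_derivative J2 y) (at y)"
     "\<And>y. y * J2 y + real (n + 1) * J1 y + reduced_J n y = 0"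
     "\<And>y. J1 y = (\<Sum>m. diffs ?a m * y ^ m)"
    using reduced_J_ode[of n] by blast
  obtain P1 P2 where P: "\<And>y. y > 0 \<Longrightarrow> (principal_part n has_field_derivative P1 y) (at y)"
     "\<And>y. y > 0 \<Longrightarrow> (P1 has_field_derivative P2 y) (at y)"
     "\<And>y. y > 0 \<Longrightarrow> y * P2 y + real (n + 1) * P1 y + principal_part n y = real n / (fact n * y)"
    using principal_part_ode[of n] by blast
  have d: "summable (\<lambda>m. diffs ?b m * y ^ m)" for y
    by (rule termdiff_converges_all) (rule summable_log_coeff)
  have B: "(B has_field_derivative B1 y) (at y)" "(B1 has_field_derivative B2 y) (at y)" for y
    unfolding B_def[abs_def] B1_def[abs_def] B2_def
    by (intro termdiffs_strong_converges_everywhere summable_log_coeff d)+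
  \<comment> \<open>the recurrence of the digamma function turns the defect of the logarithmic coefficients
    into multiples of the Bessel coefficients\<close>
  have rec: "real (Suc m) * real (m + n + 1) * ?b (Suc m) + ?b m = real (2 * (m + 1) + n) * ?a (Suc m)" for m
  proof -
    have D: "Digamma (real (Suc m + 1)) = Digamma (real (m + 1)) + 1 / real (Suc m)"
            "Digamma (real (n + Suc m + 1)) = Digamma (real (n + m + 1)) + 1 / real (m + n + 1)"
      using Digamma_plus1[of "real (m + 1)"] Digamma_plus1[of "real (n + m + 1)"]
      by (simp_all add: add_ac)
    have a: "?a m = - (real (Suc m) * real (m + n + 1) * ?a (Suc m))"
      using bessel_coeff_rec[of m n] by simp
    have "S * T * ((d1 + 1 / S + (d2 + 1 / T)) * A) + (d1 + d2) * - (S * T * A) = (T + S) * A"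
      if "S \<noteq> 0" "T \<noteq> 0" for S T d1 d2 A :: real
      using that by (simp add: field_simps)
    from this[of "real (Suc m)" "real (m + n + 1)"] show ?thesis
      unfolding log_coeff_def D a by (simp del: of_nat_Suc)
  qed
  have LB: "y * B2 y + real (n + 1) * B1 y + B y = 2 * J1 y + real n * (reduced_J n y - 1 / fact n) / y"
    if "y > 0" for y
  proof -
    have "y * B2 y + real (n + 1) * B1 y + B y = (\<Sum>m. real (2 * (m + 1) + n) * ?a (Suc m) * y ^ m)"
      unfolding B_def B1_def B2_def bessel_operator_powser[OF summable_log_coeff] rec ..
    also have "(\<lambda>m. real (2 * (m + 1) + n) * ?a (Suc m) * y ^ m) =
        (\<lambda>m. 2 * (diffs ?a m * y ^ m) + real n * (?a (Suc m) * y ^ Suc m) / y)"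
      using that by (auto simp: diffs_def fun_eq_iff field_simps)
    also have "(\<Sum>m. 2 * (diffs ?a m * y ^ m) + real n * (?a (Suc m) * y ^ Suc m) / y) =
        2 * J1 y + real n * (reduced_J n y - 1 / fact n) / y"
    proof -
      have "(\<lambda>m. ?a m * y ^ m) sums reduced_J n y"
        unfolding reduced_J_def by (intro summable_sums summable_bessel_coeff)
      hence "(\<lambda>m. ?a (Suc m) * y ^ Suc m) sums (reduced_J n y - 1 / fact n)"
        by (subst sums_Suc_iff) (simp add: bessel_coeff_def)
      hence "(\<lambda>m. real n * (?a (Suc m) * y ^ Suc m) / y) sums (real n * (reduced_J n y - 1 / fact n) / y)"
        by (intro sums_divide sums_mult)
      moreover have "(\<lambda>m. 2 * (diffs ?a m * y ^ m)) sums (2 * J1 y)"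
        unfolding J(4) by (intro sums_mult summable_sums termdiff_converges_all summable_bessel_coeff)
      ultimately show ?thesis by (intro sums_unique[symmetric] sums_add)
    qed
    finally show ?thesis .
  qed
  define Y1 where "Y1 y = (reduced_J n y / y + ln y * J1 y - P1 y - B1 y) / pi" for y
  define Y2 where "Y2 y = (- reduced_J n y / y\<^sup>2 + 2 * J1 y / y + ln y * J2 y - P2 y - B2 y) / pi" for y
  have "(reduced_Y n has_field_derivative Y1 y) (at y)" if "y > 0" for y
    unfolding reduced_Y_def[abs_def] B_def[symmetric] Y1_def using that
    by (auto intro!: derivative_eq_intros J(1) P(1) B(1) simp: field_simps)
  moreover have "(Y1 has_field_derivative Y2 y) (at y)" if "y > 0" for y
    unfolding Y1_def[abs_def] Y2_def using that
    by (auto intro!: derivative_eq_intros J(1,2) P(2) B(2) simp: field_simps power2_eq_square)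
  moreover have "y * Y2 y + real (n + 1) * Y1 y + reduced_Y n y = 0" if y: "y > 0" for y
  proof -
    let ?J = "reduced_J n y" and ?L = "ln y"
    have "pi * (y * Y2 y + real (n + 1) * Y1 y + reduced_Y n y) =
        ?L * (y * J2 y + real (n + 1) * J1 y + ?J) + (2 * J1 y + real n * ?J / y)
        - (y * P2 y + real (n + 1) * P1 y + principal_part n y)
        - (y * B2 y + real (n + 1) * B1 y + B y)"
      unfolding Y1_def Y2_def reduced_Y_def B_def using y
      by (simp add: field_simps power2_eq_square)
    also have "\<dots> = 0"
      unfolding J(3) P(3)[OF y] LB[OF y] using y by (simp add: field_simps)
    finally show ?thesis by simp
  qed
  ultimately show ?thesis by blast
qed

lemma reduced_hankel_ode:
  "\<exists>h' h''. (\<forall>y>0. (reduced_hankel n has_vector_derivative h' y) (at y)) \<and>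
     (\<forall>y>0. (h' has_vector_derivative h'' y) (at y)) \<and>
     (\<forall>y>0. y *\<^sub>R h'' y + real (n + 1) *\<^sub>R h' y + reduced_hankel n y = 0)"
proof -
  obtain J1 J2 where J: "\<And>y. (reduced_J n has_field_derivative J1 y) (at y)"
     "\<And>y. (J1 has_field_derivative J2 y) (at y)"
     "\<And>y. y * J2 y + real (n + 1) * J1 y + reduced_J n y = 0"
    using reduced_J_ode[of n] by blast
  obtain Y1 Y2 where Y: "\<And>y. y > 0 \<Longrightarrow> (reduced_Y n has_field_derivative Y1 y) (at y)"
     "\<And>y. y > 0 \<Longrightarrow> (Y1 has_field_derivative Y2 y) (at y)"
     "\<And>y. y > 0 \<Longrightarrow> y * Y2 y + real (n + 1) * Y1 y + reduced_Y n y = 0"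
    using reduced_Y_ode[of n] by blast
  have C: "((\<lambda>y. Complex (a y) (b y)) has_vector_derivative Complex a' b') (at y)"
    if "(a has_field_derivative a') (at y)" "(b has_field_derivative b') (at y)" for a b a' b' y
    using that unfolding has_vector_derivative_complex_iff has_real_derivative_iff_has_vector_derivative
    by (simp add: has_real_derivative_iff_has_vector_derivative)
  show ?thesis
  proof (intro exI conjI allI impI)
    fix y :: real assume y: "y > 0"
    show "(reduced_hankel n has_vector_derivative Complex (J1 y) (Y1 y)) (at y)"
      unfolding reduced_hankel_def[abs_def] by (intro C J Y y)
    show "((\<lambda>y. Complex (J1 y) (Y1 y)) has_vector_derivative Complex (J2 y) (Y2 y)) (at y)"
      by (intro C J Y y)
    show "y *\<^sub>R Complex (J2 y) (Y2 y) + real (n + 1) *\<^sub>R Complex (J1 y) (Y1 y) + reduced_hankel n y = 0"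
      using J(3)[of y] Y(3)[OF y] by (simp add: reduced_hankel_def complex_eq_iff)
  qed
qed

lemma hankel1_eq_reduced:
  assumes x: "x > 0"
  shows "hankel1 n x = (if n < 0 then (-1) ^ nat (- n) else 1) *
    (of_real ((x / 2) ^ nat \<bar>n\<bar>) * reduced_hankel (nat \<bar>n\<bar>) ((x / 2)\<^sup>2))"
proof -
  define m where "m = nat \<bar>n\<bar>"
  define y where "y = (x / 2)\<^sup>2"
  have pw: "(x / 2) ^ (2 * k + m) = (x / 2) ^ m * y ^ k" for k
    unfolding y_def power_add power_mult by (rule mult.commute)
  have J: "bessel_J m x = (x / 2) ^ m * reduced_J m y"
  proof -
    have "bessel_J m x = (\<Sum>k. (x / 2) ^ m * (bessel_coeff m k * y ^ k))"
      unfolding bessel_J_def pw bessel_coeff_def by (simp add: mult_ac)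
    thus ?thesis unfolding reduced_J_def by (simp add: suminf_mult summable_bessel_coeff)
  qed
  have B: "(\<Sum>k. (Digamma (real (k + 1)) + Digamma (real (m + k + 1)))
                      * ((-1) ^ k / (fact k * fact (m + k))) * (x / 2) ^ (2 * k + m))
     = (x / 2) ^ m * (\<Sum>k. log_coeff m k * y ^ k)"
  proof -
    have "(\<Sum>k. (Digamma (real (k + 1)) + Digamma (real (m + k + 1)))
                      * ((-1) ^ k / (fact k * fact (m + k))) * (x / 2) ^ (2 * k + m)) =
       (\<Sum>k. (x / 2) ^ m * (log_coeff m k * y ^ k))"
      unfolding pw log_coeff_def bessel_coeff_def by (simp add: mult_ac add.commute)
    thus ?thesis by (simp add: suminf_mult summable_log_coeff)
  qed
  have P: "(\<Sum>k<m. fact (m - k - 1) / fact k * (x / 2) powi (2 * int k - int m))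
     = (x / 2) ^ m * principal_part m y"
  proof -
    have "(x / 2) powi (2 * int k - int m) = (x / 2) ^ m * y powi (int k - int m)" for k
    proof -
      have "y powi (int k - int m) = (x / 2) powi (2 * (int k - int m))"
        unfolding y_def by (subst power_int_mult) simp
      moreover have "(x / 2) powi (2 * int k - int m) = (x / 2) powi (int m + 2 * (int k - int m))"
        by simp
      moreover have "(x / 2) powi (int m + 2 * (int k - int m)) = (x / 2) powi int m * (x / 2) powi (2 * (int k - int m))"
        by (rule power_int_add) (use x in auto)
      ultimately show ?thesis by (simp only: power_int_of_nat)
    qed
    thus ?thesis unfolding principal_part_def by (simp add: sum_distrib_left mult_ac)
  qed
  have L: "ln y = 2 * ln (x / 2)" using x by (simp add: y_def ln_realpow)
  have "bessel_Y m x = (x / 2) ^ m * reduced_Y m y"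
    unfolding bessel_Y_def B P J reduced_Y_def L by (simp add: field_simps)
  thus ?thesis
    unfolding hankel1_def reduced_hankel_def m_def[symmetric] y_def[symmetric] J
    by (simp add: complex_eq_iff)
qed

section \<open>Circle means of Helmholtz fields\<close>

lemma has_derivative_partials:
  fixes f :: "real^2 \<Rightarrow> 'a::real_normed_vector"
  assumes "f differentiable (at x)"
  shows "(f has_derivative (\<lambda>h. h$1 *\<^sub>R pderiv_at 1 f x + h$2 *\<^sub>R pderiv_at 2 f x)) (at x)"
proof -
  let ?D = "frechet_derivative f (at x)"
  have D: "(f has_derivative ?D) (at x)" using assms by (simp add: frechet_derivative_works)
  then interpret bounded_linear ?D by (rule has_derivative_bounded_linear)
  have "?D h = h$1 *\<^sub>R pderiv_at 1 f x + h$2 *\<^sub>R pderiv_at 2 f x" for h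
  proof -
    have "h = h$1 *\<^sub>R axis 1 1 + h$2 *\<^sub>R axis 2 1"
      by (simp add: vec_eq_iff forall_2 axis_def)
    hence "?D h = ?D (h$1 *\<^sub>R axis 1 1 + h$2 *\<^sub>R axis 2 1)" by simp
    thus ?thesis by (simp add: add scaleR pderiv_at_def)
  qed
  hence "?D = (\<lambda>h. h$1 *\<^sub>R pderiv_at 1 f x + h$2 *\<^sub>R pderiv_at 2 f x)" by blast
  thus ?thesis using D by simp
qed

lemma pderiv_at_eqI:
  fixes f :: "real^2 \<Rightarrow> 'a::real_normed_vector"
  assumes "(f has_derivative (\<lambda>h. h$1 *\<^sub>R g 1 + h$2 *\<^sub>R g 2)) (at x)"
  shows "pderiv_at i f x = g i"
proof -
  have "frechet_derivative f (at x) = (\<lambda>h. h$1 *\<^sub>R g 1 + h$2 *\<^sub>R g 2)"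
    using frechet_derivative_at[OF assms] by simp
  thus ?thesis using exhaust_2[of i] by (auto simp: pderiv_at_def axis_def)
qed

lemma pderiv_at_chain:
  fixes f :: "real^2 \<Rightarrow> 'a::real_normed_vector"
  assumes "f differentiable (at (\<gamma> t))" "(\<gamma> has_vector_derivative \<gamma>') (at t within T)"
  shows "((\<lambda>t. f (\<gamma> t)) has_vector_derivative
     (\<gamma>'$1 *\<^sub>R pderiv_at 1 f (\<gamma> t) + \<gamma>'$2 *\<^sub>R pderiv_at 2 f (\<gamma> t))) (at t within T)"
  using has_derivative_compose[OF assms(2)[unfolded has_vector_derivative_def] has_derivative_partials[OF assms(1)]]
  unfolding has_vector_derivative_def by (simp add: algebra_simps)

lemma C2_onI:
  fixes f :: "real^2 \<Rightarrow> 'a::real_normed_vector" and g :: "2 \<Rightarrow> real^2 \<Rightarrow> 'a"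
  assumes S: "open S"
    and f: "\<And>x. x \<in> S \<Longrightarrow> (f has_derivative (\<lambda>h. h$1 *\<^sub>R g 1 x + h$2 *\<^sub>R g 2 x)) (at x)"
    and g: "\<And>i x. x \<in> S \<Longrightarrow> (g i has_derivative (\<lambda>h. h$1 *\<^sub>R G i 1 x + h$2 *\<^sub>R G i 2 x)) (at x)"
    and G: "\<And>i j. continuous_on S (G i j)"
  shows "C2_on S f" "\<And>i x. x \<in> S \<Longrightarrow> pderiv_at i f x = g i x"
    "\<And>i j x. x \<in> S \<Longrightarrow> pderiv_at j (pderiv_at i f) x = G i j x"
proof -
  show 1: "pderiv_at i f x = g i x" if "x \<in> S" for i x
    using pderiv_at_eqI[OF f[OF that], of i] .
  have 2: "(pderiv_at i f has_derivative (\<lambda>h. h$1 *\<^sub>R G i 1 x + h$2 *\<^sub>R G i 2 x)) (at x)" if "x \<in> S" for i x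
    by (rule has_derivative_transform_within_open[OF g[OF that] S that]) (simp add: 1)
  show 3: "pderiv_at j (pderiv_at i f) x = G i j x" if "x \<in> S" for i j x
    using pderiv_at_eqI[OF 2[OF that]] .
  have "continuous_on S (pderiv_at i f)" for i
    by (intro continuous_at_imp_continuous_on ballI has_derivative_continuous[OF 2])
  moreover have "continuous_on S (pderiv_at j (pderiv_at i f))" for i j
    using G[of i j] by (rule continuous_on_eq) (simp add: 3)
  ultimately show "C2_on S f"
    unfolding C2_on_def C1_on_def using f 2 by (meson differentiableI)
qed

lemma e_r_derivative:
  "(e_r has_vector_derivative e_theta \<phi>) (at \<phi> within T)"
  "(e_theta has_vector_derivative - e_r \<phi>) (at \<phi> within T)"
proof -
  have *: "((\<lambda>\<phi>. vector [f \<phi>, g \<phi>] :: real^2) has_vector_derivative vector [f', g']) (at \<phi> within T)"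
    if "(f has_vector_derivative f') (at \<phi> within T)" "(g has_vector_derivative g') (at \<phi> within T)"
    for f g f' g'
  proof -
    have e: "vector [a, b] = a *\<^sub>R axis 1 1 + b *\<^sub>R (axis 2 1 :: real^2)" for a b
      by (simp add: vec_eq_iff forall_2 axis_def)
    show ?thesis unfolding e
      by (intro has_vector_derivative_add bounded_linear.has_vector_derivative[OF bounded_linear_scaleR_left] that)
  qed
  show "(e_r has_vector_derivative e_theta \<phi>) (at \<phi> within T)"
    unfolding e_r_def[abs_def] e_theta_def
    by (rule *) (auto intro!: derivative_eq_intros simp flip: has_real_derivative_iff_has_vector_derivative)
  have "- e_r \<phi> = vector [- cos \<phi>, - sin \<phi>]"
    by (simp add: e_r_def vec_eq_iff forall_2)
  thus "(e_theta has_vector_derivative - e_r \<phi>) (at \<phi> within T)"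
    unfolding e_theta_def[abs_def]
    by (simp only:, intro *) (auto intro!: derivative_eq_intros simp flip: has_real_derivative_iff_has_vector_derivative)
qed

lemma e_r_simps [simp]:
  "e_r \<phi> $ 1 = cos \<phi>" "e_r \<phi> $ 2 = sin \<phi>" "e_theta \<phi> $ 1 = - sin \<phi>" "e_theta \<phi> $ 2 = cos \<phi>"
  "norm (e_r \<phi>) = 1"
  by (simp_all add: e_r_def e_theta_def norm_eq_sqrt_inner inner_vec_def sum_2)

lemma continuous_on_e_r [continuous_intros]:
  "continuous_on T f \<Longrightarrow> continuous_on T (\<lambda>x. e_r (f x))"
  by (rule continuous_on_compose2[of UNIV e_r])
    (auto intro!: continuous_at_imp_continuous_on has_vector_derivative_continuous e_r_derivative)

text \<open>Radial differentiation of the circle mean: twice, with the polar Laplacian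
  \<open>t \<partial>\<^sub>t\<^sup>2 + \<partial>\<^sub>t + t\<^sup>-\<^sup>1 \<partial>\<^sub>\<phi>\<^sup>2 = t \<Delta>\<close>, whose angular part integrates to zero over the circle.\<close>

lemma circle_integral_ode:
  fixes f :: "real^2 \<Rightarrow> 'a::banach"
  assumes C2: "C2_on S f" and eq: "\<And>y. y \<in> S \<Longrightarrow> laplacian f y + k\<^sup>2 *\<^sub>R f y = 0"
    and T: "cball x T \<subseteq> S"
  defines "M \<equiv> \<lambda>t. integral {0..2*pi} (\<lambda>\<phi>. f (x + t *\<^sub>R e_r \<phi>))"
  shows "\<exists>L. \<forall>t\<in>{0..T}. (M has_vector_derivative L t) (at t within {0..T}) \<and>
     ((\<lambda>t. t *\<^sub>R L t) has_vector_derivative (- k\<^sup>2 * t) *\<^sub>R M t) (at t within {0..T})"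
proof -
  define g where "g i = pderiv_at i f" for i
  define G where "G i j = pderiv_at j (pderiv_at i f)" for i j
  define c where "c t \<phi> = x + t *\<^sub>R e_r \<phi>" for t \<phi>
  have cS: "c t \<phi> \<in> S" if "t \<in> {0..T}" for t \<phi>
  proof -
    have "dist x (c t \<phi>) \<le> T" using that by (simp add: c_def dist_norm)
    thus ?thesis using T by auto
  qed
  have fd: "f differentiable (at y)" "g i differentiable (at y)" if "y \<in> S" for y i
    using C2 that by (auto simp: C2_on_def C1_on_def g_def)
  have cont: "continuous_on S f" "continuous_on S (g i)" "continuous_on S (G i j)" for i j
    using C2 by (auto simp: C2_on_def C1_on_def g_def G_def
        intro: differentiable_imp_continuous_on differentiable_at_imp_differentiable_on)
  have ct: "((\<lambda>t. c t \<phi>) has_vector_derivative e_r \<phi>) (at t within A)" for t \<phi> A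
    unfolding c_def by (auto intro!: derivative_eq_intros)
  have c\<phi>: "((\<lambda>\<phi>. c t \<phi>) has_vector_derivative t *\<^sub>R e_theta \<phi>) (at \<phi> within A)" for t \<phi> A
    unfolding c_def by (auto intro!: derivative_eq_intros e_r_derivative)
  have comp: "continuous_on ({0..T} \<times> {0..2*pi}) (\<lambda>(t, \<phi>). F (c t \<phi>))"
    if "continuous_on S F" for F :: "real^2 \<Rightarrow> 'a"
    unfolding case_prod_beta
    by (rule continuous_on_compose2[OF that])
      (auto simp: cS, auto simp: c_def intro!: continuous_intros)
  have comp1: "continuous_on {0..2*pi} (\<lambda>\<phi>. F (c t \<phi>))" if "continuous_on S F" "t \<in> {0..T}"
    for F :: "real^2 \<Rightarrow> 'a" and t
    by (rule continuous_on_compose2[OF that(1)])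
      (auto simp: cS that(2)[simplified], auto simp: c_def intro!: continuous_intros)
  define P where "P t \<phi> = cos \<phi> *\<^sub>R g 1 (c t \<phi>) + sin \<phi> *\<^sub>R g 2 (c t \<phi>)" for t \<phi>
  define P' where "P' t \<phi> = cos \<phi> *\<^sub>R (cos \<phi> *\<^sub>R G 1 1 (c t \<phi>) + sin \<phi> *\<^sub>R G 1 2 (c t \<phi>))
     + sin \<phi> *\<^sub>R (cos \<phi> *\<^sub>R G 2 1 (c t \<phi>) + sin \<phi> *\<^sub>R G 2 2 (c t \<phi>))" for t \<phi>
  define Q where "Q t \<phi> = - sin \<phi> *\<^sub>R g 1 (c t \<phi>) + cos \<phi> *\<^sub>R g 2 (c t \<phi>)" for t \<phi>
  define Q' where "Q' t \<phi> = - P t \<phi>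
     + t *\<^sub>R (- sin \<phi> *\<^sub>R (- sin \<phi> *\<^sub>R G 1 1 (c t \<phi>) + cos \<phi> *\<^sub>R G 1 2 (c t \<phi>))
     + cos \<phi> *\<^sub>R (- sin \<phi> *\<^sub>R G 2 1 (c t \<phi>) + cos \<phi> *\<^sub>R G 2 2 (c t \<phi>)))" for t \<phi>
  define L where "L t = integral {0..2*pi} (P t)" for t
  have contP: "continuous_on ({0..T} \<times> {0..2*pi}) (\<lambda>(t, \<phi>). P t \<phi>)"
    using comp[OF cont(2)[of 1]] comp[OF cont(2)[of 2]]
    unfolding P_def case_prod_beta by (auto intro!: continuous_intros)
  have contP': "continuous_on ({0..T} \<times> {0..2*pi}) (\<lambda>(t, \<phi>). P t \<phi> + t *\<^sub>R P' t \<phi>)"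
    using contP comp[OF cont(3)[of 1 1]] comp[OF cont(3)[of 1 2]] comp[OF cont(3)[of 2 1]] comp[OF cont(3)[of 2 2]]
    unfolding P'_def case_prod_beta by (auto intro!: continuous_intros)
  have intP: "P t integrable_on {0..2*pi}" if "t \<in> {0..T}" for t
    unfolding P_def using comp1[OF cont(2) that]
    by (intro integrable_continuous_interval) (auto intro!: continuous_intros)
  have 1: "((\<lambda>t. integral (cbox 0 (2*pi)) (\<lambda>\<phi>. f (x + t *\<^sub>R e_r \<phi>))) has_vector_derivative
      integral (cbox 0 (2*pi)) (P t)) (at t within {0..T})" if t: "t \<in> {0..T}" for t
  proof (rule leibniz_rule_vector_derivative)
    show "((\<lambda>t. f (x + t *\<^sub>R e_r \<phi>)) has_vector_derivative P t \<phi>) (at t within {0..T})"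
      if "t \<in> {0..T}" for t \<phi>
      using pderiv_at_chain[OF fd(1)[OF cS[OF that]] ct, where T = "{0..T}"]
      unfolding P_def g_def c_def by simp
    show "(\<lambda>\<phi>. f (x + t *\<^sub>R e_r \<phi>)) integrable_on cbox 0 (2*pi)" if "t \<in> {0..T}" for t
      using comp1[OF cont(1) that] unfolding c_def cbox_interval by (rule integrable_continuous_interval)
  qed (use t contP in auto)
  have "((\<lambda>t. integral (cbox 0 (2*pi)) (\<lambda>\<phi>. t *\<^sub>R P t \<phi>)) has_vector_derivative
      integral (cbox 0 (2*pi)) (\<lambda>\<phi>. P t \<phi> + t *\<^sub>R P' t \<phi>)) (at t within {0..T})" if t: "t \<in> {0..T}" for t
  proof (rule leibniz_rule_vector_derivative)
    show "((\<lambda>t. t *\<^sub>R P t \<phi>) has_vector_derivative P t \<phi> + t *\<^sub>R P' t \<phi>) (at t within {0..T})"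
      if "t \<in> {0..T}" for t \<phi>
    proof -
      have "((\<lambda>t. P t \<phi>) has_vector_derivative P' t \<phi>) (at t within {0..T})"
        using pderiv_at_chain[OF fd(2)[OF cS[OF that], of 1] ct, where T = "{0..T}"]
          pderiv_at_chain[OF fd(2)[OF cS[OF that], of 2] ct, where T = "{0..T}"]
        unfolding P_def P'_def G_def g_def[symmetric]
        by (auto intro!: derivative_eq_intros)
      thus ?thesis by (auto intro!: derivative_eq_intros)
    qed
    show "(\<lambda>\<phi>. t *\<^sub>R P t \<phi>) integrable_on cbox 0 (2*pi)" if "t \<in> {0..T}" for t
      using integrable_cmul[OF intP[OF that]] by (simp add: cbox_interval)
  qed (use t contP' in auto)
  moreover have "integral (cbox 0 (2*pi)) (\<lambda>\<phi>. P t \<phi> + t *\<^sub>R P' t \<phi>) = (- k\<^sup>2 * t) *\<^sub>R M t"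
    if t: "t \<in> {0..T}" for t
  proof -
    have "(Q t has_vector_derivative Q' t \<phi>) (at \<phi> within A)" for \<phi> A
      using pderiv_at_chain[OF fd(2)[OF cS[OF t], of 1] c\<phi>, where T = A]
        pderiv_at_chain[OF fd(2)[OF cS[OF t], of 2] c\<phi>, where T = A]
      unfolding Q_def Q'_def P_def G_def g_def[symmetric]
      by (auto intro!: derivative_eq_intros simp: algebra_simps)
    hence "(Q' t has_integral Q t (2*pi) - Q t 0) {0..2*pi}"
      by (intro fundamental_theorem_of_calculus) auto
    moreover have "Q t (2*pi) = Q t 0"
    proof -
      have "e_r (2*pi) = e_r 0" by (simp add: e_r_def)
      thus ?thesis by (simp add: Q_def c_def)
    qed
    ultimately have Q0: "(Q' t has_integral 0) {0..2*pi}" by simp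
    have RQ: "P t \<phi> + t *\<^sub>R P' t \<phi> + Q' t \<phi> = (- k\<^sup>2 * t) *\<^sub>R f (c t \<phi>)" for \<phi>
    proof -
      let ?c = "cos \<phi>" and ?s = "sin \<phi>"
      have alg: "p + t *\<^sub>R (a *\<^sub>R (a *\<^sub>R X + b *\<^sub>R X') + b *\<^sub>R (a *\<^sub>R Y + b *\<^sub>R Y'))
          + (- p + t *\<^sub>R (- b *\<^sub>R (- b *\<^sub>R X + a *\<^sub>R X') + a *\<^sub>R (- b *\<^sub>R Y + a *\<^sub>R Y')))
          = (t * (a * a + b * b)) *\<^sub>R (X + Y')" for a b :: real and p X X' Y Y' :: 'a
        by (simp add: algebra_simps)
      have id: "?c * ?c + ?s * ?s = 1" using sin_cos_squared_add2[of \<phi>] by (simp add: power2_eq_square)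
      have "P t \<phi> + t *\<^sub>R P' t \<phi> + Q' t \<phi> =
         (t * (?c * ?c + ?s * ?s)) *\<^sub>R (G 1 1 (c t \<phi>) + G 2 2 (c t \<phi>))"
        unfolding P'_def Q'_def by (rule alg)
      also have "\<dots> = t *\<^sub>R laplacian f (c t \<phi>)"
        by (simp only: id) (simp add: laplacian_def sum_2 G_def)
      also have "laplacian f (c t \<phi>) = - (k\<^sup>2 *\<^sub>R f (c t \<phi>))"
        using eq[OF cS[OF t, of \<phi>]] by (simp add: eq_neg_iff_add_eq_0)
      finally show ?thesis by (simp add: mult.commute)
    qed
    have "((\<lambda>\<phi>. (- k\<^sup>2 * t) *\<^sub>R f (c t \<phi>)) has_integral (- k\<^sup>2 * t) *\<^sub>R M t) {0..2*pi}"
      unfolding M_def c_def[symmetric]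
      by (intro has_integral_cmul integrable_integral integrable_continuous_interval comp1[OF cont(1) t])
    from has_integral_diff[OF this Q0]
    have "((\<lambda>\<phi>. P t \<phi> + t *\<^sub>R P' t \<phi>) has_integral (- k\<^sup>2 * t) *\<^sub>R M t) {0..2*pi}"
      by (simp only: RQ[symmetric] add_diff_cancel_right' diff_zero)
    thus ?thesis by (simp add: integral_unique)
  qed
  moreover have "(\<lambda>t. integral (cbox 0 (2*pi)) (\<lambda>\<phi>. t *\<^sub>R P t \<phi>)) = (\<lambda>t. t *\<^sub>R L t)"
    by (simp add: L_def fun_eq_iff)
  ultimately have "((\<lambda>t. t *\<^sub>R L t) has_vector_derivative (- k\<^sup>2 * t) *\<^sub>R M t) (at t within {0..T})"
    if "t \<in> {0..T}" for t
    using that by (simp only:)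
  moreover have "(M has_vector_derivative L t) (at t within {0..T})" if "t \<in> {0..T}" for t
    using 1[OF that] by (simp add: M_def L_def cbox_interval)
  ultimately show ?thesis by blast
qed

text \<open>The mean over circles of radius \<open>t\<close> of the plane standing wave \<open>cos (k x\<^sub>1)\<close>; this is
  Bessel's integral for \<open>J\<^sub>0(k t)\<close>.\<close>

definition wave_mean :: "real \<Rightarrow> real \<Rightarrow> real" where
  "wave_mean k t = integral {0..2*pi} (\<lambda>\<phi>. cos (k * t * cos \<phi>)) / (2 * pi)"

lemma standing_wave_C2:
  fixes k :: real
  defines "f \<equiv> \<lambda>y::real^2. cos (k * y$1)"
  shows "C2_on UNIV f" "laplacian f y + k\<^sup>2 *\<^sub>R f y = 0"
proof -
  define g :: "2 \<Rightarrow> real^2 \<Rightarrow> real" where "g i y = (if i = 1 then - k * sin (k * y$1) else 0)" for i y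
  define G :: "2 \<Rightarrow> 2 \<Rightarrow> real^2 \<Rightarrow> real"
    where "G i j y = (if i = 1 \<and> j = 1 then - k\<^sup>2 * cos (k * y$1) else 0)" for i j y
  have 1: "(f has_derivative (\<lambda>h. h$1 *\<^sub>R g 1 x + h$2 *\<^sub>R g 2 x)) (at x)" for x
    unfolding f_def g_def by (auto intro!: derivative_eq_intros bounded_linear_imp_has_derivative)
  have 2: "(g i has_derivative (\<lambda>h. h$1 *\<^sub>R G i 1 x + h$2 *\<^sub>R G i 2 x)) (at x)" for i x
    unfolding G_def g_def[abs_def]
    by (cases "i = 1") (auto intro!: derivative_eq_intros bounded_linear_imp_has_derivative simp: power2_eq_square)
  have 3: "continuous_on UNIV (G i j)" for i j
    unfolding G_def[abs_def] by (cases "i = 1 \<and> j = 1") (auto intro!: continuous_intros)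
  note C = C2_onI[OF open_UNIV 1 2 3]
  show "C2_on UNIV f" by (rule C(1))
  show "laplacian f y + k\<^sup>2 *\<^sub>R f y = 0"
    unfolding laplacian_def sum_2 C(3)[OF UNIV_I] by (simp add: G_def f_def)
qed

lemma cos_ge_half_of_abs_le_1:
  fixes x :: real
  assumes "\<bar>x\<bar> \<le> 1" shows "cos x \<ge> 1 / 2"
proof -
  have "cos (pi / 3) \<le> cos \<bar>x\<bar>"
    using assms pi_gt3 by (intro cos_monotone_0_pi_le) auto
  thus ?thesis by (simp add: cos_60 abs_if split: if_splits)
qed

lemma wave_mean_pos:
  assumes "0 \<le> t" "0 \<le> k" "k * t \<le> 1"
  shows "wave_mean k t > 0"
proof -
  have "cos (k * t * cos \<phi>) \<ge> 1 / 2" for \<phi>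
  proof (rule cos_ge_half_of_abs_le_1)
    have "\<bar>k * t * cos \<phi>\<bar> \<le> k * t * 1"
      unfolding abs_mult using assms by (intro mult_mono) auto
    thus "\<bar>k * t * cos \<phi>\<bar> \<le> 1" using assms by simp
  qed
  hence "integral {0..2*pi} (\<lambda>\<phi>. 1 / 2) \<le> integral {0..2*pi} (\<lambda>\<phi>. cos (k * t * cos \<phi>))"
    by (intro integral_le integrable_continuous_interval) (auto intro!: continuous_intros)
  hence "pi \<le> integral {0..2*pi} (\<lambda>\<phi>. cos (k * t * cos \<phi>))" by simp
  thus ?thesis unfolding wave_mean_def using pi_gt_zero by (intro divide_pos_pos) linarith+
qed

text \<open>Both the circle mean of \<open>f\<close> and that of the standing wave solve \<open>(t M')' = - k\<^sup>2 t M\<close>. Their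
  Wronskian times \<open>t\<close> is therefore constant, and it vanishes at \<open>t = 0\<close>, so their quotient is constant
  as long as the mean of the standing wave is positive.\<close>

lemma circle_integral_eq:
  fixes f :: "real^2 \<Rightarrow> 'a::banach"
  assumes C2: "C2_on S f" and eq: "\<And>y. y \<in> S \<Longrightarrow> laplacian f y + k\<^sup>2 *\<^sub>R f y = 0"
    and T: "cball x T \<subseteq> S" "0 \<le> T" "0 \<le> k" "k * T \<le> 1"
  shows "integral {0..2*pi} (\<lambda>\<phi>. f (x + T *\<^sub>R e_r \<phi>)) = (2 * pi * wave_mean k T) *\<^sub>R f x"
proof (cases "T = 0")
  case True
  thus ?thesis by (simp add: wave_mean_def)
next
  case False
  hence T0: "T > 0" using T by simp
  define M where "M t = integral {0..2*pi} (\<lambda>\<phi>. f (x + t *\<^sub>R e_r \<phi>))" for t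
  define m where "m t = integral {0..2*pi} (\<lambda>\<phi>. cos (k * (0 + t *\<^sub>R e_r \<phi>)$1))" for t
  have m: "m t = 2 * pi * wave_mean k t" for t by (simp add: m_def wave_mean_def mult.assoc)
  have "\<exists>L. \<forall>t\<in>{0..T}. (M has_vector_derivative L t) (at t within {0..T}) \<and>
     ((\<lambda>t. t *\<^sub>R L t) has_vector_derivative (- k\<^sup>2 * t) *\<^sub>R M t) (at t within {0..T})"
    unfolding M_def[abs_def] by (rule circle_integral_ode[OF C2 eq T(1)])
  then obtain L where L: "\<And>t. t \<in> {0..T} \<Longrightarrow> (M has_vector_derivative L t) (at t within {0..T})"
     "\<And>t. t \<in> {0..T} \<Longrightarrow> ((\<lambda>t. t *\<^sub>R L t) has_vector_derivative (- k\<^sup>2 * t) *\<^sub>R M t) (at t within {0..T})"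
    by blast
  have "\<exists>L. \<forall>t\<in>{0..T}. (m has_vector_derivative L t) (at t within {0..T}) \<and>
     ((\<lambda>t. t *\<^sub>R L t) has_vector_derivative (- k\<^sup>2 * t) *\<^sub>R m t) (at t within {0..T})"
    unfolding m_def[abs_def]
    by (rule circle_integral_ode[where f = "\<lambda>y. cos (k * y$1)" and S = UNIV])
      (rule standing_wave_C2 subset_UNIV)+
  then obtain l where l: "\<And>t. t \<in> {0..T} \<Longrightarrow> (m has_vector_derivative l t) (at t within {0..T})"
     "\<And>t. t \<in> {0..T} \<Longrightarrow> ((\<lambda>t. t *\<^sub>R l t) has_vector_derivative (- k\<^sup>2 * t) *\<^sub>R m t) (at t within {0..T})"
    by blast
  have mpos: "m t > 0" if "t \<in> {0..T}" for t
  proof -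
    have "k * t \<le> k * T" using that T by (intro mult_left_mono) auto
    thus ?thesis unfolding m using that T wave_mean_pos[of t k] by auto
  qed
  define W where "W t = m t *\<^sub>R (t *\<^sub>R L t) - (t * l t) *\<^sub>R M t" for t
  have "(W has_vector_derivative 0) (at t within {0..T})" if t: "t \<in> {0..T}" for t
  proof -
    have "((\<lambda>t. t * l t) has_real_derivative (- k\<^sup>2 * t) * m t) (at t within {0..T})"
      using l(2)[OF t] by (simp add: has_real_derivative_iff_has_vector_derivative)
    moreover have "(m has_real_derivative l t) (at t within {0..T})"
      using l(1)[OF t] by (simp add: has_real_derivative_iff_has_vector_derivative)
    ultimately have "(W has_vector_derivative
        (m t *\<^sub>R ((- k\<^sup>2 * t) *\<^sub>R M t) + l t *\<^sub>R (t *\<^sub>R L t))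
        - ((t * l t) *\<^sub>R L t + ((- k\<^sup>2 * t) * m t) *\<^sub>R M t)) (at t within {0..T})"
      unfolding W_def[abs_def]
      by (intro has_vector_derivative_diff has_vector_derivative_scaleR L t)
    thus ?thesis by (simp add: algebra_simps)
  qed
  then obtain c where c: "\<And>t. t \<in> {0..T} \<Longrightarrow> W t = c"
    using has_vector_derivative_zero_constant[of "{0..T}" W] by auto
  have "c = 0" using c[of 0] T by (simp add: W_def)
  hence W: "W t = 0" if "t \<in> {0..T}" for t using c that by simp
  define q where "q t = (1 / m t) *\<^sub>R M t" for t
  have q': "(q has_vector_derivative (1 / m t) *\<^sub>R L t - (l t / (m t)\<^sup>2) *\<^sub>R M t) (at t within {0..T})"
    if t: "t \<in> {0..T}" for t
  proof -
    have "(m has_real_derivative l t) (at t within {0..T})"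
      using l(1)[OF t] by (simp add: has_real_derivative_iff_has_vector_derivative)
    hence "((\<lambda>t. 1 / m t) has_real_derivative - (l t / (m t)\<^sup>2)) (at t within {0..T})"
      using mpos[OF t] by (auto intro!: derivative_eq_intros simp: power2_eq_square)
    from has_vector_derivative_scaleR[OF this L(1)[OF t]] show ?thesis
      unfolding q_def by simp
  qed
  have q0: "(1 / m t) *\<^sub>R L t - (l t / (m t)\<^sup>2) *\<^sub>R M t = 0" if t: "t \<in> {0<..<T}" for t
  proof -
    have p: "m t > 0" using mpos t by auto
    have "(t * (m t)\<^sup>2) *\<^sub>R ((1 / m t) *\<^sub>R L t - (l t / (m t)\<^sup>2) *\<^sub>R M t) = W t"
      unfolding W_def using p t by (simp add: algebra_simps power2_eq_square)
    hence "(t * (m t)\<^sup>2) *\<^sub>R ((1 / m t) *\<^sub>R L t - (l t / (m t)\<^sup>2) *\<^sub>R M t) = 0" using W t by auto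
    thus ?thesis using p t unfolding scaleR_eq_0_iff by auto
  qed
  have "q T = q 0"
  proof (rule has_derivative_zero_unique_strong_interval[of "{0,T}" 0 T q "q 0" T])
    show "continuous_on {0..T} q"
      by (rule continuous_on_vector_derivative) (rule q')
    show "(q has_derivative (\<lambda>h. 0)) (at t within {0..T})" if "t \<in> {0..T} - {0, T}" for t
      using q'[of t] q0[of t] that by (auto simp: has_vector_derivative_def)
  qed (use T in auto)
  moreover have "q 0 = f x" by (simp add: q_def M_def m wave_mean_def)
  moreover have "m T *\<^sub>R q T = M T" using mpos[of T] T by (simp add: q_def)
  ultimately have "M T = m T *\<^sub>R f x" by simp
  thus ?thesis unfolding M_def m .
qed

text \<open>The mean value identity passes to partial derivatives by differentiation in the centre, while the
  Helmholtz equation for a derivative would involve derivatives of the next order. The restriction to \<open>k t \<le> 1\<close> keeps the mean of the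
  standing wave positive.\<close>

definition circle_mean_on :: "real \<Rightarrow> (real^2) set \<Rightarrow> (real^2 \<Rightarrow> complex) \<Rightarrow> bool" where
  "circle_mean_on k S f \<longleftrightarrow> continuous_on S f \<and>
     (\<forall>x t. 0 \<le> t \<longrightarrow> k * t \<le> 1 \<longrightarrow> cball x t \<subseteq> S \<longrightarrow>
       integral {0..2*pi} (\<lambda>\<phi>. f (x + t *\<^sub>R e_r \<phi>)) = (2 * pi * wave_mean k t) *\<^sub>R f x)"

lemma helmholtz_circle_mean:
  assumes "helmholtz_on k S f" "k \<ge> 0"
  shows "circle_mean_on k S f"
proof -
  have "continuous_on S f" using assms
    by (auto simp: helmholtz_on_def C2_on_def C1_on_def
        intro: differentiable_imp_continuous_on differentiable_at_imp_differentiable_on)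
  thus ?thesis
    using circle_integral_eq[of S f k] assms unfolding circle_mean_on_def helmholtz_on_def by blast
qed

text \<open>The mean value identity holds at all nearby centres, so it can be differentiated in the centre.\<close>

lemma circle_mean_pderiv:
  assumes f: "circle_mean_on k S f" and C1: "C1_on S f" and S: "open S"
  shows "circle_mean_on k S (pderiv_at i f)"
  unfolding circle_mean_on_def
proof (intro conjI allI impI)
  show "continuous_on S (pderiv_at i f)" using C1 by (simp add: C1_on_def)
next
  fix x t assume t: "0 \<le> t" "k * t \<le> 1" "cball x t \<subseteq> S"
  have "compact (cball x t)" by simp
  then obtain d where d: "d > 0" "(\<Union>y\<in>cball x t. cball y d) \<subseteq> S"
    using compact_in_open_separated[of "cball x t" S] S t by (metis compact_subset_open_imp_cball_epsilon_subset)
  define U where "U = {-d..d}"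
  define a :: "real^2" where "a = axis i 1"
  have a: "norm a = 1" by (simp add: a_def)
  define c where "c s \<phi> = x + s *\<^sub>R a + t *\<^sub>R e_r \<phi>" for s \<phi>
  have cS: "cball (x + s *\<^sub>R a) t \<subseteq> S" if "s \<in> U" for s
  proof
    fix y assume y: "y \<in> cball (x + s *\<^sub>R a) t"
    have "dist (y - s *\<^sub>R a) y \<le> d" using that a by (auto simp: U_def dist_norm)
    hence "y \<in> cball (y - s *\<^sub>R a) d" by simp
    moreover have "y - s *\<^sub>R a \<in> cball x t" using y by (simp add: dist_norm algebra_simps)
    ultimately show "y \<in> S" using d(2) by blast
  qed
  have cS1: "c s \<phi> \<in> S" if "s \<in> U" for s \<phi>
    using cS[OF that] t by (auto simp: c_def subset_iff dist_norm)
  have cont: "continuous_on S f" "continuous_on S (pderiv_at i f)"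
    using f C1 by (auto simp: circle_mean_on_def C1_on_def)
  have 0: "0 \<in> U" using d by (simp add: U_def)
  have deriv: "((\<lambda>s. f (x + s *\<^sub>R a + b)) has_vector_derivative pderiv_at i f (x + s *\<^sub>R a + b)) (at s within U)"
    if "x + s *\<^sub>R a + b \<in> S" for s b
  proof -
    have "((\<lambda>s. x + s *\<^sub>R a + b) has_vector_derivative a) (at s within U)"
      by (auto intro!: derivative_eq_intros)
    from pderiv_at_chain[OF _ this, of f] show ?thesis
      using that C1 exhaust_2[of i] by (auto simp: C1_on_def a_def axis_def)
  qed
  have "((\<lambda>s. integral (cbox 0 (2*pi)) (\<lambda>\<phi>. f (c s \<phi>))) has_vector_derivative
     integral (cbox 0 (2*pi)) (\<lambda>\<phi>. pderiv_at i f (c 0 \<phi>))) (at 0 within U)"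
  proof (rule leibniz_rule_vector_derivative)
    show "((\<lambda>s. f (c s \<phi>)) has_vector_derivative pderiv_at i f (c s \<phi>)) (at s within U)" if "s \<in> U" for s \<phi>
      using deriv cS1[OF that] unfolding c_def by blast
    show "(\<lambda>\<phi>. f (c s \<phi>)) integrable_on cbox 0 (2*pi)" if "s \<in> U" for s
      unfolding cbox_interval
      by (intro integrable_continuous_interval continuous_on_compose2[OF cont(1)])
        (auto simp: cS1[OF that], auto simp: c_def intro!: continuous_intros)
    show "continuous_on (U \<times> cbox 0 (2*pi)) (\<lambda>(s, \<phi>). pderiv_at i f (c s \<phi>))"
      unfolding case_prod_beta
      by (intro continuous_on_compose2[OF cont(2)]) (auto simp: cS1, auto simp: c_def intro!: continuous_intros)
  qed (use 0 in \<open>auto simp: U_def\<close>)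
  moreover have "integral (cbox 0 (2*pi)) (\<lambda>\<phi>. f (c s \<phi>)) = (2 * pi * wave_mean k t) *\<^sub>R f (x + s *\<^sub>R a)"
    if "s \<in> U" for s
    using f t cS[OF that] by (simp add: circle_mean_on_def c_def cbox_interval)
  ultimately have 1: "((\<lambda>s. (2 * pi * wave_mean k t) *\<^sub>R f (x + s *\<^sub>R a)) has_vector_derivative
     integral (cbox 0 (2*pi)) (\<lambda>\<phi>. pderiv_at i f (c 0 \<phi>))) (at 0 within U)"
    using 0 by (auto elim: has_vector_derivative_transform[rotated 2])
  have "x \<in> S" using t by auto
  hence "((\<lambda>s. f (x + s *\<^sub>R a)) has_vector_derivative pderiv_at i f x) (at 0 within U)"
    using deriv[of 0 0] by simp
  hence 2: "((\<lambda>s. (2 * pi * wave_mean k t) *\<^sub>R f (x + s *\<^sub>R a)) has_vector_derivative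
     (2 * pi * wave_mean k t) *\<^sub>R pderiv_at i f x) (at 0 within U)"
    by (auto intro!: derivative_eq_intros)
  show "integral {0..2*pi} (\<lambda>\<phi>. pderiv_at i f (x + t *\<^sub>R e_r \<phi>)) = (2 * pi * wave_mean k t) *\<^sub>R pderiv_at i f x"
    using vector_derivative_unique_within[OF _ 1 2] d
    by (simp add: c_def cbox_interval U_def trivial_limit_within islimpt_Icc)
qed

lemma circle_mean_on_subset:
  "circle_mean_on k S f \<Longrightarrow> T \<subseteq> S \<Longrightarrow> circle_mean_on k T f"
  unfolding circle_mean_on_def by (meson continuous_on_subset order_trans)

lemma circle_mean_on_add:
  assumes "circle_mean_on k S f" "circle_mean_on k S g"
  shows "circle_mean_on k S (\<lambda>x. f x + g x)"
  unfolding circle_mean_on_def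
proof (intro conjI allI impI)
  show "continuous_on S (\<lambda>x. f x + g x)"
    using assms unfolding circle_mean_on_def by (auto intro!: continuous_intros)
  fix x t assume t: "0 \<le> t" "k * t \<le> 1" "cball x t \<subseteq> S"
  have "(\<lambda>\<phi>. h (x + t *\<^sub>R e_r \<phi>)) integrable_on {0..2*pi}" if "continuous_on S h" for h :: "real^2 \<Rightarrow> complex"
    by (intro integrable_continuous_interval continuous_on_compose2[OF that])
      (use t in \<open>auto simp: subset_iff dist_norm intro!: continuous_intros\<close>)
  thus "integral {0..2*pi} (\<lambda>\<phi>. f (x + t *\<^sub>R e_r \<phi>) + g (x + t *\<^sub>R e_r \<phi>)) = (2 * pi * wave_mean k t) *\<^sub>R (f x + g x)"
    using assms t unfolding circle_mean_on_def by (simp add: integral_add scaleR_add_right)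
qed

lemma circle_mean_on_cmult:
  assumes "circle_mean_on k S f"
  shows "circle_mean_on k S (\<lambda>x. c * f x)"
  using assms unfolding circle_mean_on_def
  by (auto intro!: continuous_intros simp: mult.left_commute)

section \<open>Integration in polar coordinates\<close>

lemma Basis_real2: "(Basis :: (real^2) set) = {axis 1 1, axis 2 1}"
  by (auto simp: Basis_vec_def UNIV_2)

lemma measurable_vector2 [measurable]: 
  "(\<lambda>(a, b). vector [a, b] :: real^2) \<in> borel_measurable borel"
proof -
  have "(\<lambda>p. fst p *\<^sub>R axis 1 1 + snd p *\<^sub>R axis 2 1 :: real^2) \<in> borel_measurable borel"
    by (intro borel_measurable_continuous_onI continuous_intros)
  also have "(\<lambda>p. fst p *\<^sub>R axis 1 1 + snd p *\<^sub>R axis 2 1 :: real^2) = (\<lambda>(a, b). vector [a, b])"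
    by (auto simp: fun_eq_iff vec_eq_iff forall_2 axis_def)
  finally show ?thesis .
qed

lemma lborel_real2_eq_distr: "(lborel :: (real^2) measure) = distr lborel borel (\<lambda>(a, b). vector [a, b])"
proof (rule lborel_eqI)
  fix l u :: "real^2" assume lu: "\<And>b. b \<in> Basis \<Longrightarrow> l \<bullet> b \<le> u \<bullet> b"
  have le: "l $ i \<le> u $ i" for i
    using lu[of "axis i 1"] by (simp add: inner_axis)
  have "emeasure (distr lborel borel (\<lambda>(a, b). vector [a, b])) (box l u)
      = emeasure lborel ({l$1<..<u$1} \<times> {l$2<..<u$2})"
    by (subst emeasure_distr) (auto simp: mem_box_cart forall_2 intro!: arg_cong[where f = "emeasure lborel"])
  also have "\<dots> = emeasure lborel {l$1<..<u$1} * emeasure lborel {l$2<..<u$2}"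
    unfolding lborel_prod[symmetric] by (rule lborel.emeasure_pair_measure_Times) auto
  also have "\<dots> = ennreal (\<Prod>b\<in>Basis. (u - l) \<bullet> b)"
    unfolding Basis_real2 using le by (simp add: axis_eq_axis inner_axis ennreal_mult)
  finally show "emeasure (distr lborel borel (\<lambda>(a, b). vector [a, b])) (box l u) = (\<Prod>b\<in>Basis. (u - l) \<bullet> b)" .
qed simp

lemma polar_nth [simp]: "polar r \<theta> $ 1 = r * cos \<theta>" "polar r \<theta> $ 2 = r * sin \<theta>"
  by (simp_all add: polar_def)

lemma norm_polar [simp]: "norm (polar r \<theta>) = \<bar>r\<bar>"
  by (simp add: polar_def)

lemma polar_exhaust:
  obtains \<theta> where "0 \<le> \<theta>" "\<theta> < 2*pi" "x = polar (norm x) \<theta>"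
proof (cases "x = 0")
  case True
  show thesis by (rule that[of 0]) (auto simp: True polar_def)
next
  case False
  have n: "(norm x)\<^sup>2 = (x$1)\<^sup>2 + (x$2)\<^sup>2"
    by (simp add: norm_vec_def L2_set_def sum_2)
  have "(x$1 / norm x)\<^sup>2 + (x$2 / norm x)\<^sup>2 = 1"
    using False by (simp add: power_divide n[symmetric] add_divide_distrib[symmetric])
  then obtain t where t: "0 \<le> t" "t < 2*pi" "x$1 / norm x = cos t" "x$2 / norm x = sin t"
    by (rule sincos_total_2pi)
  have "x = polar (norm x) t"
    using False by (simp add: vec_eq_iff forall_2 t(3,4)[symmetric])
  with t(1,2) show thesis by (rule that)
qed

lemma polar_eq_polar:
  assumes "polar r \<theta> = polar r' \<theta>'" "r > 0" "r' > 0"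
  shows "r = r'" "\<exists>n::int. \<theta> = \<theta>' + 2 * pi * n"
proof -
  show r: "r = r'" using assms norm_polar[of r \<theta>] norm_polar[of r' \<theta>'] by simp
  have "r * cos \<theta> = r * cos \<theta>'" "r * sin \<theta> = r * sin \<theta>'"
    using arg_cong[OF assms(1), of "\<lambda>v. v$1"] arg_cong[OF assms(1), of "\<lambda>v. v$2"] r by simp_all
  hence "sin \<theta> = sin \<theta>' \<and> cos \<theta> = cos \<theta>'" using assms by simp
  thus "\<exists>n::int. \<theta> = \<theta>' + 2 * pi * n" by (simp only: sin_cos_eq_iff)
qed

lemma polar_inj:
  assumes "polar r \<theta> = polar r' \<theta>'" "r > 0" "r' > 0" "\<bar>\<theta> - \<theta>'\<bar> < 2 * pi"
  shows "r = r'" "\<theta> = \<theta>'"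
proof -
  show "r = r'" using polar_eq_polar[OF assms(1-3)] by simp
  obtain n :: int where n: "\<theta> = \<theta>' + 2 * pi * n" using polar_eq_polar[OF assms(1-3)] by blast
  have "2 * pi * \<bar>real_of_int n\<bar> < 2 * pi * 1" using assms(4) by (simp add: n abs_mult)
  hence "\<bar>real_of_int n\<bar> < 1" by (subst (asm) mult_less_cancel_left_pos) auto
  hence "n = 0" by linarith
  thus "\<theta> = \<theta>'" using n by simp
qed

lemma polar_measurable [measurable]: "(\<lambda>(r, \<theta>). polar r \<theta>) \<in> borel_measurable (borel :: (real \<times> real) measure)"
  unfolding polar_def case_prod_beta by (intro borel_measurable_continuous_onI continuous_intros)

text \<open>The Jacobian \<open>r\<close> of the polar map, cut off to a strip on which the map is injective.\<close>

definition polar_weight :: "real \<times> real \<Rightarrow> ennreal" where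
  "polar_weight x = ennreal (fst x) * indicator ({0<..} \<times> {0<..<2*pi}) x"

lemma polar_weight_measurable [measurable]: "polar_weight \<in> borel_measurable borel"
proof -
  have "({0<..} \<times> {0<..<2*pi} :: (real \<times> real) set) \<in> sets borel"
    by (intro borel_open open_Times) auto
  hence "(indicator ({0<..} \<times> {0<..<2*pi}) :: real \<times> real \<Rightarrow> ennreal) \<in> borel_measurable borel"
    by (rule borel_measurable_indicator)
  moreover have "(\<lambda>x. ennreal (fst x)) \<in> borel_measurable (borel :: (real \<times> real) measure)"
    by (intro measurable_compose[OF _ measurable_ennreal] borel_measurable_continuous_onI continuous_intros)
  ultimately show ?thesis unfolding polar_weight_def[abs_def] by (intro borel_measurable_times_ennreal)
qed

text \<open>Lebesgue measure is determined by its values on boxes. The polar map is injective on the strip and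
  covers a box up to a part of the axis \<open>x\<^sub>2 = 0\<close>, a null set, so the change of variables formula for the constant
  function one gives the measure of the box.\<close>

theorem lborel_polar:
  "(lborel :: (real^2) measure) = distr (density lborel polar_weight) borel (\<lambda>(r, \<theta>). polar r \<theta>)"
proof (rule lborel_eqI)
  fix l u :: "real^2" assume lu: "\<And>b. b \<in> Basis \<Longrightarrow> l \<bullet> b \<le> u \<bullet> b"
  define g :: "real^2 \<Rightarrow> real^2" where "g x = polar (x$1) (x$2)" for x
  define g' :: "real^2 \<Rightarrow> real^2 \<Rightarrow> real^2" where
    "g' x h = vector [cos (x$2) * h$1 - x$1 * sin (x$2) * h$2, sin (x$2) * h$1 + x$1 * cos (x$2) * h$2]" for x h
  define S where "S = {x::real^2. 0 < x$1 \<and> 0 < x$2 \<and> x$2 < 2*pi}"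
  define T where "T = S \<inter> g -` box l u"
  have gcont: "continuous_on UNIV g"
    unfolding g_def polar_def by (intro continuous_intros)
  have [measurable]: "S \<in> sets borel"
  proof -
    have "S = {x. 0 < x$1} \<inter> {x. 0 < x$2} \<inter> {x. x$2 < 2*pi}" by (auto simp: S_def)
    moreover have "open \<dots>"
      by (intro open_Int open_Collect_less continuous_intros)
    ultimately show ?thesis by (auto intro: borel_open)
  qed
  have [measurable]: "g \<in> borel_measurable borel" by (rule borel_measurable_continuous_onI[OF gcont])
  have Tb: "T \<in> sets borel"
    unfolding T_def using measurable_sets[OF \<open>g \<in> borel_measurable borel\<close>, of "box l u"] by auto
  have der: "(g has_derivative g' x) (at x within T)" for x
  proof -
    have "(g has_derivative (\<lambda>h. h$1 *\<^sub>R e_r (x$2) + x$1 *\<^sub>R (h$2 *\<^sub>R e_theta (x$2)))) (at x within T)"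
    proof -
      have c: "((\<lambda>x. x $ i) has_derivative (\<lambda>h. h $ i)) (at x within T)" for i :: 2
        by (intro bounded_linear_imp_has_derivative bounded_linear_vec_nth)
      have e: "((\<lambda>x. e_r (x$2)) has_derivative (\<lambda>h. h$2 *\<^sub>R e_theta (x$2))) (at x within T)"
        by (rule has_derivative_compose[OF c])
          (rule e_r_derivative(1)[where T = UNIV, unfolded has_vector_derivative_def])
      show ?thesis
        unfolding g_def polar_def
        by (rule derivative_eq_intros c e refl | simp add: add.commute)+
    qed
    moreover have "(\<lambda>h. h$1 *\<^sub>R e_r (x$2) + x$1 *\<^sub>R (h$2 *\<^sub>R e_theta (x$2))) = g' x"
      by (auto simp: fun_eq_iff vec_eq_iff forall_2 g'_def)
    ultimately show ?thesis by simp
  qed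
  have det: "\<bar>det (matrix (g' x))\<bar> = x$1" if "x \<in> T" for x
  proof -
    have "det (matrix (g' x)) = x$1 * (cos (x$2) * cos (x$2)) + x$1 * (sin (x$2) * sin (x$2))"
      by (simp add: det_2 matrix_def g'_def axis_def)
    also have "\<dots> = x$1 * ((cos (x$2))\<^sup>2 + (sin (x$2))\<^sup>2)"
      by (simp only: power2_eq_square distrib_left)
    finally have "det (matrix (g' x)) = x$1" by simp
    thus ?thesis using that by (simp add: T_def S_def)
  qed
  have inj: "inj_on g T"
  proof (rule inj_onI)
    fix x y assume xy: "x \<in> T" "y \<in> T" "g x = g y"
    hence "\<bar>x$2 - y$2\<bar> < 2*pi" by (auto simp: T_def S_def)
    hence "x$1 = y$1" "x$2 = y$2"
      using polar_inj[of "x$1" "x$2" "y$1" "y$2"] xy by (auto simp: T_def S_def g_def)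
    thus "x = y" by (simp add: vec_eq_iff forall_2)
  qed
  have neg: "negligible {y::real^2. y$2 = 0}"
    by (rule negligible_standard_hyperplane_cart)
  have sub: "box l u - {y. y$2 = 0} \<subseteq> g ` T" "g ` T \<subseteq> box l u"
  proof -
    show "box l u - {y. y$2 = 0} \<subseteq> g ` T"
    proof
      fix y assume y: "y \<in> box l u - {y. y$2 = 0}"
      obtain \<theta> where \<theta>: "0 \<le> \<theta>" "\<theta> < 2*pi" "y = polar (norm y) \<theta>" by (rule polar_exhaust)
      have "\<theta> \<noteq> 0" using y \<theta>(3) by (metis (mono_tags, lifting) DiffD2 mem_Collect_eq mult_zero_right polar_nth(2) sin_zero)
      moreover have "norm y > 0" using y by (auto simp: zero_less_norm_iff)
      ultimately have "vector [norm y, \<theta>] \<in> T" using \<theta> y by (simp add: T_def S_def g_def)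
      moreover have "g (vector [norm y, \<theta>]) = y" using \<theta> by (simp add: g_def)
      ultimately show "y \<in> g ` T" by (metis imageI)
    qed
  qed (auto simp: T_def)
  have symd: "negligible (sym_diff (g ` T) (box l u))"
    by (rule negligible_subset[OF neg]) (use sub in auto)
  have lm: "g ` T \<in> lmeasurable"
    by (rule lmeasurable_negligible_symdiff[OF lmeasurable_box[of l u]]) (use symd in \<open>simp add: Un_commute\<close>)
  have "measure lebesgue (g ` T) = measure lebesgue (box l u)"
    by (rule measure_negligible_symdiff[OF lmeasurable_box[of l u]]) (use symd in \<open>simp add: Un_commute\<close>)
  also have "\<dots> = (\<Prod>b\<in>Basis. (u - l) \<bullet> b)"
    using lu by (simp add: measure_lborel_box_eq)
  finally have "((\<lambda>x. \<bar>det (matrix (g' x))\<bar>) has_integral (\<Prod>b\<in>Basis. (u - l) \<bullet> b)) T"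
    using has_measure_differentiable_image[of T g g'] der inj lm Tb by auto
  hence "((\<lambda>x. x$1) has_integral (\<Prod>b\<in>Basis. (u - l) \<bullet> b)) T"
    by (rule has_integral_eq[rotated]) (use det in auto)
  hence "(\<integral>\<^sup>+x. ennreal (x$1) * indicator T x \<partial>lborel) = ennreal (\<Prod>b\<in>Basis. (u - l) \<bullet> b)"
    by (intro nn_integral_has_integral_lebesgue') (auto simp: T_def S_def)
  also have "(\<integral>\<^sup>+x. ennreal (x$1) * indicator T x \<partial>lborel)
     = (\<integral>\<^sup>+p. ennreal (fst p) * indicator T (vector [fst p, snd p]) \<partial>lborel)"
  proof -
    have [measurable]: "(\<lambda>x::real^2. x$1) \<in> borel_measurable borel"
      by (intro borel_measurable_continuous_onI continuous_intros)
    note [measurable] = Tb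
    show ?thesis
      by (subst lborel_real2_eq_distr, subst nn_integral_distr) (auto simp: case_prod_beta)
  qed
  also have "\<dots> = (\<integral>\<^sup>+p. polar_weight p * indicator ((\<lambda>(r, \<theta>). polar r \<theta>) -` box l u) p \<partial>lborel)"
    by (intro nn_integral_cong) (auto simp: polar_weight_def T_def S_def g_def indicator_def)
  also have "\<dots> = emeasure (distr (density lborel polar_weight) borel (\<lambda>(r, \<theta>). polar r \<theta>)) (box l u)"
  proof -
    have "(\<lambda>(r, \<theta>). polar r \<theta>) -` box l u \<in> sets borel"
      using measurable_sets[OF polar_measurable, of "box l u"] by simp
    thus ?thesis by (subst emeasure_distr) (auto simp: emeasure_density)
  qed
  finally show "emeasure (distr (density lborel polar_weight) borel (\<lambda>(r, \<theta>). polar r \<theta>)) (box l u)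
      = (\<Prod>b\<in>Basis. (u - l) \<bullet> b)" by simp
qed simp

lemma nn_integral_polar:
  fixes F :: "real^2 \<Rightarrow> ennreal"
  assumes [measurable]: "F \<in> borel_measurable borel"
  shows "(\<integral>\<^sup>+y. F y \<partial>lborel) =
    (\<integral>\<^sup>+\<theta>. (\<integral>\<^sup>+r. ennreal r * indicator {0<..} r * F (polar r \<theta>) \<partial>lborel) * indicator {0<..<2*pi} \<theta> \<partial>lborel)"
proof -
  have [measurable]: "(\<lambda>p. polar (fst p) (snd p)) \<in> borel_measurable (borel :: (real \<times> real) measure)"
    unfolding polar_def by (intro borel_measurable_continuous_onI continuous_intros)
  have "(\<integral>\<^sup>+y. F y \<partial>lborel) = (\<integral>\<^sup>+p. polar_weight p * F (polar (fst p) (snd p)) \<partial>(lborel \<Otimes>\<^sub>M lborel))"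
    unfolding lborel_prod
    by (subst lborel_polar, subst nn_integral_distr)
      (auto simp: nn_integral_density case_prod_beta)
  also have "\<dots> = (\<integral>\<^sup>+\<theta>. \<integral>\<^sup>+r. polar_weight (r, \<theta>) * F (polar r \<theta>) \<partial>lborel \<partial>lborel)"
    using lborel_pair.nn_integral_snd[of "\<lambda>p. polar_weight p * F (polar (fst p) (snd p))"]
    by (simp add: case_prod_beta lborel_prod)
  also have "\<dots> = (\<integral>\<^sup>+\<theta>. \<integral>\<^sup>+r. ennreal r * indicator {0<..} r * F (polar r \<theta>) * indicator {0<..<2*pi} \<theta> \<partial>lborel \<partial>lborel)"
    by (intro nn_integral_cong) (auto simp: polar_weight_def indicator_def)
  also have "\<dots> = (\<integral>\<^sup>+\<theta>. (\<integral>\<^sup>+r. ennreal r * indicator {0<..} r * F (polar r \<theta>) \<partial>lborel) * indicator {0<..<2*pi} \<theta> \<partial>lborel)"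
  proof (intro nn_integral_cong nn_integral_multc)
    fix \<theta> :: real
    have [measurable]: "(\<lambda>r. polar r \<theta>) \<in> borel_measurable borel"
      unfolding polar_def by (intro borel_measurable_continuous_onI continuous_intros)
    show "(\<lambda>r. ennreal r * indicator {0<..} r * F (polar r \<theta>)) \<in> borel_measurable lborel"
      by measurable
  qed
  finally show ?thesis .
qed

lemma integral_polar:
  fixes F :: "real^2 \<Rightarrow> complex"
  assumes F: "integrable lborel F"
  shows "integral\<^sup>L lborel F = (\<integral>r. (\<integral>\<theta>. indicator ({0<..} \<times> {0<..<2*pi}) (r, \<theta>) *\<^sub>R (r *\<^sub>R F (polar r \<theta>)) \<partial>lborel) \<partial>lborel)"
proof -
  define w where "w p = indicator ({0<..} \<times> {0<..<2*pi}) p * fst p" for p :: "real \<times> real"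
  have wm: "w \<in> borel_measurable borel"
  proof -
    have "({0<..} \<times> {0<..<2*pi} :: (real \<times> real) set) \<in> sets borel"
      by (intro borel_open open_Times) auto
    hence "(indicator ({0<..} \<times> {0<..<2*pi}) :: real \<times> real \<Rightarrow> real) \<in> borel_measurable borel"
      by (rule borel_measurable_indicator)
    moreover have "fst \<in> borel_measurable (borel :: (real \<times> real) measure)"
      by (intro borel_measurable_continuous_onI continuous_intros)
    ultimately show ?thesis unfolding w_def[abs_def] by (intro borel_measurable_times)
  qed
  have w: "polar_weight = (\<lambda>p. ennreal (w p))"
    by (auto simp: polar_weight_def w_def indicator_def fun_eq_iff)
  have w0: "w p \<ge> 0" for p by (auto simp: w_def indicator_def)
  have [measurable]: "F \<in> borel_measurable borel" using F by simp
  have pm[measurable]: "(\<lambda>p. polar (fst p) (snd p)) \<in> borel_measurable (borel :: (real \<times> real) measure)"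
    unfolding polar_def by (intro borel_measurable_continuous_onI continuous_intros)
  have "integrable (distr (density lborel polar_weight) borel (\<lambda>(r, \<theta>). polar r \<theta>)) F"
    using F by (subst (asm) lborel_polar)
  hence "integrable (density lborel w) (\<lambda>p. F (polar (fst p) (snd p)))"
    by (subst (asm) integrable_distr_eq) (auto simp: w case_prod_beta)
  hence I: "integrable lborel (\<lambda>p. w p *\<^sub>R F (polar (fst p) (snd p)))"
    by (subst (asm) integrable_density) (use wm w0 in auto)
  have "integral\<^sup>L lborel F = integral\<^sup>L (density lborel w) (\<lambda>p. F (polar (fst p) (snd p)))"
    by (subst lborel_polar, subst integral_distr) (auto simp: w case_prod_beta)
  also have "\<dots> = (\<integral>p. w p *\<^sub>R F (polar (fst p) (snd p)) \<partial>lborel)"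
    by (subst integral_density) (use wm w0 in auto)
  also have "\<dots> = (\<integral>r. (\<integral>\<theta>. w (r, \<theta>) *\<^sub>R F (polar r \<theta>) \<partial>lborel) \<partial>lborel)"
    using lborel_pair.integral_fst'[of "\<lambda>p. w p *\<^sub>R F (polar (fst p) (snd p))"] I by (simp add: lborel_prod)
  finally show ?thesis by (simp add: w_def)
qed

section \<open>A reproducing kernel for two wave numbers\<close>

text \<open>The bump is a function of the squared distance to the centre, so it is smooth at the centre; the third
  power makes it \<open>C\<^sup>2\<close> across the rim. Its moment is taken against circle means.\<close>

definition bump :: "real \<Rightarrow> real \<Rightarrow> real" where
  "bump s q = (max 0 (s\<^sup>2 - q)) ^ 3"

definition bump_moment :: "real \<Rightarrow> real \<Rightarrow> real" where
  "bump_moment s k = integral {0..s} (\<lambda>r. r * (s\<^sup>2 - r\<^sup>2) ^ 3 * wave_mean k r)"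

lemma bump_eq_0: "norm y > s \<Longrightarrow> s \<ge> 0 \<Longrightarrow> bump s ((norm y)\<^sup>2) = 0"
  using power_mono[of s "norm y" 2] by (simp add: bump_def max_def)

lemma bump_eq: "norm y \<le> s \<Longrightarrow> bump s ((norm y)\<^sup>2) = (s\<^sup>2 - (norm y)\<^sup>2) ^ 3"
  using power_mono[of "norm y" s 2] by (simp add: bump_def max_def)

lemma continuous_bump [continuous_intros]:
  "continuous_on T f \<Longrightarrow> continuous_on T (\<lambda>x. bump s (f x))"
  unfolding bump_def by (intro continuous_intros)

lemma continuous_wave_mean: "continuous_on T (wave_mean k)"
proof -
  have "continuous_on UNIV (\<lambda>t. integral (cbox 0 (2*pi)) (\<lambda>\<phi>. cos (k * t * cos \<phi>)))"
    by (rule integral_continuous_on_param) (auto simp: case_prod_beta intro!: continuous_intros)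
  hence "continuous_on UNIV (wave_mean k)"
    unfolding wave_mean_def[abs_def] by (auto intro!: continuous_intros simp: cbox_interval)
  thus ?thesis by (rule continuous_on_subset) simp
qed

text \<open>In polar coordinates around \<open>x\<close> the integral over each circle is a circle mean, that is, a multiple of
  \<open>f x\<close> that depends on the radius only.\<close>

lemma bump_mean:
  assumes f: "circle_mean_on k S f" and s: "cball x s \<subseteq> S" "s > 0" "k \<ge> 0" "k * s \<le> 1"
  defines "F \<equiv> \<lambda>y. if y \<in> cball x s then bump s ((norm (y - x))\<^sup>2) *\<^sub>R f y else 0"
  shows "integrable lborel F" "integral\<^sup>L lborel F = (2 * pi * bump_moment s k) *\<^sub>R f x"
proof -
  have cf: "continuous_on S f" using f by (simp add: circle_mean_on_def)
  show I: "integrable lborel F"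
  proof -
    have "integrable lborel (\<lambda>y. indicator (cball x s) y *\<^sub>R (bump s ((norm (y - x))\<^sup>2) *\<^sub>R f y))"
      by (intro borel_integrable_compact continuous_intros continuous_on_subset[OF cf] s compact_cball)
    moreover have "(\<lambda>y. indicator (cball x s) y *\<^sub>R (bump s ((norm (y - x))\<^sup>2) *\<^sub>R f y)) = F"
      by (auto simp: F_def fun_eq_iff indicator_def)
    ultimately show ?thesis by simp
  qed
  define F0 where "F0 y = F (x + y)" for y
  have "integrable (distr lborel borel ((+) x)) F" using I by (simp add: lborel_distr_plus)
  hence I0: "integrable lborel F0"
    unfolding F0_def by (subst (asm) integrable_distr_eq) (auto simp: borel_measurable_integrable[OF I, simplified])
  have "integral\<^sup>L lborel F = integral\<^sup>L (distr lborel borel ((+) x)) F"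
    by (simp add: lborel_distr_plus)
  also have "\<dots> = integral\<^sup>L lborel F0"
    unfolding F0_def by (subst integral_distr) (auto simp: borel_measurable_integrable[OF I, simplified])
  also have "\<dots> = (\<integral>r. (\<integral>\<theta>. indicator ({0<..} \<times> {0<..<2*pi}) (r, \<theta>) *\<^sub>R (r *\<^sub>R F0 (polar r \<theta>)) \<partial>lborel) \<partial>lborel)"
    by (rule integral_polar[OF I0])
  also have "\<dots> = (\<integral>r. indicator {0..s} r *\<^sub>R ((r * (s\<^sup>2 - r\<^sup>2) ^ 3 * wave_mean k r) *\<^sub>R ((2 * pi) *\<^sub>R f x)) \<partial>lborel)"
  proof (rule Bochner_Integration.integral_cong[OF refl])
    fix r :: real
    show "(\<integral>\<theta>. indicator ({0<..} \<times> {0<..<2*pi}) (r, \<theta>) *\<^sub>R (r *\<^sub>R F0 (polar r \<theta>)) \<partial>lborel) =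
      indicator {0..s} r *\<^sub>R ((r * (s\<^sup>2 - r\<^sup>2) ^ 3 * wave_mean k r) *\<^sub>R ((2 * pi) *\<^sub>R f x))"
    proof (cases "0 < r \<and> r \<le> s")
      case False
      have "indicator ({0<..} \<times> {0<..<2*pi}) (r, \<theta>) *\<^sub>R (r *\<^sub>R F0 (polar r \<theta>)) = 0" for \<theta>
        using False by (auto simp: F0_def F_def indicator_def dist_norm)
      moreover have "indicator {0..s} r *\<^sub>R ((r * (s\<^sup>2 - r\<^sup>2) ^ 3 * wave_mean k r) *\<^sub>R ((2 * pi) *\<^sub>R f x)) = 0"
        using False by (auto simp: indicator_def)
      ultimately show ?thesis by (simp only: Bochner_Integration.integral_zero)
    next
      case True
      have sub: "cball x r \<subseteq> S" using s True by (auto simp: subset_iff)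
      have kr: "k * r \<le> 1"
        using mult_left_mono[of r s k] True s by linarith
      have c: "continuous_on {0..2*pi} (\<lambda>\<theta>. f (x + r *\<^sub>R e_r \<theta>))"
        by (intro continuous_on_compose2[OF cf] continuous_intros)
          (use sub True in \<open>auto simp: subset_iff dist_norm\<close>)
      have E: "(\<lambda>\<theta>. indicator ({0<..} \<times> {0<..<2*pi}) (r, \<theta>) *\<^sub>R (r *\<^sub>R F0 (polar r \<theta>))) =
         (\<lambda>\<theta>. (r * (s\<^sup>2 - r\<^sup>2) ^ 3) *\<^sub>R (indicator {0<..<2*pi} \<theta> *\<^sub>R f (x + r *\<^sub>R e_r \<theta>)))"
      proof
        fix \<theta>
        have "norm (polar r \<theta>) = r" using True by simp
        hence "F0 (polar r \<theta>) = (s\<^sup>2 - r\<^sup>2) ^ 3 *\<^sub>R f (x + r *\<^sub>R e_r \<theta>)"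
          using True bump_eq[of "polar r \<theta>" s] by (simp add: F0_def F_def dist_norm polar_def)
        thus "indicator ({0<..} \<times> {0<..<2*pi}) (r, \<theta>) *\<^sub>R (r *\<^sub>R F0 (polar r \<theta>)) =
          (r * (s\<^sup>2 - r\<^sup>2) ^ 3) *\<^sub>R (indicator {0<..<2*pi} \<theta> *\<^sub>R f (x + r *\<^sub>R e_r \<theta>))"
          using True by (simp add: indicator_def)
      qed
      have L: "(LBINT \<theta>:{0<..<2*pi}. f (x + r *\<^sub>R e_r \<theta>)) = integral {0..2*pi} (\<lambda>\<theta>. f (x + r *\<^sub>R e_r \<theta>))"
      proof -
        have 1: "set_integrable lborel {0..2*pi} (\<lambda>\<theta>. f (x + r *\<^sub>R e_r \<theta>))"
          by (rule borel_integrable_atLeastAtMost'[OF c])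
        hence "set_integrable lborel {0<..<2*pi} (\<lambda>\<theta>. f (x + r *\<^sub>R e_r \<theta>))"
          by (rule set_integrable_subset) auto
        from set_borel_integral_eq_integral(2)[OF this] show ?thesis
          by (simp add: integral_open_interval_real)
      qed
      have "(\<integral>\<theta>. indicator ({0<..} \<times> {0<..<2*pi}) (r, \<theta>) *\<^sub>R (r *\<^sub>R F0 (polar r \<theta>)) \<partial>lborel)
        = (r * (s\<^sup>2 - r\<^sup>2) ^ 3) *\<^sub>R (LBINT \<theta>:{0<..<2*pi}. f (x + r *\<^sub>R e_r \<theta>))"
        unfolding E set_lebesgue_integral_def by (rule integral_scaleR_right)
      also have "\<dots> = (r * (s\<^sup>2 - r\<^sup>2) ^ 3) *\<^sub>R ((2 * pi * wave_mean k r) *\<^sub>R f x)"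
        using f True kr sub unfolding L circle_mean_on_def by simp
      finally show ?thesis using True by (simp add: indicator_def mult_ac)
    qed
  qed
  also have "\<dots> = (LBINT r:{0..s}. r * (s\<^sup>2 - r\<^sup>2) ^ 3 * wave_mean k r) *\<^sub>R ((2 * pi) *\<^sub>R f x)"
    unfolding set_lebesgue_integral_def
  proof -
    have "integrable lborel (\<lambda>r. indicator {0..s} r *\<^sub>R (r * (s\<^sup>2 - r\<^sup>2) ^ 3 * wave_mean k r))"
      by (intro borel_integrable_compact compact_Icc continuous_intros continuous_wave_mean)
    hence "(\<integral>r. (indicator {0..s} r *\<^sub>R (r * (s\<^sup>2 - r\<^sup>2) ^ 3 * wave_mean k r)) *\<^sub>R ((2 * pi) *\<^sub>R f x) \<partial>lborel)
      = (\<integral>r. indicator {0..s} r *\<^sub>R (r * (s\<^sup>2 - r\<^sup>2) ^ 3 * wave_mean k r) \<partial>lborel) *\<^sub>R ((2 * pi) *\<^sub>R f x)"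
      by (intro integral_scaleR_left)
    thus "(\<integral>r. indicator {0..s} r *\<^sub>R ((r * (s\<^sup>2 - r\<^sup>2) ^ 3 * wave_mean k r) *\<^sub>R ((2 * pi) *\<^sub>R f x)) \<partial>lborel)
      = (\<integral>r. indicator {0..s} r *\<^sub>R (r * (s\<^sup>2 - r\<^sup>2) ^ 3 * wave_mean k r) \<partial>lborel) *\<^sub>R ((2 * pi) *\<^sub>R f x)"
      by (simp only: real_scaleR_def scaleR_scaleR mult_ac)
  qed
  also have "(LBINT r:{0..s}. r * (s\<^sup>2 - r\<^sup>2) ^ 3 * wave_mean k r) = bump_moment s k"
    unfolding bump_moment_def
    by (intro set_borel_integral_eq_integral borel_integrable_atLeastAtMost' continuous_intros continuous_wave_mean)
  finally show "integral\<^sup>L lborel F = (2 * pi * bump_moment s k) *\<^sub>R f x" by (simp add: mult_ac)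
qed

lemma integral_strict_mono_continuous:
  fixes f g :: "real \<Rightarrow> real"
  assumes "continuous_on {a..b} f" "continuous_on {a..b} g" "a < b"
    and le: "\<And>x. x \<in> {a..b} \<Longrightarrow> f x \<le> g x" and c: "c \<in> {a..b}" "f c < g c"
  shows "integral {a..b} f < integral {a..b} g"
proof (rule ccontr)
  assume n: "\<not> ?thesis"
  have i: "f integrable_on {a..b}" "g integrable_on {a..b}"
    using assms by (auto intro: integrable_continuous_interval)
  have "integral {a..b} f \<le> integral {a..b} g" by (rule integral_le[OF i le])
  hence "integral {a..b} (\<lambda>x. g x - f x) = 0"
    using n by (simp add: integral_diff i)
  hence "((\<lambda>x. g x - f x) has_integral 0) (cbox a b)"
    using integrable_diff[OF i(2,1)] by (simp add: has_integral_iff cbox_interval)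
  hence "g c - f c = 0"
    by (rule has_integral_0_cbox_imp_0[rotated 2])
      (use assms in \<open>auto simp: cbox_interval box_real intro!: continuous_intros\<close>)
  thus False using c by simp
qed

lemma wave_mean_le_1: "wave_mean k t \<le> 1"
proof -
  have "integral {0..2*pi} (\<lambda>\<phi>. cos (k * t * cos \<phi>)) \<le> integral {0..2*pi} (\<lambda>\<phi>. 1)"
    by (intro integral_le integrable_continuous_interval continuous_intros) auto
  thus ?thesis by (simp add: wave_mean_def divide_simps)
qed

lemma abs_mult_cos_le: "0 \<le> x \<Longrightarrow> \<bar>x * cos \<phi>\<bar> \<le> x" for x :: real
  using mult_left_mono[of "\<bar>cos \<phi>\<bar>" 1 x] by (simp add: abs_mult)

lemma cos_abs_mono: "\<bar>x\<bar> \<le> \<bar>y\<bar> \<Longrightarrow> \<bar>y\<bar> \<le> pi \<Longrightarrow> cos y \<le> cos x" for x y :: real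
  using cos_monotone_0_pi_le[of "\<bar>x\<bar>" "\<bar>y\<bar>"] by simp

lemma wave_mean_ge:
  assumes "0 \<le> t" "0 \<le> k" "k * t \<le> 1"
  shows "cos (k * t) \<le> wave_mean k t"
proof -
  have "cos (k * t) \<le> cos (k * t * cos \<phi>)" for \<phi>
    using assms abs_mult_cos_le[of "k * t" \<phi>] pi_gt3 by (intro cos_abs_mono) auto
  hence "integral {0..2*pi} (\<lambda>\<phi>. cos (k * t)) \<le> integral {0..2*pi} (\<lambda>\<phi>. cos (k * t * cos \<phi>))"
    by (intro integral_le integrable_continuous_interval continuous_intros) auto
  thus ?thesis by (simp add: wave_mean_def divide_simps mult.commute)
qed

lemma wave_mean_strict_antimono:
  assumes "0 < t" "0 < k" "k < k'" "k' * t \<le> 1"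
  shows "wave_mean k' t < wave_mean k t"
proof -
  have kt: "k * t < k' * t" using assms by simp
  have "integral {0..2*pi} (\<lambda>\<phi>. cos (k' * t * cos \<phi>)) < integral {0..2*pi} (\<lambda>\<phi>. cos (k * t * cos \<phi>))"
  proof (rule integral_strict_mono_continuous[where c = 0])
    fix \<phi> :: real
    have "\<bar>k * t * cos \<phi>\<bar> \<le> \<bar>k' * t * cos \<phi>\<bar>"
      using kt assms by (auto simp: abs_mult intro!: mult_right_mono)
    moreover have "\<bar>k' * t * cos \<phi>\<bar> \<le> pi"
      using abs_mult_cos_le[of "k' * t" \<phi>] assms pi_gt3 by auto
    ultimately show "cos (k' * t * cos \<phi>) \<le> cos (k * t * cos \<phi>)" by (rule cos_abs_mono)
  next
    show "cos (k' * t * cos 0) < cos (k * t * cos 0)"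
      using kt assms pi_gt3 by (auto intro!: cos_monotone_0_pi)
  qed (auto intro!: continuous_intros)
  thus ?thesis by (simp add: wave_mean_def divide_strict_right_mono)
qed

lemma continuous_moment_integrand:
  "continuous_on {0..s} (\<lambda>r. r * (s\<^sup>2 - r\<^sup>2) ^ 3 * wave_mean k r)"
  "continuous_on {0..s} (\<lambda>r. r * (s\<^sup>2 - r\<^sup>2) ^ 3 :: real)"
  by (intro continuous_intros continuous_wave_mean)+

lemma moment_weight_nonneg: "r \<in> {0..s} \<Longrightarrow> 0 \<le> r * (s\<^sup>2 - r\<^sup>2) ^ 3" for r s :: real
  using power_mono[of r s 2] by (intro mult_nonneg_nonneg zero_le_power) auto

text \<open>Comparison with the moment at frequency zero; the bounds show that the two become equal to leading order for
  small radii.\<close>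

lemma bump_moment_bounds:
  assumes s: "s > 0" "k \<ge> 0" "k * s \<le> 1"
  defines "m \<equiv> integral {0..s} (\<lambda>r. r * (s\<^sup>2 - r\<^sup>2) ^ 3)"
  shows "0 < m" "bump_moment s k \<le> m" "cos (k * s) * m \<le> bump_moment s k"
proof -
  have "integral {0..s} (\<lambda>r. 0) < m" unfolding m_def
  proof (rule integral_strict_mono_continuous[where c = "s / 2"])
    have "(s / 2)\<^sup>2 < s\<^sup>2" using s by (simp add: power_divide)
    thus "0 < s / 2 * (s\<^sup>2 - (s / 2)\<^sup>2) ^ 3" using s by simp
  qed (use s moment_weight_nonneg continuous_moment_integrand in \<open>auto\<close>)
  thus "0 < m" by simp
  show "bump_moment s k \<le> m"
    unfolding bump_moment_def m_def
  proof (rule integral_le)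
    fix r assume r: "r \<in> {0..s}"
    show "r * (s\<^sup>2 - r\<^sup>2) ^ 3 * wave_mean k r \<le> r * (s\<^sup>2 - r\<^sup>2) ^ 3"
      using mult_left_mono[OF wave_mean_le_1 moment_weight_nonneg[OF r]] by simp
  qed (auto intro!: integrable_continuous_interval continuous_moment_integrand)
  have "integral {0..s} (\<lambda>r. cos (k * s) * (r * (s\<^sup>2 - r\<^sup>2) ^ 3)) \<le> bump_moment s k"
    unfolding bump_moment_def
  proof (rule integral_le)
    fix r assume r: "r \<in> {0..s}"
    have "k * r \<le> k * s" using r s by (intro mult_left_mono) auto
    hence "cos (k * s) \<le> cos (k * r)" "k * r \<le> 1"
      using r s pi_gt3 by (auto intro!: cos_monotone_0_pi_le)
    hence "cos (k * s) \<le> wave_mean k r" using wave_mean_ge[of r k] r s by auto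
    thus "cos (k * s) * (r * (s\<^sup>2 - r\<^sup>2) ^ 3) \<le> r * (s\<^sup>2 - r\<^sup>2) ^ 3 * wave_mean k r"
      using mult_left_mono[OF _ moment_weight_nonneg[OF r]] by (simp add: mult.commute)
  qed (auto intro!: integrable_continuous_interval continuous_intros continuous_moment_integrand)
  thus "cos (k * s) * m \<le> bump_moment s k" by (simp add: m_def)
qed

lemma bump_moment_strict_antimono:
  assumes s: "s > 0" "0 < k" "k < k'" "k' * s \<le> 1"
  shows "bump_moment s k' < bump_moment s k"
  unfolding bump_moment_def
proof (rule integral_strict_mono_continuous[where c = "s / 2"])
  have w: "wave_mean k' r < wave_mean k r" if "0 < r" "r \<le> s" for r
  proof -
    have "k' * r \<le> k' * s" using that s by (intro mult_left_mono) auto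
    hence "k' * r \<le> 1" using s by linarith
    thus ?thesis using that s by (intro wave_mean_strict_antimono) auto
  qed
  show "r * (s\<^sup>2 - r\<^sup>2) ^ 3 * wave_mean k' r \<le> r * (s\<^sup>2 - r\<^sup>2) ^ 3 * wave_mean k r" if "r \<in> {0..s}" for r
  proof (cases "r = 0")
    case False
    thus ?thesis using that w[of r] moment_weight_nonneg[OF that] by (intro mult_left_mono) auto
  qed simp
  have "(s / 2)\<^sup>2 < s\<^sup>2" using s by (simp add: power_divide)
  hence "0 < s / 2 * (s\<^sup>2 - (s / 2)\<^sup>2) ^ 3" using s by simp
  thus "s / 2 * (s\<^sup>2 - (s / 2)\<^sup>2) ^ 3 * wave_mean k' (s / 2) < s / 2 * (s\<^sup>2 - (s / 2)\<^sup>2) ^ 3 * wave_mean k (s / 2)"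
    using w[of "s / 2"] s by (intro mult_strict_left_mono) auto
qed (use s continuous_moment_integrand in auto)

text \<open>The moments of a single bump at the two wave numbers differ, but their quotient tends to one as
  the radius shrinks. So two radii give linearly independent moment vectors, and a combination of the
  two bumps has the normalised moment at both wave numbers.\<close>

lemma ex_two_bumps:
  assumes k: "0 < k" "k < k'" and d: "d > 0"
  shows "\<exists>s1 s2 A B. 0 < s2 \<and> s2 \<le> s1 \<and> s1 \<le> d \<and> k' * s1 \<le> 1 \<and>
    A * bump_moment s1 k + B * bump_moment s2 k = 1 / (2 * pi) \<and>
    A * bump_moment s1 k' + B * bump_moment s2 k' = 1 / (2 * pi)"
proof -
  define s1 where "s1 = min d (1 / k')"
  have s1: "0 < s1" "s1 \<le> d" using k d by (auto simp: s1_def)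
  have "k' * s1 \<le> k' * (1 / k')" using k by (intro mult_left_mono) (auto simp: s1_def)
  hence ks1: "k' * s1 \<le> 1" using k by simp
  define I where "I = bump_moment s1"
  have I: "I k' < I k" unfolding I_def by (rule bump_moment_strict_antimono) (use s1 ks1 k in auto)
  have "k' * s1 < pi / 2" using ks1 pi_gt3 by linarith
  hence "cos (k' * s1) > 0" using k s1 by (intro cos_gt_zero) auto
  hence I0: "I k' > 0"
    using bump_moment_bounds[of s1 k'] s1 ks1 k unfolding I_def
    by (meson less_le_trans mult_pos_pos order_less_imp_le)
  have ex: "\<exists>s. 0 < s \<and> s \<le> s1 \<and> I k * cos (k' * s) > I k'"
  proof -
    have "((\<lambda>s. I k * cos (k' * s)) \<longlongrightarrow> I k * cos (k' * 0)) (at_right 0)"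
      by (intro tendsto_intros)
    hence "eventually (\<lambda>s. I k * cos (k' * s) > I k') (at_right 0)"
      by (rule order_tendstoD) (use I in simp)
    moreover have "eventually (\<lambda>s. s \<in> {0<..<s1}) (at_right 0)"
      by (rule eventually_at_right_real) (use s1 in auto)
    ultimately have "eventually (\<lambda>s. I k * cos (k' * s) > I k' \<and> s \<in> {0<..<s1}) (at_right 0)"
      by (rule eventually_conj)
    from eventually_happens[OF this] show ?thesis by auto
  qed
  then obtain s2 where s2: "0 < s2" "s2 \<le> s1" "I k * cos (k' * s2) > I k'" by blast
  have ks2: "k' * s2 \<le> 1" using mult_left_mono[of s2 s1 k'] s2 ks1 k by linarith
  have kks2: "k * s2 \<le> 1" using mult_right_mono[of k k' s2] ks2 k s2 by linarith
  define m where "m = integral {0..s2} (\<lambda>r. r * (s2\<^sup>2 - r\<^sup>2) ^ 3)"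
  have m: "0 < m" "bump_moment s2 k \<le> m" "cos (k' * s2) * m \<le> bump_moment s2 k'"
    unfolding m_def using bump_moment_bounds[of s2 k] bump_moment_bounds[of s2 k'] s2 ks2 kks2 k by auto
  have "I k' * bump_moment s2 k \<le> I k' * m" using m I0 by simp
  also have "\<dots> < I k * cos (k' * s2) * m" using m s2 by simp
  also have "\<dots> \<le> I k * bump_moment s2 k'"
    using m I I0 by (simp add: mult.assoc)
  finally have det: "I k * bump_moment s2 k' - I k' * bump_moment s2 k \<noteq> 0" by simp
  define D where "D = 2 * pi * (I k * bump_moment s2 k' - I k' * bump_moment s2 k)"
  have D: "D \<noteq> 0" using det by (simp add: D_def)
  define A where "A = (bump_moment s2 k' - bump_moment s2 k) / D"
  define B where "B = (I k - I k') / D"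
  have "A * I k + B * bump_moment s2 k = 1 / (2 * pi)"
  proof -
    have "A * I k + B * bump_moment s2 k = (I k * bump_moment s2 k' - I k' * bump_moment s2 k) / D"
      unfolding A_def B_def by (simp add: add_divide_distrib[symmetric] algebra_simps)
    thus ?thesis using det by (simp add: D_def)
  qed
  moreover have "A * I k' + B * bump_moment s2 k' = 1 / (2 * pi)"
  proof -
    have "A * I k' + B * bump_moment s2 k' = (I k * bump_moment s2 k' - I k' * bump_moment s2 k) / D"
      unfolding A_def B_def by (simp add: add_divide_distrib[symmetric] algebra_simps)
    thus ?thesis using det by (simp add: D_def)
  qed
  ultimately show ?thesis unfolding I_def using s1 s2 ks1 by blast
qed

text \<open>Estimates for the elastic fields concern only the sum of their two Helmholtz parts. Bounds on the
  separate parts would need derivatives of the sum, so the kernel has to reproduce both parts at once.\<close>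

definition two_wave_on :: "real \<Rightarrow> real \<Rightarrow> (real^2) set \<Rightarrow> (real^2 \<Rightarrow> complex) \<Rightarrow> bool" where
  "two_wave_on k k' S f \<longleftrightarrow>
     (\<exists>g g'. circle_mean_on k S g \<and> circle_mean_on k' S g' \<and> (\<forall>x\<in>S. f x = g x + g' x))"

lemma two_wave_on_continuous: "two_wave_on k k' S f \<Longrightarrow> continuous_on S f"
proof -
  assume "two_wave_on k k' S f"
  then obtain g g' where g: "continuous_on S g" "continuous_on S g'" "\<forall>x\<in>S. f x = g x + g' x"
    unfolding two_wave_on_def circle_mean_on_def by blast
  have "continuous_on S (\<lambda>x. g x + g' x)" using g by (intro continuous_intros)
  thus ?thesis by (rule continuous_on_eq) (use g in auto)
qed

lemma bump_mean_integral:
  assumes f: "circle_mean_on k S f" and s: "cball x s \<subseteq> X" "X \<subseteq> S" "s > 0" "k \<ge> 0" "k * s \<le> 1"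
  shows "((\<lambda>y. bump s ((norm (y - x))\<^sup>2) *\<^sub>R f y) has_integral (2 * pi * bump_moment s k) *\<^sub>R f x) X"
proof -
  define F where "F = (\<lambda>y. if y \<in> cball x s then bump s ((norm (y - x))\<^sup>2) *\<^sub>R f y else 0)"
  have "integrable lborel F" "integral\<^sup>L lborel F = (2 * pi * bump_moment s k) *\<^sub>R f x"
    unfolding F_def by (rule bump_mean[OF f]; use s in auto)+
  hence "(F has_integral (2 * pi * bump_moment s k) *\<^sub>R f x) UNIV"
    using has_integral_integral_lborel[of F] by simp
  also have "F = (\<lambda>y. if y \<in> X then bump s ((norm (y - x))\<^sup>2) *\<^sub>R f y else 0)"
  proof
    fix y
    show "F y = (if y \<in> X then bump s ((norm (y - x))\<^sup>2) *\<^sub>R f y else 0)"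
    proof (cases "y \<in> cball x s")
      case False
      hence "bump s ((norm (y - x))\<^sup>2) = 0" using s by (intro bump_eq_0) (auto simp: dist_norm norm_minus_commute)
      thus ?thesis using False by (simp add: F_def)
    qed (use s in \<open>auto simp: F_def\<close>)
  qed
  finally show ?thesis by (simp add: has_integral_restrict_UNIV)
qed

lemma two_wave_reproducing:
  assumes k: "0 < k" "k < k'"
    and s: "0 < s2" "s2 \<le> s1" "k' * s1 \<le> 1"
    and A: "A * bump_moment s1 k + B * bump_moment s2 k = 1 / (2 * pi)"
       "A * bump_moment s1 k' + B * bump_moment s2 k' = 1 / (2 * pi)"
    and f: "two_wave_on k k' S f" and X: "cball x s1 \<subseteq> X" "X \<subseteq> S"
  shows "((\<lambda>y. (A * bump s1 ((norm (y - x))\<^sup>2) + B * bump s2 ((norm (y - x))\<^sup>2)) *\<^sub>R f y) has_integral f x) X"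
proof -
  obtain g g' where g: "circle_mean_on k S g" "circle_mean_on k' S g'" "\<And>x. x \<in> S \<Longrightarrow> f x = g x + g' x"
    using f unfolding two_wave_on_def by blast
  have s2: "cball x s2 \<subseteq> X" using X s by (auto simp: subset_iff)
  have "x \<in> cball x s1" using s by simp
  hence x: "x \<in> S" using X by blast
  have le: "k' * s2 \<le> 1" "k * s1 \<le> 1" "k * s2 \<le> 1"
  proof -
    show 1: "k' * s2 \<le> 1" using mult_left_mono[of s2 s1 k'] s k by linarith
    show "k * s1 \<le> 1" using mult_right_mono[of k k' s1] s k by linarith
    show "k * s2 \<le> 1" using mult_right_mono[of k k' s2] 1 s k by linarith
  qed
  have mean: "((\<lambda>y. A *\<^sub>R (bump s1 ((norm (y - x))\<^sup>2) *\<^sub>R h y) + B *\<^sub>R (bump s2 ((norm (y - x))\<^sup>2) *\<^sub>R h y)) has_integral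
     A *\<^sub>R ((2 * pi * bump_moment s1 \<kappa>) *\<^sub>R h x) + B *\<^sub>R ((2 * pi * bump_moment s2 \<kappa>) *\<^sub>R h x)) X"
    if h: "circle_mean_on \<kappa> S h" "\<kappa> \<ge> 0" "\<kappa> * s1 \<le> 1" "\<kappa> * s2 \<le> 1" for h \<kappa>
    by (intro has_integral_add has_integral_cmul bump_mean_integral[OF h(1)]) (use X s s2 h in auto)
  have "A *\<^sub>R ((2 * pi * bump_moment s1 \<kappa>) *\<^sub>R h) + B *\<^sub>R ((2 * pi * bump_moment s2 \<kappa>) *\<^sub>R h) = h"
    if "A * bump_moment s1 \<kappa> + B * bump_moment s2 \<kappa> = 1 / (2 * pi)" for h :: complex and \<kappa>
  proof -
    have "A *\<^sub>R ((2 * pi * bump_moment s1 \<kappa>) *\<^sub>R h) + B *\<^sub>R ((2 * pi * bump_moment s2 \<kappa>) *\<^sub>R h)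
      = (2 * pi * (A * bump_moment s1 \<kappa> + B * bump_moment s2 \<kappa>)) *\<^sub>R h"
      by (simp only: scaleR_scaleR scaleR_add_left[symmetric]) (simp add: algebra_simps)
    thus ?thesis unfolding that by simp
  qed
  note combine = this
  have k': "0 \<le> k'" using k by simp
  from has_integral_add[OF mean[OF g(1) less_imp_le[OF k(1)] le(2,3), unfolded combine[OF A(1)]]
      mean[OF g(2) k' s(3) le(1), unfolded combine[OF A(2)]]]
  show ?thesis
    unfolding g(3)[OF x]
    by (rule has_integral_eq[rotated]) (use g(3) X in \<open>auto simp: algebra_simps subset_iff\<close>)
qed

section \<open>Interior regularity in the radial direction\<close>

lemma max_pow_derivative:
  "((\<lambda>x. max 0 x ^ (n + 2)) has_real_derivative real (n + 2) * max 0 x ^ (n + 1)) (at x)"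
proof -
  consider "x < 0" | "x > 0" | "x = 0" by linarith
  thus ?thesis
  proof cases
    case 1
    have "((\<lambda>_. 0) has_real_derivative 0) (at x)" by simp
    hence "((\<lambda>x. max 0 x ^ (n + 2)) has_real_derivative 0) (at x)"
      by (rule has_field_derivative_transform_within_open[where S = "{..<0}"]) (use 1 in auto)
    thus ?thesis using 1 by simp
  next
    case 2
    have "((\<lambda>x. x ^ (n + 2)) has_real_derivative real (n + 2) * x ^ (n + 1)) (at x)"
      using DERIV_pow[of "n + 2" x UNIV] by simp
    hence "((\<lambda>x. max 0 x ^ (n + 2)) has_real_derivative real (n + 2) * x ^ (n + 1)) (at x)"
      by (rule has_field_derivative_transform_within_open[where S = "{0<..}"]) (use 2 in auto)
    thus ?thesis using 2 by simp
  next
    case 3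
    have "((\<lambda>h::real. \<bar>h\<bar> ^ (n + 1)) \<longlongrightarrow> \<bar>0\<bar> ^ (n + 1)) (at 0)"
      by (intro tendsto_intros)
    hence "((\<lambda>h::real. \<bar>h\<bar> ^ (n + 1)) \<longlongrightarrow> 0) (at 0)" by simp
    hence "((\<lambda>h::real. max 0 h ^ (n + 2) / h) \<longlongrightarrow> 0) (at 0)"
    proof (rule Lim_null_comparison[rotated])
      have "norm (max 0 h ^ (n + 2) / h) \<le> \<bar>h\<bar> ^ (n + 1)" for h :: real
      proof (cases "h > 0")
        case False
        hence "max 0 h = 0" by simp
        moreover have "0 \<le> \<bar>h\<bar> ^ (n + 1)" by (intro zero_le_power abs_ge_zero)
        ultimately show ?thesis by (simp only: power_add power2_eq_square mult_zero_right div_0 norm_zero)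
      qed (simp add: abs_mult)
      thus "\<forall>\<^sub>F h in at 0. norm (max 0 h ^ (n + 2) / h) \<le> \<bar>h\<bar> ^ (n + 1)" for h :: real
        by simp
    qed
    thus ?thesis using 3 by (simp add: DERIV_def)
  qed
qed

text \<open>Profiles are functions of the squared distance, so that the kernels that they define have two continuous
  derivatives at the centre as well.\<close>

definition C2_profile :: "(real \<Rightarrow> real) \<Rightarrow> (real \<Rightarrow> real) \<Rightarrow> (real \<Rightarrow> real) \<Rightarrow> bool" where
  "C2_profile \<kappa> \<kappa>1 \<kappa>2 \<longleftrightarrow> (\<forall>q. (\<kappa> has_real_derivative \<kappa>1 q) (at q)) \<and>
     (\<forall>q. (\<kappa>1 has_real_derivative \<kappa>2 q) (at q)) \<and> continuous_on UNIV \<kappa>2"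

lemma C2_profile_bumps: "\<exists>\<kappa>1 \<kappa>2. C2_profile (\<lambda>q. A * bump s q + B * bump t q) \<kappa>1 \<kappa>2"
proof -
  define b1 where "b1 s q = - (3 * max 0 (s\<^sup>2 - q) ^ 2)" for s q :: real
  define b2 where "b2 s q = 6 * max 0 (s\<^sup>2 - q)" for s q :: real
  have 1: "(bump s has_real_derivative b1 s q) (at q)" for s q
  proof -
    have "((\<lambda>q. max 0 (s\<^sup>2 - q) ^ (1 + 2)) has_real_derivative (real (1 + 2) * max 0 (s\<^sup>2 - q) ^ (1 + 1)) * (- 1)) (at q)"
      by (rule DERIV_chain2[OF max_pow_derivative]) (auto intro!: derivative_eq_intros)
    thus ?thesis unfolding bump_def[abs_def] b1_def by (simp add: numeral_eq_Suc)
  qed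
  have 2: "(b1 s has_real_derivative b2 s q) (at q)" for s q
  proof -
    have "((\<lambda>q. max 0 (s\<^sup>2 - q) ^ (0 + 2)) has_real_derivative (real (0 + 2) * max 0 (s\<^sup>2 - q) ^ (0 + 1)) * (- 1)) (at q)"
      by (rule DERIV_chain2[OF max_pow_derivative]) (auto intro!: derivative_eq_intros)
    hence "((\<lambda>q. (- 3) * max 0 (s\<^sup>2 - q) ^ (0 + 2)) has_real_derivative (- 3) * ((real (0 + 2) * max 0 (s\<^sup>2 - q) ^ (0 + 1)) * (- 1))) (at q)"
      by (rule DERIV_cmult)
    thus ?thesis unfolding b1_def[abs_def] b2_def by (simp add: power2_eq_square)
  qed
  have "C2_profile (\<lambda>q. A * bump s q + B * bump t q) (\<lambda>q. A * b1 s q + B * b1 t q) (\<lambda>q. A * b2 s q + B * b2 t q)"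
    unfolding C2_profile_def
  proof (intro conjI allI)
    show "continuous_on UNIV (\<lambda>q. A * b2 s q + B * b2 t q)"
      unfolding b2_def by (intro continuous_intros)
  qed (intro DERIV_add DERIV_cmult 1 2)+
  thus ?thesis by blast
qed

text \<open>The first and second derivative in \<open>r\<close> of \<open>\<kappa>(|y - r e\<^sub>r|\<^sup>2)\<close>, where \<open>\<kappa>1\<close> and \<open>\<kappa>2\<close> are the
  derivatives of \<open>\<kappa>\<close>.\<close>

definition radial_kernel1 :: "(real \<Rightarrow> real) \<Rightarrow> real \<Rightarrow> real \<Rightarrow> real^2 \<Rightarrow> real" where
  "radial_kernel1 \<kappa>1 r \<theta> y = \<kappa>1 ((norm (y - polar r \<theta>))\<^sup>2) * (- 2 * ((y - polar r \<theta>) \<bullet> e_r \<theta>))"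

definition radial_kernel2 :: "(real \<Rightarrow> real) \<Rightarrow> (real \<Rightarrow> real) \<Rightarrow> real \<Rightarrow> real \<Rightarrow> real^2 \<Rightarrow> real" where
  "radial_kernel2 \<kappa>1 \<kappa>2 r \<theta> y = \<kappa>2 ((norm (y - polar r \<theta>))\<^sup>2) * (4 * ((y - polar r \<theta>) \<bullet> e_r \<theta>)\<^sup>2)
     + 2 * \<kappa>1 ((norm (y - polar r \<theta>))\<^sup>2)"

lemma radial_kernel_derivatives:
  assumes "C2_profile \<kappa> \<kappa>1 \<kappa>2"
  shows "((\<lambda>r. \<kappa> ((norm (y - polar r \<theta>))\<^sup>2)) has_real_derivative radial_kernel1 \<kappa>1 r \<theta> y) (at r within T)"
    "((\<lambda>r. radial_kernel1 \<kappa>1 r \<theta> y) has_real_derivative radial_kernel2 \<kappa>1 \<kappa>2 r \<theta> y) (at r within T)"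
proof -
  have ee: "e_r \<theta> \<bullet> e_r \<theta> = 1" by (simp add: dot_square_norm)
  have q: "((\<lambda>r. (norm (y - polar r \<theta>))\<^sup>2) has_real_derivative - 2 * ((y - polar r \<theta>) \<bullet> e_r \<theta>)) (at r within T)" for r
  proof -
    have "(norm (y - polar r \<theta>))\<^sup>2 = y \<bullet> y - 2 * r * (y \<bullet> e_r \<theta>) + r * r" for r
      unfolding power2_norm_eq_inner polar_def
      by (simp add: inner_diff_left inner_diff_right ee inner_commute)
    hence "(\<lambda>r. (norm (y - polar r \<theta>))\<^sup>2) = (\<lambda>r. y \<bullet> y - 2 * r * (y \<bullet> e_r \<theta>) + r * r)" by blast
    moreover have "((\<lambda>r. y \<bullet> y - 2 * r * (y \<bullet> e_r \<theta>) + r * r) has_real_derivative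
        - 2 * (y \<bullet> e_r \<theta>) + 2 * r) (at r within T)"
      by (auto intro!: derivative_eq_intros)
    moreover have "- 2 * ((y - polar r \<theta>) \<bullet> e_r \<theta>) = - 2 * (y \<bullet> e_r \<theta>) + 2 * r"
      by (simp add: polar_def inner_diff_left ee)
    ultimately show ?thesis by simp
  qed
  have l: "((\<lambda>r. - 2 * ((y - polar r \<theta>) \<bullet> e_r \<theta>)) has_real_derivative 2) (at r within T)" for r
  proof -
    have "(\<lambda>r. - 2 * ((y - polar r \<theta>) \<bullet> e_r \<theta>)) = (\<lambda>r. - 2 * (y \<bullet> e_r \<theta>) + 2 * r)"
      by (simp add: fun_eq_iff polar_def inner_diff_left ee)
    thus ?thesis by (auto intro!: derivative_eq_intros)
  qed
  have k: "(\<kappa> has_real_derivative \<kappa>1 q) (at q)" "(\<kappa>1 has_real_derivative \<kappa>2 q) (at q)" for q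
    using assms by (auto simp: C2_profile_def)
  show "((\<lambda>r. \<kappa> ((norm (y - polar r \<theta>))\<^sup>2)) has_real_derivative radial_kernel1 \<kappa>1 r \<theta> y) (at r within T)"
    unfolding radial_kernel1_def by (rule DERIV_chain2[OF k(1) q])
  have "((\<lambda>r. radial_kernel1 \<kappa>1 r \<theta> y) has_real_derivative
     (\<kappa>2 ((norm (y - polar r \<theta>))\<^sup>2) * (- 2 * ((y - polar r \<theta>) \<bullet> e_r \<theta>))) * (- 2 * ((y - polar r \<theta>) \<bullet> e_r \<theta>))
     + 2 * \<kappa>1 ((norm (y - polar r \<theta>))\<^sup>2)) (at r within T)"
    unfolding radial_kernel1_def by (rule DERIV_mult[OF DERIV_chain2[OF k(2) q] l])
  thus "((\<lambda>r. radial_kernel1 \<kappa>1 r \<theta> y) has_real_derivative radial_kernel2 \<kappa>1 \<kappa>2 r \<theta> y) (at r within T)"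
    by (simp add: radial_kernel2_def power2_eq_square mult_ac)
qed

lemma C2_profile_continuous:
  assumes "C2_profile \<kappa> \<kappa>1 \<kappa>2"
  shows "continuous_on T \<kappa>" "continuous_on T \<kappa>1" "continuous_on T \<kappa>2"
proof -
  have "continuous_on UNIV \<kappa>" "continuous_on UNIV \<kappa>1"
    using assms by (auto simp: C2_profile_def intro!: continuous_at_imp_continuous_on DERIV_isCont)
  thus "continuous_on T \<kappa>" "continuous_on T \<kappa>1" by (auto intro: continuous_on_subset)
  show "continuous_on T \<kappa>2"
    using assms unfolding C2_profile_def by (meson continuous_on_subset subset_UNIV)
qed

lemma radial_kernel_continuous:
  assumes "C2_profile \<kappa> \<kappa>1 \<kappa>2"
    "continuous_on T a" "continuous_on T b" "continuous_on T c"
  shows "continuous_on T (\<lambda>x. radial_kernel1 \<kappa>1 (a x) (b x) (c x))"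
    "continuous_on T (\<lambda>x. radial_kernel2 \<kappa>1 \<kappa>2 (a x) (b x) (c x))"
  unfolding radial_kernel1_def radial_kernel2_def polar_def
  by (intro continuous_intros assms(2-4)
      continuous_on_compose2[OF C2_profile_continuous(2)[OF assms(1), of UNIV]]
      continuous_on_compose2[OF C2_profile_continuous(3)[OF assms(1), of UNIV]]; simp)+

lemma radial_kernel_bounds:
  assumes \<kappa>: "C2_profile \<kappa> \<kappa>1 \<kappa>2"
  shows "\<exists>C>0. \<forall>r \<theta> y. norm (y - polar r \<theta>) \<le> d \<longrightarrow> \<bar>\<kappa> ((norm (y - polar r \<theta>))\<^sup>2)\<bar> \<le> C \<and>
     \<bar>radial_kernel1 \<kappa>1 r \<theta> y\<bar> \<le> C \<and> \<bar>radial_kernel2 \<kappa>1 \<kappa>2 r \<theta> y\<bar> \<le> C"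
proof -
  have "\<exists>B>0. \<forall>q\<in>{0..d\<^sup>2}. \<bar>f q\<bar> \<le> B" if "continuous_on UNIV f" for f :: "real \<Rightarrow> real"
  proof -
    have "bounded (f ` {0..d\<^sup>2})"
      by (intro compact_imp_bounded compact_continuous_image continuous_on_subset[OF that]) auto
    thus ?thesis by (auto simp: bounded_pos)
  qed
  from this[OF C2_profile_continuous(1)[OF \<kappa>]] this[OF C2_profile_continuous(2)[OF \<kappa>]] this[OF C2_profile_continuous(3)[OF \<kappa>]]
  obtain B0 B1 B2 where B: "B0 > 0" "B1 > 0" "B2 > 0"
    "\<And>q. q \<in> {0..d\<^sup>2} \<Longrightarrow> \<bar>\<kappa> q\<bar> \<le> B0" "\<And>q. q \<in> {0..d\<^sup>2} \<Longrightarrow> \<bar>\<kappa>1 q\<bar> \<le> B1"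
    "\<And>q. q \<in> {0..d\<^sup>2} \<Longrightarrow> \<bar>\<kappa>2 q\<bar> \<le> B2" by blast
  define C where "C = B0 + B1 * (2 * \<bar>d\<bar>) + (B2 * (4 * d\<^sup>2) + 2 * B1)"
  have C: "B0 \<le> C" "B1 * (2 * \<bar>d\<bar>) \<le> C" "B2 * (4 * d\<^sup>2) + 2 * B1 \<le> C" "C > 0"
    using B by (auto simp: C_def intro!: add_pos_pos add_nonneg_pos mult_nonneg_nonneg add_nonneg_nonneg)
  have "\<bar>\<kappa> ((norm (y - polar r \<theta>))\<^sup>2)\<bar> \<le> C \<and>
     \<bar>radial_kernel1 \<kappa>1 r \<theta> y\<bar> \<le> C \<and> \<bar>radial_kernel2 \<kappa>1 \<kappa>2 r \<theta> y\<bar> \<le> C"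
    if d: "norm (y - polar r \<theta>) \<le> d" for r \<theta> y
  proof -
    let ?q = "(norm (y - polar r \<theta>))\<^sup>2" and ?w = "(y - polar r \<theta>) \<bullet> e_r \<theta>"
    have q: "?q \<in> {0..d\<^sup>2}" using d by (auto intro: power_mono)
    have "\<bar>?w\<bar> \<le> norm (y - polar r \<theta>) * norm (e_r \<theta>)" by (rule Cauchy_Schwarz_ineq2)
    hence w: "\<bar>?w\<bar> \<le> \<bar>d\<bar>" using d by simp
    have w2: "?w\<^sup>2 \<le> d\<^sup>2" using w by (simp add: abs_le_square_iff)
    have "\<bar>radial_kernel1 \<kappa>1 r \<theta> y\<bar> \<le> B1 * (2 * \<bar>d\<bar>)"
      unfolding radial_kernel1_def abs_mult using B(5)[OF q] w B by (intro mult_mono) auto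
    moreover have "\<bar>radial_kernel2 \<kappa>1 \<kappa>2 r \<theta> y\<bar> \<le> B2 * (4 * d\<^sup>2) + 2 * B1"
    proof -
      have "\<bar>radial_kernel2 \<kappa>1 \<kappa>2 r \<theta> y\<bar> \<le> \<bar>\<kappa>2 ?q * (4 * ?w\<^sup>2)\<bar> + \<bar>2 * \<kappa>1 ?q\<bar>"
        unfolding radial_kernel2_def by (rule abs_triangle_ineq)
      also have "\<bar>\<kappa>2 ?q * (4 * ?w\<^sup>2)\<bar> \<le> B2 * (4 * d\<^sup>2)"
        unfolding abs_mult using B(6)[OF q] w2 B by (intro mult_mono) auto
      finally show ?thesis using B(5)[OF q] by linarith
    qed
    ultimately show ?thesis using C B(4)[OF q] by linarith
  qed
  thus ?thesis using C(4) by blast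
qed

text \<open>Differentiation under the integral falls on the kernel, which has two continuous derivatives; the field
  itself only has to be continuous.\<close>

lemma reproduced_radial_derivatives:
  fixes f :: "real^2 \<Rightarrow> 'a::banach"
  assumes \<kappa>: "C2_profile \<kappa> \<kappa>1 \<kappa>2" and f: "continuous_on (cbox a b) f" and P: "open P"
    and rep: "\<And>x. x \<in> P \<Longrightarrow> f x = integral (cbox a b) (\<lambda>y. \<kappa> ((norm (y - x))\<^sup>2) *\<^sub>R f y)"
  shows "polar r \<theta> \<in> P \<Longrightarrow> ((\<lambda>r. f (polar r \<theta>)) has_vector_derivative
      integral (cbox a b) (\<lambda>y. radial_kernel1 \<kappa>1 r \<theta> y *\<^sub>R f y)) (at r)"
    "((\<lambda>r. integral (cbox a b) (\<lambda>y. radial_kernel1 \<kappa>1 r \<theta> y *\<^sub>R f y)) has_vector_derivative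
      integral (cbox a b) (\<lambda>y. radial_kernel2 \<kappa>1 \<kappa>2 r \<theta> y *\<^sub>R f y)) (at r)"
    "continuous_on UNIV (\<lambda>(r, \<theta>). integral (cbox a b) (\<lambda>y. radial_kernel1 \<kappa>1 r \<theta> y *\<^sub>R f y))"
proof -
  have fs: "continuous_on (T \<times> cbox a b) (\<lambda>x. f (snd x))" for T :: "'b::topological_space set"
    by (rule continuous_on_compose2[OF f]) (auto intro!: continuous_intros)
  have 1: "((\<lambda>r. integral (cbox a b) (\<lambda>y. \<kappa> ((norm (y - polar r \<theta>))\<^sup>2) *\<^sub>R f y)) has_vector_derivative
      integral (cbox a b) (\<lambda>y. radial_kernel1 \<kappa>1 r \<theta> y *\<^sub>R f y)) (at r)" for r
  proof (rule leibniz_rule_vector_derivative[where U = UNIV])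
    show "((\<lambda>r. \<kappa> ((norm (y - polar r \<theta>))\<^sup>2) *\<^sub>R f y) has_vector_derivative radial_kernel1 \<kappa>1 r \<theta> y *\<^sub>R f y) (at r)" for r y
      using has_vector_derivative_scaleR[OF radial_kernel_derivatives(1)[OF \<kappa>] has_vector_derivative_const] by simp
    show "(\<lambda>y. \<kappa> ((norm (y - polar r \<theta>))\<^sup>2) *\<^sub>R f y) integrable_on cbox a b" for r
      by (intro integrable_continuous continuous_intros f
          continuous_on_compose2[OF C2_profile_continuous(1)[OF \<kappa>, of UNIV]]) auto
    show "continuous_on (UNIV \<times> cbox a b) (\<lambda>(r, y). radial_kernel1 \<kappa>1 r \<theta> y *\<^sub>R f y)"
      unfolding case_prod_beta
      by (intro continuous_intros fs radial_kernel_continuous[OF \<kappa>])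
  qed auto
  show "((\<lambda>r. f (polar r \<theta>)) has_vector_derivative
      integral (cbox a b) (\<lambda>y. radial_kernel1 \<kappa>1 r \<theta> y *\<^sub>R f y)) (at r)" if "polar r \<theta> \<in> P"
  proof (rule has_vector_derivative_transform_within_open[OF 1])
    show "open ((\<lambda>r. polar r \<theta>) -` P)"
      unfolding polar_def by (intro open_vimage P continuous_intros)
  qed (use that rep in auto)
  show "((\<lambda>r. integral (cbox a b) (\<lambda>y. radial_kernel1 \<kappa>1 r \<theta> y *\<^sub>R f y)) has_vector_derivative
      integral (cbox a b) (\<lambda>y. radial_kernel2 \<kappa>1 \<kappa>2 r \<theta> y *\<^sub>R f y)) (at r)"
  proof (rule leibniz_rule_vector_derivative[where U = UNIV])
    show "((\<lambda>r. radial_kernel1 \<kappa>1 r \<theta> y *\<^sub>R f y) has_vector_derivative radial_kernel2 \<kappa>1 \<kappa>2 r \<theta> y *\<^sub>R f y) (at r)" for r y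
      using has_vector_derivative_scaleR[OF radial_kernel_derivatives(2)[OF \<kappa>] has_vector_derivative_const] by simp
    show "(\<lambda>y. radial_kernel1 \<kappa>1 r \<theta> y *\<^sub>R f y) integrable_on cbox a b" for r
      by (intro integrable_continuous continuous_intros f radial_kernel_continuous[OF \<kappa>])
    show "continuous_on (UNIV \<times> cbox a b) (\<lambda>(r, y). radial_kernel2 \<kappa>1 \<kappa>2 r \<theta> y *\<^sub>R f y)"
      unfolding case_prod_beta
      by (intro continuous_intros fs radial_kernel_continuous[OF \<kappa>])
  qed auto
  have "continuous_on UNIV (\<lambda>p. integral (cbox a b) (\<lambda>y. radial_kernel1 \<kappa>1 (fst p) (snd p) y *\<^sub>R f y))"
    by (rule integral_continuous_on_param)
      (unfold case_prod_beta, intro continuous_intros fs radial_kernel_continuous[OF \<kappa>])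
  thus "continuous_on UNIV (\<lambda>(r, \<theta>). integral (cbox a b) (\<lambda>y. radial_kernel1 \<kappa>1 r \<theta> y *\<^sub>R f y))"
    by (simp add: case_prod_beta)
qed

lemma integrable_on_compact_continuous:
  fixes f :: "real^2 \<Rightarrow> real"
  assumes "compact K" "continuous_on K f" shows "f integrable_on K"
proof -
  have "set_integrable lborel K f"
    unfolding set_integrable_def by (rule borel_integrable_compact[OF assms])
  thus ?thesis by (rule set_borel_integral_eq_integral(1))
qed

definition two_wave_field :: "real \<Rightarrow> real \<Rightarrow> (real^2) set \<Rightarrow> (real^2 \<Rightarrow> complex^2) \<Rightarrow> bool" where
  "two_wave_field k k' S f \<longleftrightarrow> (\<forall>i. two_wave_on k k' S (\<lambda>x. f x $ i))"

lemma two_wave_field_continuous: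
  assumes "two_wave_field k k' S f" shows "continuous_on S f"
proof -
  have "continuous_on S (\<lambda>x. f x $ i)" for i
    using assms two_wave_on_continuous unfolding two_wave_field_def by blast
  hence "continuous_on S (\<lambda>x. \<chi> i. f x $ i)" by (rule continuous_on_vec_lambda)
  thus ?thesis by simp
qed

text \<open>The constant depends only on the wave numbers and on the distance \<open>d\<close> to the boundary of the domain. This
  makes the estimate uniform in the noise level, although the number of modes grows as the noise decreases. The
  reproducing formula is used on a square around the point, which lies in the disc of radius \<open>d\<close> and contains
  the supports of the kernels centred at all nearby points.\<close>

theorem two_wave_radial_estimate:
  assumes k: "0 < k" "k < k'" and d: "d > 0"
  shows "\<exists>C>0. \<forall>S f. two_wave_field k k' S f \<longrightarrow> (\<forall>r \<theta>. cball (polar r \<theta>) d \<subseteq> S \<longrightarrow>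
     (\<exists>\<sigma>>0. \<exists>g1 g2.
        (\<forall>s t. polar s t \<in> ball (polar r \<theta>) \<sigma> \<longrightarrow> ((\<lambda>s. f (polar s t)) has_vector_derivative g1 s t) (at s)) \<and>
        ((\<lambda>s. g1 s \<theta>) has_vector_derivative g2) (at r) \<and>
        continuous_on UNIV (\<lambda>(s, t). g1 s t) \<and>
        norm (f (polar r \<theta>)) \<le> C * integral (cball (polar r \<theta>) d) (\<lambda>y. norm (f y)) \<and>
        norm (g1 r \<theta>) \<le> C * integral (cball (polar r \<theta>) d) (\<lambda>y. norm (f y)) \<and>
        norm g2 \<le> C * integral (cball (polar r \<theta>) d) (\<lambda>y. norm (f y))))"
proof -
  obtain s1 s2 A B where s: "0 < s2" "s2 \<le> s1" "s1 \<le> d / 4" "k' * s1 \<le> 1"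
    and AB: "A * bump_moment s1 k + B * bump_moment s2 k = 1 / (2 * pi)"
      "A * bump_moment s1 k' + B * bump_moment s2 k' = 1 / (2 * pi)"
    using ex_two_bumps[OF k, of "d / 4"] d by auto
  define \<kappa> where "\<kappa> q = A * bump s1 q + B * bump s2 q" for q
  obtain \<kappa>1 \<kappa>2 where \<kappa>: "C2_profile \<kappa> \<kappa>1 \<kappa>2"
    using C2_profile_bumps[of A s1 B s2] unfolding \<kappa>_def by blast
  obtain C where C: "C > 0" "\<And>r \<theta> y. norm (y - polar r \<theta>) \<le> d \<Longrightarrow> \<bar>\<kappa> ((norm (y - polar r \<theta>))\<^sup>2)\<bar> \<le> C"
     "\<And>r \<theta> y. norm (y - polar r \<theta>) \<le> d \<Longrightarrow> \<bar>radial_kernel1 \<kappa>1 r \<theta> y\<bar> \<le> C"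
     "\<And>r \<theta> y. norm (y - polar r \<theta>) \<le> d \<Longrightarrow> \<bar>radial_kernel2 \<kappa>1 \<kappa>2 r \<theta> y\<bar> \<le> C"
    using radial_kernel_bounds[OF \<kappa>, of d] by blast
  show ?thesis
  proof (rule exI[of _ C], intro conjI allI impI)
    show "C > 0" by (rule C)
    fix S f r \<theta> assume f: "two_wave_field k k' S f" and sub: "cball (polar r \<theta>) d \<subseteq> S"
    define x0 where "x0 = polar r \<theta>"
    define h :: "real^2" where "h = (\<chi> i. d / 2)"
    define a where "a = x0 - h"
    define b where "b = x0 + h"
    have X1: "ball x0 (d / 2) \<subseteq> cbox a b"
    proof
      fix y assume y: "y \<in> ball x0 (d / 2)"
      have c: "\<bar>y $ i - x0 $ i\<bar> < d / 2" for i
        using component_le_norm_cart[of "y - x0" i] y by (simp add: dist_norm norm_minus_commute)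
      have "x0 $ i - d / 2 \<le> y $ i \<and> y $ i \<le> x0 $ i + d / 2" for i
        using c[of i] by linarith
      thus "y \<in> cbox a b"
        unfolding mem_box_cart a_def b_def h_def by (simp add: algebra_simps)
    qed
    have X2: "cbox a b \<subseteq> cball x0 d"
    proof
      fix y assume y: "y \<in> cbox a b"
      have "x0 $ i - d / 2 \<le> y $ i \<and> y $ i \<le> x0 $ i + d / 2" for i
        using y unfolding mem_box_cart a_def b_def h_def by simp
      hence "\<bar>(y - x0) $ i\<bar> \<le> d / 2" for i
        unfolding abs_le_iff vector_minus_component by (smt (verit))
      hence "(\<Sum>i\<in>UNIV. \<bar>(y - x0) $ i\<bar>) \<le> d / 2 + d / 2"
        unfolding sum_2 by (intro add_mono)
      thus "y \<in> cball x0 d"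
        using norm_le_l1_cart[of "y - x0"] by (simp add: dist_norm norm_minus_commute)
    qed
    have XS: "cbox a b \<subseteq> S" using X2 sub by (auto simp: x0_def)
    have fc: "continuous_on S f" by (rule two_wave_field_continuous[OF f])
    have fX: "continuous_on (cbox a b) f" by (rule continuous_on_subset[OF fc XS])
    define P where "P = ball x0 (d / 4)"
    have rep: "f x = integral (cbox a b) (\<lambda>y. \<kappa> ((norm (y - x))\<^sup>2) *\<^sub>R f y)" if x: "x \<in> P" for x
    proof -
      have sub1: "cball x s1 \<subseteq> cbox a b"
      proof
        fix y assume "y \<in> cball x s1"
        hence "dist x0 y < d / 2"
          using dist_triangle[of x0 y x] x s by (simp add: P_def)
        thus "y \<in> cbox a b" using X1 by auto
      qed
      have int: "(\<lambda>y. \<kappa> ((norm (y - x))\<^sup>2) *\<^sub>R f y) integrable_on cbox a b"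
        by (intro integrable_continuous continuous_intros fX
          continuous_on_compose2[OF C2_profile_continuous(1)[OF \<kappa>, of UNIV]]) auto
      have "f x $ i = integral (cbox a b) (\<lambda>y. \<kappa> ((norm (y - x))\<^sup>2) *\<^sub>R f y) $ i" for i
      proof -
        have "two_wave_on k k' S (\<lambda>y. f y $ i)" using f by (simp add: two_wave_field_def)
        from two_wave_reproducing[OF k s(1,2,4) AB this sub1 XS]
        have "((\<lambda>y. (\<kappa> ((norm (y - x))\<^sup>2) *\<^sub>R f y) $ i) has_integral f x $ i) (cbox a b)"
          by (simp add: \<kappa>_def)
        moreover have "((\<lambda>y. (\<kappa> ((norm (y - x))\<^sup>2) *\<^sub>R f y) $ i) has_integral
            integral (cbox a b) (\<lambda>y. \<kappa> ((norm (y - x))\<^sup>2) *\<^sub>R f y) $ i) (cbox a b)"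
          using has_integral_linear[OF integrable_integral[OF int] bounded_linear_vec_nth[of i]]
          by (simp add: o_def)
        ultimately show ?thesis by (rule has_integral_unique)
      qed
      thus ?thesis by (simp add: vec_eq_iff)
    qed
    have Po: "open P" by (simp add: P_def)
    have x0P: "polar r \<theta> \<in> P" using d by (simp add: P_def x0_def)
    note D = reproduced_radial_derivatives[OF \<kappa> fX Po rep]
    have bound: "norm (integral (cbox a b) (\<lambda>y. w y *\<^sub>R f y)) \<le> C * integral (cball (polar r \<theta>) d) (\<lambda>y. norm (f y))"
      if w: "continuous_on (cbox a b) w" "\<And>y. norm (y - polar r \<theta>) \<le> d \<Longrightarrow> \<bar>w y\<bar> \<le> C" for w
    proof -
      have nf: "(\<lambda>y. norm (f y)) integrable_on cbox a b"
        by (intro integrable_continuous continuous_intros fX)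
      have "norm (integral (cbox a b) (\<lambda>y. w y *\<^sub>R f y)) \<le> integral (cbox a b) (\<lambda>y. C * norm (f y))"
      proof (rule integral_norm_bound_integral)
        show "(\<lambda>y. w y *\<^sub>R f y) integrable_on cbox a b"
          by (intro integrable_continuous continuous_intros fX w)
        show "norm (w y *\<^sub>R f y) \<le> C * norm (f y)" if "y \<in> cbox a b" for y
          using that X2 w(2)[of y] by (auto simp: x0_def dist_norm norm_minus_commute subset_iff intro!: mult_right_mono)
      qed (intro integrable_on_mult_right nf)
      also have "\<dots> = C * integral (cbox a b) (\<lambda>y. norm (f y))" by simp
      also have "\<dots> \<le> C * integral (cball (polar r \<theta>) d) (\<lambda>y. norm (f y))"
      proof (intro mult_left_mono integral_subset_le nf)
        show "(\<lambda>y. norm (f y)) integrable_on cball (polar r \<theta>) d"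
          by (intro integrable_on_compact_continuous compact_cball continuous_intros continuous_on_subset[OF fc sub])
      qed (use X2 C(1) in \<open>auto simp: x0_def\<close>)
      finally show ?thesis .
    qed
    show "\<exists>\<sigma>>0. \<exists>g1 g2.
        (\<forall>s t. polar s t \<in> ball (polar r \<theta>) \<sigma> \<longrightarrow> ((\<lambda>s. f (polar s t)) has_vector_derivative g1 s t) (at s)) \<and>
        ((\<lambda>s. g1 s \<theta>) has_vector_derivative g2) (at r) \<and>
        continuous_on UNIV (\<lambda>(s, t). g1 s t) \<and>
        norm (f (polar r \<theta>)) \<le> C * integral (cball (polar r \<theta>) d) (\<lambda>y. norm (f y)) \<and>
        norm (g1 r \<theta>) \<le> C * integral (cball (polar r \<theta>) d) (\<lambda>y. norm (f y)) \<and>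
        norm g2 \<le> C * integral (cball (polar r \<theta>) d) (\<lambda>y. norm (f y))"
    proof (intro exI conjI allI impI)
      show "d / 4 > 0" using d by simp
      show "((\<lambda>s. f (polar s t)) has_vector_derivative
          integral (cbox a b) (\<lambda>y. radial_kernel1 \<kappa>1 s t y *\<^sub>R f y)) (at s)"
        if "polar s t \<in> ball (polar r \<theta>) (d / 4)" for s t
        by (rule D(1)) (use that in \<open>auto simp: P_def x0_def\<close>)
      show "((\<lambda>s. integral (cbox a b) (\<lambda>y. radial_kernel1 \<kappa>1 s \<theta> y *\<^sub>R f y)) has_vector_derivative
         integral (cbox a b) (\<lambda>y. radial_kernel2 \<kappa>1 \<kappa>2 r \<theta> y *\<^sub>R f y)) (at r)"
        by (rule D(2))
      show "continuous_on UNIV (\<lambda>(s, t). integral (cbox a b) (\<lambda>y. radial_kernel1 \<kappa>1 s t y *\<^sub>R f y))"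
        by (rule D(3))
      show "norm (f (polar r \<theta>)) \<le> C * integral (cball (polar r \<theta>) d) (\<lambda>y. norm (f y))"
        by (subst rep[OF x0P], rule bound)
          (auto intro!: C continuous_intros continuous_on_compose2[OF C2_profile_continuous(1)[OF \<kappa>, of UNIV]])
      show "norm (integral (cbox a b) (\<lambda>y. radial_kernel1 \<kappa>1 r \<theta> y *\<^sub>R f y)) \<le> C * integral (cball (polar r \<theta>) d) (\<lambda>y. norm (f y))"
        by (rule bound) (auto intro!: C continuous_intros radial_kernel_continuous[OF \<kappa>])
      show "norm (integral (cbox a b) (\<lambda>y. radial_kernel2 \<kappa>1 \<kappa>2 r \<theta> y *\<^sub>R f y)) \<le> C * integral (cball (polar r \<theta>) d) (\<lambda>y. norm (f y))"
        by (rule bound) (auto intro!: C continuous_intros radial_kernel_continuous[OF \<kappa>])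
    qed
  qed
qed

section \<open>Cylindrical waves\<close>

text \<open>With \<open>\<zeta> = i\<close> or \<open>\<zeta> = -i\<close> these are, up to a constant, the waves \<open>H\<^sub>n(k r) e\<^sup>i\<^sup>n\<^sup>\<theta>\<close> and
  \<open>H\<^sub>n(k r) e\<^sup>-\<^sup>i\<^sup>n\<^sup>\<theta>\<close> in polar coordinates around \<open>z\<close>. Writing the angular factor as a polynomial avoids
  branches of the angle.\<close>

definition cylinder_wave :: "real \<Rightarrow> nat \<Rightarrow> complex \<Rightarrow> real^2 \<Rightarrow> real^2 \<Rightarrow> complex" where
  "cylinder_wave k n \<zeta> z x = reduced_hankel n (k\<^sup>2 / 4 * ((x - z) \<bullet> (x - z)))
     * (of_real ((x - z)$1) + \<zeta> * of_real ((x - z)$2)) ^ n"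

lemma has_derivative_radial:
  fixes F :: "real \<Rightarrow> complex"
  assumes "(F has_vector_derivative F') (at (a * ((x - z) \<bullet> (x - z))))"
  shows "((\<lambda>x::real^2. F (a * ((x - z) \<bullet> (x - z)))) has_derivative
    (\<lambda>h. of_real (h$1) * (of_real (2 * a * (x - z)$1) * F') + of_real (h$2) * (of_real (2 * a * (x - z)$2) * F'))) (at x)"
proof -
  have "((\<lambda>x::real^2. a * ((x - z) \<bullet> (x - z))) has_derivative (\<lambda>h. a * ((x - z) \<bullet> h + h \<bullet> (x - z)))) (at x)"
    by (auto intro!: derivative_eq_intros)
  from has_derivative_compose[OF this assms[unfolded has_vector_derivative_def]]
  show ?thesis
    by (rule has_derivative_eq_rhs)
      (auto simp: fun_eq_iff inner_vec_def sum_2 scaleR_conv_of_real algebra_simps)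
qed

lemma has_derivative_linear_power:
  "((\<lambda>x::real^2. (of_real ((x - z)$1) + \<zeta> * of_real ((x - z)$2)) ^ m :: complex) has_derivative
    (\<lambda>h. of_real (h$1) * (of_nat m * (of_real ((x - z)$1) + \<zeta> * of_real ((x - z)$2)) ^ (m - 1))
      + of_real (h$2) * (of_nat m * (of_real ((x - z)$1) + \<zeta> * of_real ((x - z)$2)) ^ (m - 1) * \<zeta>))) (at x)"
proof -
  have nth: "((\<lambda>x::real^2. complex_of_real ((x - z)$i)) has_derivative (\<lambda>h. of_real (h$i))) (at x)" for i
    by (auto intro!: derivative_eq_intros bounded_linear_imp_has_derivative simp: bounded_linear_vec_nth)
  have "((\<lambda>x::real^2. of_real ((x - z)$1) + \<zeta> * of_real ((x - z)$2)) has_derivative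
      (\<lambda>h. of_real (h$1) + \<zeta> * of_real (h$2))) (at x)"
    by (intro has_derivative_add has_derivative_mult_right nth)
  from has_derivative_power[OF this, of m] show ?thesis
    by (rule has_derivative_eq_rhs) (auto simp: fun_eq_iff algebra_simps)
qed

text \<open>The power of \<open>L = x\<^sub>1 + \<zeta> x\<^sub>2\<close> is harmonic because \<open>\<zeta>\<^sup>2 = -1\<close>, and it is homogeneous of degree \<open>n\<close>. So
  the Laplacian of the product with a function \<open>h\<close> of \<open>q = k\<^sup>2 r\<^sup>2 / 4\<close> is
  \<open>k\<^sup>2 (q h'' + (n + 1) h') L\<^sup>n\<close>, which equals \<open>- k\<^sup>2 h L\<^sup>n\<close> by the reduced Bessel equation.\<close>

lemma cylinder_wave_helmholtz:
  assumes k: "k > 0" and \<zeta>: "\<zeta>\<^sup>2 = -1"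
  shows "helmholtz_on k (- {z}) (cylinder_wave k n \<zeta> z)"
proof -
  define h where "h = reduced_hankel n"
  obtain h1 h2' where h: "\<And>y. y > 0 \<Longrightarrow> (h has_vector_derivative h1 y) (at y)"
     "\<And>y. y > 0 \<Longrightarrow> (h1 has_vector_derivative h2' y) (at y)"
     "\<And>y. y > 0 \<Longrightarrow> y *\<^sub>R h2' y + real (n + 1) *\<^sub>R h1 y + h y = 0"
    using reduced_hankel_ode[of n] unfolding h_def by blast
  define h2 where "h2 y = - (of_nat (n + 1) * h1 y + h y) / of_real y" for y
  have h2: "h2' y = h2 y" if "y > 0" for y
  proof -
    have "of_real y * h2' y + (of_nat (n + 1) * h1 y + h y) = 0"
      using h(3)[OF that] by (simp add: scaleR_conv_of_real add.assoc)
    hence "of_real y * h2' y = - (of_nat (n + 1) * h1 y + h y)"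
      by (simp only: eq_neg_iff_add_eq_0)
    thus ?thesis using that by (simp add: h2_def field_simps)
  qed
  define a where "a = k\<^sup>2 / 4"
  have a: "a > 0" using k by (simp add: a_def)
  define q :: "real^2 \<Rightarrow> real" where "q x = a * ((x - z) \<bullet> (x - z))" for x
  have q: "q x > 0" if "x \<in> - {z}" for x
    unfolding q_def using a that by (simp add: zero_less_mult_iff)
  define L :: "real^2 \<Rightarrow> complex" where "L x = of_real ((x - z)$1) + \<zeta> * of_real ((x - z)$2)" for x
  define c where "c i = (if i = (1::2) then 1 else \<zeta>)" for i
  have c: "c 1 = 1" "c 2 = \<zeta>" by (simp_all add: c_def)
  define X :: "2 \<Rightarrow> real^2 \<Rightarrow> complex" where "X i x = of_real ((x - z)$i)" for i x
  define \<Delta> :: "2 \<Rightarrow> 2 \<Rightarrow> complex" where "\<Delta> i j = (if i = j then 1 else 0)" for i j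
  define g where "g i x = 2 * of_real a * X i x * h1 (q x) * L x ^ n
     + h (q x) * (of_nat n * L x ^ (n - 1)) * c i" for i x
  define G where "G i j x = 2 * of_real a * \<Delta> i j * h1 (q x) * L x ^ n
     + 4 * of_real a * of_real a * X i x * X j x * h2 (q x) * L x ^ n
     + 2 * of_real a * X i x * h1 (q x) * (of_nat n * L x ^ (n - 1)) * c j
     + 2 * of_real a * X j x * h1 (q x) * (of_nat n * L x ^ (n - 1)) * c i
     + h (q x) * (of_nat n * of_nat (n - 1) * L x ^ (n - 1 - 1)) * c i * c j" for i j x
  have dh: "((\<lambda>x. h (q x)) has_derivative
    (\<lambda>d. of_real (d$1) * (2 * of_real a * X 1 x * h1 (q x)) + of_real (d$2) * (2 * of_real a * X 2 x * h1 (q x)))) (at x)"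
    if "x \<in> - {z}" for x
    using has_derivative_radial[OF h(1)[OF q[OF that], unfolded q_def]] unfolding q_def X_def by simp
  have dh1: "((\<lambda>x. h1 (q x)) has_derivative
    (\<lambda>d. of_real (d$1) * (2 * of_real a * X 1 x * h2 (q x)) + of_real (d$2) * (2 * of_real a * X 2 x * h2 (q x)))) (at x)"
    if "x \<in> - {z}" for x
    using has_derivative_radial[OF h(2)[OF q[OF that], unfolded h2[OF q[OF that]], unfolded q_def]] unfolding q_def X_def by simp
  have dL: "((\<lambda>x. L x ^ m) has_derivative (\<lambda>d. of_real (d$1) * (of_nat m * L x ^ (m - 1))
      + of_real (d$2) * (of_nat m * L x ^ (m - 1) * \<zeta>))) (at x)" for m x
    unfolding L_def by (rule has_derivative_linear_power)
  have dX: "(X i has_derivative (\<lambda>d. of_real (d$1) * \<Delta> i 1 + of_real (d$2) * \<Delta> i 2)) (at x)" for i x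
  proof -
    have "(X i has_derivative (\<lambda>d. of_real (d$i))) (at x)"
      unfolding X_def by (auto intro!: derivative_eq_intros bounded_linear_imp_has_derivative simp: bounded_linear_vec_nth)
    moreover have "(\<lambda>d::real^2. complex_of_real (d$i)) = (\<lambda>d. of_real (d$1) * \<Delta> i 1 + of_real (d$2) * \<Delta> i 2)"
      using exhaust_2[of i] by (auto simp: \<Delta>_def)
    ultimately show ?thesis by simp
  qed
  have op: "open (- {z})" by auto
  have f: "cylinder_wave k n \<zeta> z = (\<lambda>x. h (q x) * L x ^ n)"
    by (simp add: fun_eq_iff cylinder_wave_def h_def q_def a_def L_def)
  have 1: "(cylinder_wave k n \<zeta> z has_derivative (\<lambda>d. d$1 *\<^sub>R g 1 x + d$2 *\<^sub>R g 2 x)) (at x)" if "x \<in> - {z}" for x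
    unfolding f
    by (rule has_derivative_eq_rhs[OF has_derivative_mult[OF dh[OF that] dL]])
      (simp add: fun_eq_iff g_def c scaleR_conv_of_real algebra_simps)
  have 2: "(g i has_derivative (\<lambda>d. d$1 *\<^sub>R G i 1 x + d$2 *\<^sub>R G i 2 x)) (at x)" if x: "x \<in> - {z}" for i x
    unfolding g_def[abs_def]
    by (rule has_derivative_eq_rhs, (rule has_derivative_add has_derivative_mult has_derivative_const dX dh[OF x] dh1[OF x] dL)+)
      (simp add: fun_eq_iff G_def c scaleR_conv_of_real algebra_simps)
  have cont: "continuous_on (- {z}) (\<lambda>x. h (q x))" "continuous_on (- {z}) (\<lambda>x. h1 (q x))"
    by (intro continuous_at_imp_continuous_on ballI has_derivative_continuous[OF dh] has_derivative_continuous[OF dh1]; assumption)+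
  have cq: "continuous_on (- {z}) q" unfolding q_def by (intro continuous_intros)
  have cL: "continuous_on (- {z}) L" "continuous_on (- {z}) (X i)" for i
    unfolding L_def X_def by (intro continuous_intros)+
  have ch2: "continuous_on (- {z}) (\<lambda>x. h2 (q x))"
    unfolding h2_def by (intro continuous_intros cont cq) (use q in force)
  have 3: "continuous_on (- {z}) (G i j)" for i j
    unfolding G_def[abs_def] by (intro continuous_intros cont ch2 cL)
  have C2: "C2_on (- {z}) (cylinder_wave k n \<zeta> z)" by (rule C2_onI(1)[OF op 1 2 3])
  have C3: "pderiv_at j (pderiv_at i (cylinder_wave k n \<zeta> z)) x = G i j x" if "x \<in> - {z}" for i j x
    by (rule C2_onI(3)[OF op 1 2 3]) (use that in auto)
  show ?thesis
    unfolding helmholtz_on_def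
  proof (intro conjI ballI)
    show "C2_on (- {z}) (cylinder_wave k n \<zeta> z)" by (rule C2)
    fix x assume x: "x \<in> - {z}"
    define A where "A = of_real a * h1 (q x)"
    have qX: "of_real (q x) = of_real a * (X 1 x * X 1 x + X 2 x * X 2 x)"
      by (simp add: q_def X_def inner_vec_def sum_2)
    have LX: "X 1 x + \<zeta> * X 2 x = L x" by (simp add: L_def X_def)
    have Ln: "of_nat n * L x ^ (n - 1) * L x = of_nat n * L x ^ n" by (cases n) (auto simp: mult_ac)
    have hq: "of_real (q x) * h2 (q x) = - (of_nat (n + 1) * h1 (q x) + h (q x))"
      using q[OF x] by (simp add: h2_def)
    have z1: "1 + \<zeta> * \<zeta> = 0" using \<zeta> by (simp add: power2_eq_square)
    have "G 1 1 x + G 2 2 x = 4 * of_real a * h1 (q x) * L x ^ n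
      + 4 * of_real a * (of_real a * (X 1 x * X 1 x + X 2 x * X 2 x)) * h2 (q x) * L x ^ n
      + 4 * of_real a * h1 (q x) * (of_nat n * L x ^ (n - 1) * (X 1 x + \<zeta> * X 2 x))
      + h (q x) * (of_nat n * of_nat (n - 1) * L x ^ (n - 1 - 1)) * (1 + \<zeta> * \<zeta>)"
      unfolding G_def c by (simp add: \<Delta>_def algebra_simps)
    also have "\<dots> = 4 * of_real a * h1 (q x) * L x ^ n
      + 4 * of_real a * (of_real (q x) * h2 (q x)) * L x ^ n
      + 4 * of_real a * h1 (q x) * (of_nat n * L x ^ n)"
      unfolding LX z1 qX[symmetric] Ln by (simp add: mult_ac)
    also have "\<dots> = - (4 * of_real a) * (h (q x) * L x ^ n)"
      unfolding hq by (simp add: algebra_simps)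
    also have "h (q x) * L x ^ n = cylinder_wave k n \<zeta> z x" by (simp add: f)
    finally have "laplacian (cylinder_wave k n \<zeta> z) x = - (4 * of_real a) * cylinder_wave k n \<zeta> z x"
      unfolding laplacian_def sum_2 C3[OF x] .
    thus "laplacian (cylinder_wave k n \<zeta> z) x + k\<^sup>2 *\<^sub>R cylinder_wave k n \<zeta> z x = 0"
      by (simp add: a_def scaleR_conv_of_real)
  qed
qed

lemma pderiv_at_cong_open:
  assumes "open S" "x \<in> S" "\<And>y. y \<in> S \<Longrightarrow> f y = g y" "f differentiable (at x)"
  shows "pderiv_at i g x = pderiv_at i f x"
proof -
  have f: "(f has_derivative (\<lambda>h. h$1 *\<^sub>R pderiv_at 1 f x + h$2 *\<^sub>R pderiv_at 2 f x)) (at x)"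
    by (rule has_derivative_partials[OF assms(4)])
  hence g: "(g has_derivative (\<lambda>h. h$1 *\<^sub>R pderiv_at 1 f x + h$2 *\<^sub>R pderiv_at 2 f x)) (at x)"
    by (rule has_derivative_transform_within_open[OF _ assms(1,2)]) (use assms(3) in auto)
  show "pderiv_at i g x = pderiv_at i f x"
    using pderiv_at_eqI[OF g] by simp
qed

lemma C2_on_partials:
  assumes "C2_on S f" "x \<in> S"
  shows "f differentiable (at x)" "pderiv_at i f differentiable (at x)"
  using assms by (auto simp: C2_on_def C1_on_def)

lemma helmholtz_on_lincomb:
  assumes S: "open S" and f: "helmholtz_on k S f" and g: "\<And>x. x \<in> S \<Longrightarrow> g x = c * f x"
  shows "helmholtz_on k S g"
proof -
  have C2: "C2_on S f" using f by (simp add: helmholtz_on_def)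
  have 1: "(g has_derivative (\<lambda>h. h$1 *\<^sub>R (c * pderiv_at 1 f x) + h$2 *\<^sub>R (c * pderiv_at 2 f x))) (at x)" if "x \<in> S" for x
  proof (rule has_derivative_transform_within_open[OF _ S that])
    show "((\<lambda>x. c * f x) has_derivative (\<lambda>h. h$1 *\<^sub>R (c * pderiv_at 1 f x) + h$2 *\<^sub>R (c * pderiv_at 2 f x))) (at x)"
      by (rule has_derivative_eq_rhs[OF has_derivative_mult_right[OF has_derivative_partials[OF C2_on_partials(1)[OF C2 that]]]])
        (simp add: fun_eq_iff algebra_simps)
  qed (use g in auto)
  have 2: "((\<lambda>x. c * pderiv_at i f x) has_derivative (\<lambda>h. h$1 *\<^sub>R (c * pderiv_at 1 (pderiv_at i f) x)
      + h$2 *\<^sub>R (c * pderiv_at 2 (pderiv_at i f) x))) (at x)" if "x \<in> S" for i x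
    by (rule has_derivative_eq_rhs[OF has_derivative_mult_right[OF has_derivative_partials[OF C2_on_partials(2)[OF C2 that]]]])
      (simp add: fun_eq_iff algebra_simps)
  have 3: "continuous_on S (\<lambda>x. c * pderiv_at j (pderiv_at i f) x)" for i j
    using C2 by (auto simp: C2_on_def C1_on_def intro!: continuous_intros)
  have C3: "pderiv_at j (pderiv_at i g) x = c * pderiv_at j (pderiv_at i f) x" if "x \<in> S" for i j x
    by (rule C2_onI(3)[OF S 1 2 3]) (use that in auto)
  show ?thesis
    unfolding helmholtz_on_def
  proof (intro conjI ballI)
    show "C2_on S g" by (rule C2_onI(1)[OF S 1 2 3])
    fix x assume x: "x \<in> S"
    have "laplacian g x = c * laplacian f x"
      unfolding laplacian_def sum_2 C3[OF x] by (simp add: algebra_simps)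
    moreover have "laplacian f x = - (k\<^sup>2 *\<^sub>R f x)"
      using f x by (simp add: helmholtz_on_def eq_neg_iff_add_eq_0)
    ultimately show "laplacian g x + k\<^sup>2 *\<^sub>R g x = 0" by (simp add: g[OF x])
  qed
qed

lemma helmholtz_circle_mean_partials:
  assumes f: "helmholtz_on k S f" and S: "open S" and k: "k \<ge> 0"
  shows "circle_mean_on k S f" "circle_mean_on k S (pderiv_at i f)"
    "circle_mean_on k S (pderiv_at j (pderiv_at i f))"
proof -
  have C: "C1_on S f" "C1_on S (pderiv_at i f)"
    using f by (auto simp: helmholtz_on_def C2_on_def)
  show 1: "circle_mean_on k S f" by (rule helmholtz_circle_mean[OF f k])
  show 2: "circle_mean_on k S (pderiv_at i f)" by (rule circle_mean_pderiv[OF 1 C(1) S])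
  show "circle_mean_on k S (pderiv_at j (pderiv_at i f))" by (rule circle_mean_pderiv[OF 2 C(2) S])
qed

lemma polar_eq_0 [simp]: "polar r \<theta> = 0 \<longleftrightarrow> r = 0"
  using norm_polar[of r \<theta>] by (metis abs_eq_0 norm_eq_zero)

section \<open>The modes, the incident field and the scattered field\<close>

text \<open>The wave \<open>H\<^sub>n(k r) e\<^sup>i\<^sup>n\<^sup>\<theta>\<close> in Cartesian form. For negative \<open>n\<close> the sign comes from the reflection
  formula and \<open>\<zeta> = -i\<close> turns the power \<open>|n|\<close> into the angular factor of order \<open>n\<close>.\<close>

definition hankel_mode :: "real \<Rightarrow> int \<Rightarrow> real^2 \<Rightarrow> complex" where
  "hankel_mode k n x = (if n < 0 then (-1) ^ nat (- n) else 1) * of_real ((k / 2) ^ nat \<bar>n\<bar>)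
     * cylinder_wave k (nat \<bar>n\<bar>) (if n < 0 then - \<i> else \<i>) 0 x"

lemma hankel_mode_helmholtz: "k > 0 \<Longrightarrow> helmholtz_on k (- {0}) (hankel_mode k n)"
  by (rule helmholtz_on_lincomb[OF _ cylinder_wave_helmholtz[of k "if n < 0 then - \<i> else \<i>"]])
    (auto simp: hankel_mode_def)

lemma hankel_mode_polar:
  assumes "k > 0" "r > 0"
  shows "hankel_mode k n (polar r \<theta>) = hankel1 n (k * r) * cis (of_int n * \<theta>)"
proof -
  define m where "m = nat \<bar>n\<bar>"
  define \<sigma> :: real where "\<sigma> = (if n < 0 then - 1 else 1)"
  have "of_real (polar r \<theta> $ 1) + (if n < 0 then - \<i> else \<i>) * of_real (polar r \<theta> $ 2) = of_real r * cis (\<sigma> * \<theta>)"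
    by (simp add: \<sigma>_def complex_eq_iff)
  hence "(of_real (polar r \<theta> $ 1) + (if n < 0 then - \<i> else \<i>) * of_real (polar r \<theta> $ 2)) ^ m
     = of_real (r ^ m) * cis (real m * (\<sigma> * \<theta>))"
    by (simp only: power_mult_distrib Complex.DeMoivre of_real_power)
  also have "real m * (\<sigma> * \<theta>) = of_int n * \<theta>" by (simp add: m_def \<sigma>_def)
  finally have p: "(of_real (polar r \<theta> $ 1) + (if n < 0 then - \<i> else \<i>) * of_real (polar r \<theta> $ 2)) ^ m
     = of_real (r ^ m) * cis (of_int n * \<theta>)" .
  have q: "k\<^sup>2 / 4 * (polar r \<theta> \<bullet> polar r \<theta>) = (k * r / 2)\<^sup>2"
    by (simp add: dot_square_norm power_mult_distrib power_divide)
  show ?thesis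
    unfolding hankel_mode_def cylinder_wave_def m_def[symmetric] diff_zero p q
    using assms by (simp add: hankel1_eq_reduced m_def power_mult_distrib power_divide)
qed

lemma hankel1_has_derivative:
  assumes "x > 0"
  shows "(hankel1 n has_vector_derivative hankel1_deriv n x) (at x)"
proof -
  have C: "C2_on (- {0}) (hankel_mode 1 n)"
    using hankel_mode_helmholtz[of 1 n] by (simp add: helmholtz_on_def)
  have p: "((\<lambda>r. polar r 0) has_vector_derivative e_r 0) (at x)"
    unfolding polar_def by (auto intro!: derivative_eq_intros)
  have "polar x 0 \<in> - {0}" using assms by simp
  from pderiv_at_chain[OF C2_on_partials(1)[OF C this] p]
  obtain D where D: "((\<lambda>r. hankel_mode 1 n (polar r 0)) has_vector_derivative D) (at x)" by blast
  have "(hankel1 n has_vector_derivative D) (at x)"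
    by (rule has_vector_derivative_transform_within_open[OF D, of "{0<..}"])
      (use assms in \<open>auto simp: hankel_mode_polar\<close>)
  thus ?thesis unfolding hankel1_deriv_def by (simp add: vector_derivative_at)
qed

text \<open>The radial and the angular derivative of the mode are explicit, and rotating them by \<open>\<theta>\<close> gives the
  Cartesian partial derivatives.\<close>

lemma hankel_mode_gradient:
  fixes n :: int and \<theta> :: real
  assumes k: "k > 0" and r: "r > 0"
  defines "a \<equiv> of_real k * hankel1_deriv n (k * r) * cis (of_int n * \<theta>)"
    and "b \<equiv> \<i> * of_int n / of_real r * hankel1 n (k * r) * cis (of_int n * \<theta>)"
  shows "pderiv_at 1 (hankel_mode k n) (polar r \<theta>) = of_real (cos \<theta>) * a - of_real (sin \<theta>) * b"
    "pderiv_at 2 (hankel_mode k n) (polar r \<theta>) = of_real (sin \<theta>) * a + of_real (cos \<theta>) * b"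
proof -
  let ?f = "hankel_mode k n"
  define f1 where "f1 = pderiv_at 1 ?f (polar r \<theta>)"
  define f2 where "f2 = pderiv_at 2 ?f (polar r \<theta>)"
  have "polar r \<theta> \<in> - {0}" using r by simp
  hence df: "?f differentiable (at (polar r \<theta>))"
    using hankel_mode_helmholtz[OF k, of n] C2_on_partials(1) unfolding helmholtz_on_def by blast
  have pr: "((\<lambda>r. polar r \<theta>) has_vector_derivative e_r \<theta>) (at r)"
    unfolding polar_def by (auto intro!: derivative_eq_intros)
  have pt: "((\<lambda>\<theta>. polar r \<theta>) has_vector_derivative r *\<^sub>R e_theta \<theta>) (at \<theta>)"
    unfolding polar_def by (auto intro!: derivative_eq_intros e_r_derivative)
  have 1: "((\<lambda>r. ?f (polar r \<theta>)) has_vector_derivative (cos \<theta> *\<^sub>R f1 + sin \<theta> *\<^sub>R f2)) (at r)"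
    using pderiv_at_chain[OF df pr] by (simp add: f1_def f2_def)
  have 2: "((\<lambda>\<theta>. ?f (polar r \<theta>)) has_vector_derivative ((- (r * sin \<theta>)) *\<^sub>R f1 + (r * cos \<theta>) *\<^sub>R f2)) (at \<theta>)"
    using pderiv_at_chain[OF df pt] by (simp add: f1_def f2_def)
  have kr: "k * r > 0" using k r by simp
  have lin: "((\<lambda>r. k * r) has_vector_derivative k) (at r)"
    by (auto intro!: derivative_eq_intros)
  have "((\<lambda>r. hankel1 n (k * r)) has_vector_derivative k *\<^sub>R hankel1_deriv n (k * r)) (at r)"
    using vector_diff_chain_at[OF lin hankel1_has_derivative[OF kr]] by (simp add: o_def)
  hence "((\<lambda>r. hankel1 n (k * r) * cis (of_int n * \<theta>)) has_vector_derivative a) (at r)"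
    unfolding a_def scaleR_conv_of_real by (rule has_vector_derivative_mult_left)
  hence "((\<lambda>r. ?f (polar r \<theta>)) has_vector_derivative a) (at r)"
    by (rule has_vector_derivative_transform_within_open[of _ _ _ "{0<..}"])
      (use k r in \<open>auto simp: hankel_mode_polar\<close>)
  from vector_derivative_unique_at[OF this 1] have a: "a = of_real (cos \<theta>) * f1 + of_real (sin \<theta>) * f2"
    by (simp add: scaleR_conv_of_real)
  have "((\<lambda>\<theta>. cis (of_int n * \<theta>)) has_vector_derivative \<i> * of_int n * cis (of_int n * \<theta>)) (at \<theta>)"
    unfolding has_vector_derivative_complex_iff
    by (auto intro!: derivative_eq_intros)
  from has_vector_derivative_mult_right[OF this, of "hankel1 n (k * r)"]
  have "((\<lambda>\<theta>. ?f (polar r \<theta>)) has_vector_derivative of_real r * b) (at \<theta>)"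
    using r by (simp add: hankel_mode_polar[OF k r] b_def mult_ac)
  from vector_derivative_unique_at[OF this 2]
  have "of_real r * b = of_real r * (- of_real (sin \<theta>) * f1 + of_real (cos \<theta>) * f2)"
    by (simp add: scaleR_conv_of_real algebra_simps)
  hence b: "b = - of_real (sin \<theta>) * f1 + of_real (cos \<theta>) * f2" using r by simp
  have cs: "complex_of_real (cos \<theta>) * of_real (cos \<theta>) + of_real (sin \<theta>) * of_real (sin \<theta>) = 1"
    by (simp flip: of_real_mult of_real_add)
  have "of_real (cos \<theta>) * a - of_real (sin \<theta>) * b = (of_real (cos \<theta>) * of_real (cos \<theta>) + of_real (sin \<theta>) * of_real (sin \<theta>)) * f1"
    unfolding a b by (simp add: algebra_simps)
  thus "pderiv_at 1 ?f (polar r \<theta>) = of_real (cos \<theta>) * a - of_real (sin \<theta>) * b"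
    unfolding cs f1_def by simp
  have "of_real (sin \<theta>) * a + of_real (cos \<theta>) * b = (of_real (cos \<theta>) * of_real (cos \<theta>) + of_real (sin \<theta>) * of_real (sin \<theta>)) * f2"
    unfolding a b by (simp add: algebra_simps)
  thus "pderiv_at 2 ?f (polar r \<theta>) = of_real (sin \<theta>) * a + of_real (cos \<theta>) * b"
    unfolding cs f2_def by simp
qed

lemma circle_mean_on_sum:
  assumes "\<And>n. n \<in> A \<Longrightarrow> circle_mean_on k S (f n)"
  shows "circle_mean_on k S (\<lambda>x. \<Sum>n\<in>A. f n x)"
  using assms
proof (induction A rule: infinite_finite_induct)
  case (insert n A)
  thus ?case using circle_mean_on_add[of k S "f n" "\<lambda>x. \<Sum>n\<in>A. f n x"] by simp
qed (simp_all add: circle_mean_on_def)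

lemma two_wave_fieldI:
  assumes "\<And>i. circle_mean_on k S (\<lambda>x. g x $ i)" "\<And>i. circle_mean_on k' S (\<lambda>x. g' x $ i)"
    "\<And>x. x \<in> S \<Longrightarrow> f x = g x + g' x"
  shows "two_wave_field k k' S f"
  unfolding two_wave_field_def two_wave_on_def using assms by fastforce

lemma two_wave_field_add_diff:
  assumes "two_wave_field k k' S f" "two_wave_field k k' S g"
  shows "two_wave_field k k' S (\<lambda>x. f x + g x)" "two_wave_field k k' S (\<lambda>x. f x - g x)"
proof -
  have *: "two_wave_on k k' S (\<lambda>x. a x + c * b x)"
    if wa: "two_wave_on k k' S a" and wb: "two_wave_on k k' S b" for a b :: "real^2 \<Rightarrow> complex" and c
  proof -
    obtain a1 a2 where a: "circle_mean_on k S a1" "circle_mean_on k' S a2" "\<forall>x\<in>S. a x = a1 x + a2 x"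
      using wa unfolding two_wave_on_def by blast
    obtain b1 b2 where b: "circle_mean_on k S b1" "circle_mean_on k' S b2" "\<forall>x\<in>S. b x = b1 x + b2 x"
      using wb unfolding two_wave_on_def by blast
    note ab = a b
    have "circle_mean_on k S (\<lambda>x. a1 x + c * b1 x)" "circle_mean_on k' S (\<lambda>x. a2 x + c * b2 x)"
      by (intro circle_mean_on_add circle_mean_on_cmult ab)+
    moreover have "\<forall>x\<in>S. a x + c * b x = (a1 x + c * b1 x) + (a2 x + c * b2 x)"
      using ab by (simp add: algebra_simps)
    ultimately show ?thesis unfolding two_wave_on_def by blast
  qed
  show "two_wave_field k k' S (\<lambda>x. f x + g x)" "two_wave_field k k' S (\<lambda>x. f x - g x)"
    using assms *[of "\<lambda>x. f x $ i" "\<lambda>x. g x $ i" 1 for i] *[of "\<lambda>x. f x $ i" "\<lambda>x. g x $ i" "- 1" for i]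
    unfolding two_wave_field_def by simp_all
qed

lemma two_wave_field_subset: "two_wave_field k k' S f \<Longrightarrow> T \<subseteq> S \<Longrightarrow> two_wave_field k k' T f"
  unfolding two_wave_field_def two_wave_on_def by (meson circle_mean_on_subset subsetD)

lemma grad_plus_curl_two_wave:
  assumes "helmholtz_on k S f" "helmholtz_on k' S g" "open S" "k \<ge> 0" "k' \<ge> 0"
    and u: "\<And>x. x \<in> S \<Longrightarrow> u x = grad f x + curl g x"
  shows "two_wave_field k k' S u"
proof (rule two_wave_fieldI[where g = "grad f" and g' = "curl g"])
  show "circle_mean_on k S (\<lambda>x. grad f x $ i)" for i
    using helmholtz_circle_mean_partials(2)[OF assms(1,3,4), of i] by (simp add: grad_def)
  show "circle_mean_on k' S (\<lambda>x. curl g x $ i)" for i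
    using helmholtz_circle_mean_partials(2)[OF assms(2,3,5), of 2]
      circle_mean_on_cmult[OF helmholtz_circle_mean_partials(2)[OF assms(2,3,5), of 1], of "- 1"]
      exhaust_2[of i] by (auto simp: curl_def)
qed (rule u)

text \<open>The truncated expansion, not as a function of the polar coordinates but as the gradient and the curl of
  its two potentials, which shows its Helmholtz parts.\<close>

definition mode_field :: "real \<Rightarrow> real \<Rightarrow> real \<Rightarrow> int \<Rightarrow> (int \<Rightarrow> complex^2) \<Rightarrow> real^2 \<Rightarrow> complex^2" where
  "mode_field kp ks R N c x = (\<Sum>n = -N..N. (c n $ 1 / hankel1 n (kp * R)) *s grad (hankel_mode kp n) x)
     + (\<Sum>n = -N..N. (c n $ 2 / hankel1 n (ks * R)) *s curl (hankel_mode ks n) x)"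

lemma mode_sum_eq_mode_field:
  assumes k: "kp > 0" "ks > 0" and r: "r > 0"
  shows "mode_sum kp ks R N c r \<theta> = mode_field kp ks R N c (polar r \<theta>)"
  unfolding mode_sum_def mode_field_def sum.distrib[symmetric]
proof (rule sum.cong[OF refl])
  fix n
  define A B where "A = c n $ 1 / hankel1 n (kp * R)" and "B = c n $ 2 / hankel1 n (ks * R)"
  define a where "a k = of_real k * hankel1_deriv n (k * r)" for k
  define b where "b k = \<i> * of_int n / of_real r * hankel1 n (k * r)" for k
  define e where "e = cis (of_int n * \<theta>)"
  define C S where "C = complex_of_real (cos \<theta>)" and "S = complex_of_real (sin \<theta>)"
  have "alpha kp R n r * c n $ 1 + \<i> * of_int n / of_real r * beta ks R n r * c n $ 2 = A * a kp + B * b ks"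
    "\<i> * of_int n / of_real r * beta kp R n r * c n $ 1 - alpha ks R n r * c n $ 2 = A * b kp - B * a ks"
    by (simp_all add: alpha_def beta_def A_def B_def a_def b_def mult_ac)
  hence "(alpha kp R n r * c n $ 1 + \<i> * of_int n / of_real r * beta ks R n r * c n $ 2) *s U_mode n \<theta>
     + (\<i> * of_int n / of_real r * beta kp R n r * c n $ 1 - alpha ks R n r * c n $ 2) *s V_mode n \<theta>
    = (A * a kp + B * b ks) *s U_mode n \<theta> + (A * b kp - B * a ks) *s V_mode n \<theta>" by simp
  also have "\<dots> = A *s vector [C * (a kp * e) - S * (b kp * e), S * (a kp * e) + C * (b kp * e)]
    + B *s vector [S * (a ks * e) + C * (b ks * e), - (C * (a ks * e) - S * (b ks * e))]"
    by (simp add: vec_eq_iff forall_2 U_mode_def V_mode_def cvec_def C_def S_def e_def algebra_simps)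
  also have "vector [C * (a kp * e) - S * (b kp * e), S * (a kp * e) + C * (b kp * e)]
     = grad (hankel_mode kp n) (polar r \<theta>)"
    by (simp add: vec_eq_iff forall_2 grad_def hankel_mode_gradient[OF k(1) r] a_def b_def e_def C_def S_def)
  also have "vector [S * (a ks * e) + C * (b ks * e), - (C * (a ks * e) - S * (b ks * e))]
     = curl (hankel_mode ks n) (polar r \<theta>)"
    by (simp add: vec_eq_iff forall_2 curl_def hankel_mode_gradient[OF k(2) r] a_def b_def e_def C_def S_def)
  finally show "(alpha kp R n r * c n $ 1 + \<i> * of_int n / of_real r * beta ks R n r * c n $ 2) *s U_mode n \<theta>
     + (\<i> * of_int n / of_real r * beta kp R n r * c n $ 1 - alpha ks R n r * c n $ 2) *s V_mode n \<theta>
    = (c n $ 1 / hankel1 n (kp * R)) *s grad (hankel_mode kp n) (polar r \<theta>)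
     + (c n $ 2 / hankel1 n (ks * R)) *s curl (hankel_mode ks n) (polar r \<theta>)"
    by (simp add: A_def B_def)
qed

lemma mode_field_two_wave:
  assumes k: "kp > 0" "ks > 0"
  shows "two_wave_field kp ks (- {0}) (mode_field kp ks R N c)"
proof (rule two_wave_fieldI[OF _ _ mode_field_def])
  have op: "open (- {0 :: real^2})" by auto
  show "circle_mean_on kp (- {0}) (\<lambda>x. (\<Sum>n = -N..N. (c n $ 1 / hankel1 n (kp * R)) *s grad (hankel_mode kp n) x) $ i)" for i
    unfolding sum_component vector_smult_component grad_def vec_lambda_beta
    using k by (intro circle_mean_on_sum circle_mean_on_cmult helmholtz_circle_mean_partials(2) hankel_mode_helmholtz op) auto
  have "circle_mean_on ks (- {0}) (\<lambda>x. curl (hankel_mode ks n) x $ i)" for n i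
    using helmholtz_circle_mean_partials(2)[OF hankel_mode_helmholtz[OF k(2), of n] op, of 2]
      circle_mean_on_cmult[OF helmholtz_circle_mean_partials(2)[OF hankel_mode_helmholtz[OF k(2), of n] op, of 1], of "- 1"]
      exhaust_2[of i] k by (auto simp: curl_def)
  thus "circle_mean_on ks (- {0}) (\<lambda>x. (\<Sum>n = -N..N. (c n $ 2 / hankel1 n (ks * R)) *s curl (hankel_mode ks n) x) $ i)" for i
    unfolding sum_component vector_smult_component
    by (intro circle_mean_on_sum circle_mean_on_cmult)
qed

lemma fund_sol_helmholtz:
  assumes k: "k > 0" shows "helmholtz_on k (- {z}) (\<lambda>x. fund_sol k x z)"
proof (rule helmholtz_on_lincomb[OF _ cylinder_wave_helmholtz[OF k, of \<i> z 0], where c = "\<i> / 4"])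
  fix x :: "real^2" assume "x \<in> - {z}"
  hence "k * norm (x - z) > 0" using k by simp
  moreover have "k\<^sup>2 / 4 * ((x - z) \<bullet> (x - z)) = (k * norm (x - z) / 2)\<^sup>2"
    by (simp add: dot_square_norm power_mult_distrib power_divide)
  ultimately show "fund_sol k x z = \<i> / 4 * cylinder_wave k 0 \<i> z x"
    by (simp add: fund_sol_def cylinder_wave_def hankel1_eq_reduced)
qed (auto simp: power2_eq_square)

lemma pderiv_at_diff:
  fixes f g :: "real^2 \<Rightarrow> complex"
  assumes "f differentiable (at x)" "g differentiable (at x)"
  shows "pderiv_at i (\<lambda>x. f x - g x) x = pderiv_at i f x - pderiv_at i g x"
  by (rule pderiv_at_eqI, rule has_derivative_eq_rhs[OF has_derivative_diff[OF
      has_derivative_partials[OF assms(1)] has_derivative_partials[OF assms(2)]]])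
    (simp add: fun_eq_iff algebra_simps)

text \<open>The fundamental solutions are modes of order zero around the source point. The tensor consists of
  second derivatives of the fundamental solutions and a multiple of the shear one, so it splits into two
  Helmholtz parts away from the source.\<close>

lemma incident_field_two_wave:
  assumes k: "kp > 0" "ks > 0"
  shows "two_wave_field kp ks (- {z}) (incident_field \<mu> \<omega> kp ks z pol)"
proof -
  define Es where "Es x = fund_sol ks x z" for x
  define Ep where "Ep x = fund_sol kp x z" for x
  have op: "open (- {z})" by auto
  have Es: "helmholtz_on ks (- {z}) Es" and Ep: "helmholtz_on kp (- {z}) Ep"
    unfolding Es_def Ep_def by (rule fund_sol_helmholtz; fact k)+
  have C2: "C2_on (- {z}) Es" "C2_on (- {z}) Ep" using Es Ep by (auto simp: helmholtz_on_def)
  have k0: "0 \<le> kp" "0 \<le> ks" using k by auto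
  define w where "w = complex_of_real (1 / \<omega>\<^sup>2)"
  define m where "m = complex_of_real (1 / \<mu>)"
  define gs :: "real^2 \<Rightarrow> complex^2" where "gs x = (\<chi> i. \<Sum>j\<in>UNIV. cvec pol $ j *
      ((if i = j then m else 0) * Es x + w * pderiv_at i (pderiv_at j Es) x))" for x
  define gp :: "real^2 \<Rightarrow> complex^2" where "gp x = (\<chi> i. \<Sum>j\<in>UNIV. cvec pol $ j *
      (- w * pderiv_at i (pderiv_at j Ep) x))" for x
  show ?thesis
  proof (rule two_wave_fieldI[where g = gp and g' = gs])
    show "circle_mean_on kp (- {z}) (\<lambda>x. gp x $ i)" for i
      unfolding gp_def vec_lambda_beta
      by (intro circle_mean_on_sum circle_mean_on_cmult helmholtz_circle_mean_partials(3)[OF Ep op k0(1)])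
    show "circle_mean_on ks (- {z}) (\<lambda>x. gs x $ i)" for i
      unfolding gs_def vec_lambda_beta
      by (intro circle_mean_on_sum circle_mean_on_cmult circle_mean_on_add
          helmholtz_circle_mean_partials(3)[OF Es op k0(2)] helmholtz_circle_mean_partials(1)[OF Es op k0(2)])
    fix x assume x: "x \<in> - {z}"
    have E: "pderiv_at i (pderiv_at j (\<lambda>x. Es x - Ep x)) x = pderiv_at i (pderiv_at j Es) x - pderiv_at i (pderiv_at j Ep) x" for i j
    proof -
      have "pderiv_at i (pderiv_at j (\<lambda>x. Es x - Ep x)) x = pderiv_at i (\<lambda>x. pderiv_at j Es x - pderiv_at j Ep x) x"
        by (rule pderiv_at_cong_open[OF op x])
          (use x in \<open>auto simp: pderiv_at_diff C2_on_partials[OF C2(1)] C2_on_partials[OF C2(2)] intro!: differentiable_diff\<close>)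
      thus ?thesis using x by (simp add: pderiv_at_diff C2_on_partials[OF C2(1)] C2_on_partials[OF C2(2)])
    qed
    show "incident_field \<mu> \<omega> kp ks z pol x = gp x + gs x"
      unfolding incident_field_def green_tensor_def matrix_vector_mult_def Es_def[symmetric] Ep_def[symmetric]
        w_def[symmetric] m_def[symmetric] E
      by (simp add: vec_eq_iff forall_2 sum_2 gp_def gs_def algebra_simps)
  qed
qed

section \<open>The scalar Newton map\<close>

lemma Re_vquot: "Re (vquot a b) = (a \<bullet> b) / (norm b)\<^sup>2"
proof -
  have "Re (cdot a b) = a \<bullet> b"
    by (simp add: cdot_def inner_vec_def inner_complex_def)
  thus ?thesis by (simp add: vquot_def)
qed

text \<open>The derivative of the Newton map is a quotient in which the terms \<open>g' \<bullet> g'\<close> cancel, so every remaining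
  term contains the factor \<open>g\<close>. On the interval \<open>|g|\<close> is at most \<open>e + B \<eta>\<close>, and the assumption on
  \<open>e\<close> and \<open>\<eta>\<close> makes the quotient at most one half.\<close>

lemma newton_map_contraction:
  fixes g g' g'' :: "real \<Rightarrow> 'a::real_inner"
  assumes g: "\<And>r. \<bar>r - p\<bar> \<le> \<eta> \<Longrightarrow> (g has_vector_derivative g' r) (at r)"
    and g': "\<And>r. \<bar>r - p\<bar> \<le> \<eta> \<Longrightarrow> (g' has_vector_derivative g'' r) (at r)"
    and B: "\<And>r. \<bar>r - p\<bar> \<le> \<eta> \<Longrightarrow> norm (g' r) \<le> B" "\<And>r. \<bar>r - p\<bar> \<le> \<eta> \<Longrightarrow> norm (g'' r) \<le> B"
    and m: "m > 0" "\<And>r. \<bar>r - p\<bar> \<le> \<eta> \<Longrightarrow> m \<le> norm (g' r)"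
    and e: "norm (g p) \<le> e" "6 * B * (e + B * \<eta>) \<le> m\<^sup>2" and \<eta>: "\<eta> > 0"
    and r: "\<bar>r - p\<bar> \<le> \<eta>" and s: "\<bar>s - p\<bar> \<le> \<eta>"
  defines "T \<equiv> \<lambda>r. r - (g r \<bullet> g' r) / (norm (g' r))\<^sup>2"
  shows "\<bar>T r - T s\<bar> \<le> \<bar>r - s\<bar> / 2" "\<bar>T p - p\<bar> \<le> e / m"
proof -
  define I where "I = {p - \<eta>..p + \<eta>}"
  have I: "t \<in> I \<longleftrightarrow> \<bar>t - p\<bar> \<le> \<eta>" for t by (auto simp: I_def abs_le_iff)
  have pI: "p \<in> I" using \<eta> by (simp add: I)
  have B0: "B \<ge> 0" using B(1)[of p] \<eta> by (smt (verit) norm_ge_zero)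
  have gb: "norm (g t) \<le> e + B * \<eta>" if t: "t \<in> I" for t
  proof -
    have "norm (g t - g p) \<le> B * norm (t - p)"
    proof (rule differentiable_bound[where S = I and f' = "\<lambda>x h. h *\<^sub>R g' x"])
      show "(g has_derivative (\<lambda>h. h *\<^sub>R g' x)) (at x within I)" if "x \<in> I" for x
        using g[of x] that by (auto simp: I has_vector_derivative_def intro: has_derivative_at_withinI)
      show "onorm (\<lambda>h. h *\<^sub>R g' x) \<le> B" if "x \<in> I" for x
        using B(1)[of x] that by (simp add: I onorm_scaleR_left_lemma onorm_scaleR_left[OF bounded_linear_ident] onorm_id)
    qed (use t pI in \<open>auto simp: I_def\<close>)
    also have "\<dots> \<le> B * \<eta>" using t B0 by (intro mult_left_mono) (auto simp: I)
    finally show ?thesis using e(1) norm_triangle_sub[of "g t" "g p"] by linarith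
  qed
  define T' where "T' t = 1 - (((g t \<bullet> g'' t + g' t \<bullet> g' t) * (g' t \<bullet> g' t) - (g t \<bullet> g' t) * (2 * (g' t \<bullet> g'' t)))
      / ((g' t \<bullet> g' t) * (g' t \<bullet> g' t)))" for t
  have T': "(T has_real_derivative T' t) (at t within I)" if t: "t \<in> I" for t
  proof -
    have t': "\<bar>t - p\<bar> \<le> \<eta>" using t by (simp add: I)
    have 1: "((\<lambda>t. g t \<bullet> g' t) has_real_derivative (g t \<bullet> g'' t + g' t \<bullet> g' t)) (at t within I)"
      using bounded_bilinear.has_vector_derivative[OF bounded_bilinear_inner
          has_vector_derivative_at_within[OF g[OF t']] has_vector_derivative_at_within[OF g'[OF t']]]
      by (simp add: has_real_derivative_iff_has_vector_derivative)
    have 2: "((\<lambda>t. g' t \<bullet> g' t) has_real_derivative (2 * (g' t \<bullet> g'' t))) (at t within I)"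
      using bounded_bilinear.has_vector_derivative[OF bounded_bilinear_inner
          has_vector_derivative_at_within[OF g'[OF t']] has_vector_derivative_at_within[OF g'[OF t']]]
      by (simp add: has_real_derivative_iff_has_vector_derivative inner_commute)
    have nz: "g' t \<bullet> g' t \<noteq> 0" using m(1) m(2)[OF t'] by auto
    show ?thesis
      unfolding T_def T'_def power2_norm_eq_inner
      by (rule DERIV_diff[OF DERIV_ident DERIV_divide[OF 1 2 nz]])
  qed
  have T'b: "norm (T' t) \<le> 1 / 2" if t: "t \<in> I" for t
  proof -
    have t': "\<bar>t - p\<bar> \<le> \<eta>" using t by (simp add: I)
    define n where "n = norm (g' t)"
    have n: "n \<ge> m" "n > 0" "n \<noteq> 0" using m(1) m(2)[OF t'] by (auto simp: n_def)
    define x where "x = norm (g t)"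
    have x0: "x \<ge> 0" by (simp add: x_def)
    have nn: "g' t \<bullet> g' t = n * n" by (simp add: n_def dot_square_norm power2_eq_square)
    have "T' t = (2 * (g t \<bullet> g' t) * (g' t \<bullet> g'' t) - (g t \<bullet> g'' t) * (n * n)) / ((n * n) * (n * n))"
      unfolding T'_def nn using n(3) by (simp add: field_simps)
    also have "\<bar>\<dots>\<bar> \<le> (2 * (x * n) * (n * B) + (x * B) * (n * n)) / ((n * n) * (n * n))"
    proof -
      have c: "\<bar>g t \<bullet> g' t\<bar> \<le> x * n" "\<bar>g' t \<bullet> g'' t\<bar> \<le> n * B" "\<bar>g t \<bullet> g'' t\<bar> \<le> x * B"
        unfolding x_def n_def using B(2)[OF t']
        by (meson Cauchy_Schwarz_ineq2 order_trans mult_left_mono norm_ge_zero)+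
      have "\<bar>2 * (g t \<bullet> g' t) * (g' t \<bullet> g'' t) - (g t \<bullet> g'' t) * (n * n)\<bar>
         \<le> \<bar>2 * (g t \<bullet> g' t) * (g' t \<bullet> g'' t)\<bar> + \<bar>(g t \<bullet> g'' t) * (n * n)\<bar>" by (rule abs_triangle_ineq4)
      also have "\<dots> \<le> 2 * (x * n) * (n * B) + (x * B) * (n * n)"
        unfolding abs_mult using c n x0 B0 by (intro add_mono mult_mono) auto
      finally have le: "\<bar>2 * (g t \<bullet> g' t) * (g' t \<bullet> g'' t) - (g t \<bullet> g'' t) * (n * n)\<bar>
         \<le> 2 * (x * n) * (n * B) + (x * B) * (n * n)" .
      have D: "(n * n) * (n * n) > 0" using n by simp
      show ?thesis
        unfolding abs_divide abs_of_pos[OF D] by (rule divide_right_mono[OF le less_imp_le[OF D]])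
    qed
    also have "\<dots> = 3 * B * x / (n * n)" using n(3) by (simp add: field_simps)
    also have "\<dots> \<le> 3 * B * (e + B * \<eta>) / (m * m)"
    proof (rule frac_le)
      show "3 * B * x \<le> 3 * B * (e + B * \<eta>)" using gb[OF t] B0 by (intro mult_left_mono) (auto simp: x_def)
      show "m * m \<le> n * n" using m n by (intro mult_mono) auto
      have "0 \<le> e + B * \<eta>" using gb[OF t] by (smt (verit) norm_ge_zero)
      thus "0 \<le> 3 * B * (e + B * \<eta>)" using B0 by simp
    qed (use m in auto)
    also have "\<dots> \<le> 1 / 2" using e(2) m(1) by (simp add: divide_simps power2_eq_square)
    finally show ?thesis by simp
  qed
  have "norm (T r - T s) \<le> 1 / 2 * norm (r - s)"
    by (rule field_differentiable_bound[where S = I, OF _ T' T'b]) (use r s in \<open>auto simp: I_def abs_le_iff\<close>)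
  thus "\<bar>T r - T s\<bar> \<le> \<bar>r - s\<bar> / 2" by simp
  have mp: "m \<le> norm (g' p)" using m(2)[of p] \<eta> by simp
  have "\<bar>T p - p\<bar> = \<bar>g p \<bullet> g' p\<bar> / (norm (g' p))\<^sup>2" by (simp add: T_def abs_divide)
  also have "\<dots> \<le> (norm (g p) * norm (g' p)) / (norm (g' p))\<^sup>2"
    by (intro divide_right_mono Cauchy_Schwarz_ineq2) auto
  also have "\<dots> = norm (g p) / norm (g' p)" by (simp add: power2_eq_square)
  also have "\<dots> \<le> e / m"
    using e(1) mp m(1) by (intro frac_le) (auto intro: order_trans[OF norm_ge_zero])
  finally show "\<bar>T p - p\<bar> \<le> e / m" .
qed

text \<open>The last bound compares an iterate with \<open>p\<close> through the last increment alone. It therefore applies at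
  whichever step the iteration stops.\<close>

lemma contraction_iterates:
  fixes T :: "real \<Rightarrow> real" and x :: "nat \<Rightarrow> real"
  assumes T: "\<And>r s. \<bar>r - p\<bar> \<le> \<eta> \<Longrightarrow> \<bar>s - p\<bar> \<le> \<eta> \<Longrightarrow> \<bar>T r - T s\<bar> \<le> \<bar>r - s\<bar> / 2"
    and e: "\<bar>T p - p\<bar> \<le> e" "e \<le> \<eta> / 2"
    and x: "\<And>m. x (Suc m) = T (x m)" "\<bar>x 0 - p\<bar> \<le> \<eta>"
  shows "\<bar>x m - p\<bar> \<le> \<eta>" "\<bar>x (Suc m) - x m\<bar> \<le> 2 * \<eta> / 2 ^ m" "\<bar>x (Suc m) - p\<bar> \<le> \<bar>x (Suc m) - x m\<bar> + 2 * e"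
proof -
  have \<eta>: "\<eta> \<ge> 0" using x(2) by linarith
  have step: "\<bar>x (Suc m) - p\<bar> \<le> \<bar>x m - p\<bar> / 2 + e" if "\<bar>x m - p\<bar> \<le> \<eta>" for m
  proof -
    have "\<bar>T (x m) - T p\<bar> \<le> \<bar>x m - p\<bar> / 2" by (rule T) (use that \<eta> in auto)
    thus ?thesis using e(1) unfolding x(1) by linarith
  qed
  show 1: "\<bar>x m - p\<bar> \<le> \<eta>" for m
  proof (induction m)
    case (Suc m)
    have "\<bar>x m - p\<bar> / 2 + e \<le> \<eta> / 2 + \<eta> / 2"
      by (intro add_mono divide_right_mono Suc e(2)) simp
    thus ?case using order_trans[OF step[OF Suc]] by simp
  qed (rule x)
  show "\<bar>x (Suc m) - x m\<bar> \<le> 2 * \<eta> / 2 ^ m"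
  proof (induction m)
    case 0
    show ?case using 1[of 0] 1[of 1] by simp
  next
    case (Suc m)
    have "\<bar>x (Suc (Suc m)) - x (Suc m)\<bar> \<le> \<bar>x (Suc m) - x m\<bar> / 2"
      using T[OF 1[of "Suc m"] 1[of m]] by (simp add: x)
    thus ?case using Suc by simp
  qed
  show "\<bar>x (Suc m) - p\<bar> \<le> \<bar>x (Suc m) - x m\<bar> + 2 * e"
  proof -
    have gen: "c \<le> b + 2 * e" if "c \<le> a / 2 + e" "a \<le> b + c" for a b c :: real
      using that by simp
    have "\<bar>x m - p\<bar> \<le> \<bar>x (Suc m) - x m\<bar> + \<bar>x (Suc m) - p\<bar>" by simp
    thus ?thesis by (rule gen[OF step[OF 1[of m]]])
  qed
qed

lemma LBINT_const_circle: "(LBINT \<theta>:{0..2*pi}. (c::real)) = 2 * pi * c"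
  unfolding set_lebesgue_integral_def by simp

lemma L2_circle_le:
  assumes f: "continuous_on {0..2*pi} f" "\<And>\<theta>. \<theta> \<in> {0..2*pi} \<Longrightarrow> \<bar>f \<theta>\<bar> \<le> c" "c \<ge> 0"
  shows "L2_circle f \<le> c * sqrt (2 * pi)"
proof -
  have "(LBINT \<theta>:{0..2*pi}. (f \<theta>)\<^sup>2) \<le> (LBINT \<theta>:{0..2*pi}. c\<^sup>2)"
  proof (rule set_integral_mono)
    show "set_integrable lborel {0..2*pi} (\<lambda>\<theta>. (f \<theta>)\<^sup>2)" "set_integrable lborel {0..2*pi} (\<lambda>\<theta>. c\<^sup>2)"
      by (intro borel_integrable_atLeastAtMost' continuous_intros f)+
    show "(f \<theta>)\<^sup>2 \<le> c\<^sup>2" if "\<theta> \<in> {0..2*pi}" for \<theta>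
      using f(2)[OF that] f(3) by (simp add: abs_le_square_iff[symmetric])
  qed
  also have "\<dots> = c\<^sup>2 * (2 * pi)" by (simp add: LBINT_const_circle)
  finally show ?thesis
    unfolding L2_circle_def using f(3) real_sqrt_le_mono by (fastforce simp: real_sqrt_mult)
qed

lemma L2_circle_triangle:
  assumes c: "continuous_on {0..2*pi} f" "continuous_on {0..2*pi} g"
    and le: "\<And>\<theta>. \<theta> \<in> {0..2*pi} \<Longrightarrow> \<bar>g \<theta>\<bar> \<le> \<bar>f \<theta>\<bar> + 2 * e" and f: "L2_circle f \<le> t"
  shows "L2_circle g \<le> sqrt (2 * t\<^sup>2 + 16 * pi * e\<^sup>2)"
proof -
  have i: "set_integrable lborel {0..2*pi} (\<lambda>\<theta>. (h \<theta>)\<^sup>2)" if "continuous_on {0..2*pi} h" for h :: "real \<Rightarrow> real"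
    by (intro borel_integrable_atLeastAtMost' continuous_intros that)
  have J0: "0 \<le> (LBINT \<theta>:{0..2*pi}. (f \<theta>)\<^sup>2)"
    unfolding set_lebesgue_integral_def by (intro Bochner_Integration.integral_nonneg) auto
  have "(L2_circle f)\<^sup>2 \<le> t\<^sup>2"
    using f J0 by (intro power_mono) (auto simp: L2_circle_def)
  hence J: "(LBINT \<theta>:{0..2*pi}. (f \<theta>)\<^sup>2) \<le> t\<^sup>2" using J0 by (simp add: L2_circle_def)
  have "(LBINT \<theta>:{0..2*pi}. (g \<theta>)\<^sup>2) \<le> (LBINT \<theta>:{0..2*pi}. 2 * (f \<theta>)\<^sup>2 + 8 * e\<^sup>2)"
  proof (rule set_integral_mono)
    show "set_integrable lborel {0..2*pi} (\<lambda>\<theta>. 2 * (f \<theta>)\<^sup>2 + 8 * e\<^sup>2)"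
      by (intro borel_integrable_atLeastAtMost' continuous_intros c)
    show "(g \<theta>)\<^sup>2 \<le> 2 * (f \<theta>)\<^sup>2 + 8 * e\<^sup>2" if "\<theta> \<in> {0..2*pi}" for \<theta>
    proof -
      have "(g \<theta>)\<^sup>2 \<le> (\<bar>f \<theta>\<bar> + 2 * e)\<^sup>2"
        using power_mono[OF le[OF that], of 2] by simp
      also have "\<dots> \<le> 2 * (f \<theta>)\<^sup>2 + 8 * e\<^sup>2"
        using sum_squares_ge_zero[of "\<bar>f \<theta>\<bar> - 2 * e" 0] by (simp add: power2_eq_square algebra_simps)
      finally show ?thesis .
    qed
  qed (intro i c)
  also have "\<dots> = 2 * (LBINT \<theta>:{0..2*pi}. (f \<theta>)\<^sup>2) + (LBINT \<theta>:{0..2*pi}. 8 * e\<^sup>2)"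
  proof (subst set_integral_add)
    show "set_integrable lborel {0..2*pi} (\<lambda>\<theta>. 2 * (f \<theta>)\<^sup>2)" "set_integrable lborel {0..2*pi} (\<lambda>\<theta>. 8 * e\<^sup>2)"
      by (intro borel_integrable_atLeastAtMost' continuous_intros c)+
  qed simp
  also have "(LBINT \<theta>:{0..2*pi}. 8 * e\<^sup>2) = 16 * pi * e\<^sup>2" by (simp add: LBINT_const_circle)
  finally show ?thesis unfolding L2_circle_def using J by (intro real_sqrt_le_mono) simp
qed

section \<open>Curves and tubes\<close>

lemma real_analytic_derivative:
  assumes "real_analytic p"
  shows "\<exists>p'. (\<forall>t. (p has_real_derivative p' t) (at t)) \<and> continuous_on UNIV p'"
proof -
  have "\<exists>D. (p has_real_derivative D) (at t) \<and> (\<exists>q. isCont q t \<and> (\<forall>\<^sub>F s in nhds t. (p has_real_derivative q s) (at s)))" for t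
  proof -
    obtain a e where e: "e > 0" "\<And>s. \<bar>s - t\<bar> < e \<Longrightarrow> (\<lambda>n. a n * (s - t) ^ n) sums p s"
      using assms unfolding real_analytic_def by blast
    define F where "F x = (\<Sum>n. a n * x ^ n)" for x
    define F' where "F' x = (\<Sum>n. diffs a n * x ^ n)" for x
    have sm: "summable (\<lambda>n. a n * x ^ n)" if "norm x < e" for x
      using e(2)[of "t + x"] that by (auto simp: summable_def)
    have sm': "summable (\<lambda>n. diffs a n * x ^ n)" if "norm x < e" for x
      by (rule termdiff_converges[OF that sm])
    have dF: "(F has_real_derivative F' x) (at x)" if "norm x < e" for x
      unfolding F_def F'_def by (rule termdiffs_strong'[OF sm that])
    have "(F' has_real_derivative (\<Sum>n. diffs (diffs a) n * 0 ^ n)) (at 0)"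
      unfolding F'_def by (rule termdiffs_strong'[OF sm']) (use e in auto)
    hence c: "isCont F' 0" by (rule DERIV_isCont)
    have dp: "(p has_real_derivative F' (s - t)) (at s)" if s: "\<bar>s - t\<bar> < e" for s
    proof -
      have "((\<lambda>s. F (s - t)) has_real_derivative F' (s - t) * 1) (at s)"
        by (rule DERIV_chain2[OF dF]) (use s in \<open>auto intro!: derivative_eq_intros\<close>)
      hence "(p has_real_derivative F' (s - t) * 1) (at s)"
        by (rule has_field_derivative_transform_within_open[where S = "ball t e"])
          (use s e in \<open>auto simp: dist_real_def abs_minus_commute F_def sums_iff\<close>)
      thus ?thesis by simp
    qed
    have "isCont (\<lambda>s. F' (s - t)) t"
      by (rule isCont_o2[where f = "\<lambda>s. s - t" and g = F']) (use c in auto)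
    moreover have "\<forall>\<^sub>F s in nhds t. (p has_real_derivative F' (s - t)) (at s)"
      unfolding eventually_nhds_metric using e dp by (auto simp: dist_real_def intro!: exI[of _ e])
    ultimately show ?thesis using dp[of t] e by auto
  qed
  then obtain D where D: "\<And>t. (p has_real_derivative D t) (at t)"
     "\<And>t. \<exists>q. isCont q t \<and> (\<forall>\<^sub>F s in nhds t. (p has_real_derivative q s) (at s))" by metis
  have "isCont D t" for t
  proof -
    obtain q where q: "isCont q t" "\<forall>\<^sub>F s in nhds t. (p has_real_derivative q s) (at s)" using D(2) by blast
    have "\<forall>\<^sub>F s in nhds t. D s = q s" using q(2) by eventually_elim (rule DERIV_unique[OF D(1)])
    thus ?thesis using q(1) by (simp add: isCont_cong)
  qed
  thus ?thesis using D(1) continuous_at_imp_continuous_on by blast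
qed

text \<open>Averaging over the parallel curves \<open>p + t\<close> turns bounds on all these curves into a bound in the
  tube that they sweep out.\<close>

lemma tube_integral_le:
  fixes w :: "real^2 \<Rightarrow> complex^2"
  assumes p: "continuous_on UNIV p" and \<kappa>: "\<kappa> > 0"
    and w: "continuous_on S w" and K: "compact K" "K \<subseteq> S"
    and tube: "\<And>r \<theta>. r > 0 \<Longrightarrow> \<theta> \<in> {0<..<2*pi} \<Longrightarrow> polar r \<theta> \<in> K \<Longrightarrow> \<bar>r - p \<theta>\<bar> \<le> \<kappa>"
    and S: "\<And>t \<theta>. \<bar>t\<bar> \<le> \<kappa> \<Longrightarrow> polar (p \<theta> + t) \<theta> \<in> S" "\<And>t \<theta>. \<bar>t\<bar> \<le> \<kappa> \<Longrightarrow> p \<theta> + t > 0"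
    and c: "\<And>t. \<bar>t\<bar> \<le> \<kappa> \<Longrightarrow> (LBINT \<theta>:{0..2*pi}. (p \<theta> + t) * norm (w (polar (p \<theta> + t) \<theta>))) \<le> c"
  shows "(\<lambda>y. norm (w y)) integrable_on K" "integral K (\<lambda>y. norm (w y)) \<le> 2 * \<kappa> * c"
proof -
  define F where "F y = indicator K y *\<^sub>R norm (w y)" for y
  have IF: "integrable lborel F"
    unfolding F_def by (intro borel_integrable_compact K continuous_intros continuous_on_subset[OF w])
  have F0: "F y \<ge> 0" for y by (simp add: F_def)
  have si: "set_integrable lborel K (\<lambda>y. norm (w y))"
    using IF unfolding F_def set_integrable_def .
  show "(\<lambda>y. norm (w y)) integrable_on K" by (rule set_borel_integral_eq_integral(1)[OF si])
  have "integral K (\<lambda>y. norm (w y)) = integral\<^sup>L lborel F"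
    using set_borel_integral_eq_integral(2)[OF si] unfolding F_def set_lebesgue_integral_def by simp
  hence eq: "ennreal (integral K (\<lambda>y. norm (w y))) = (\<integral>\<^sup>+y. ennreal (F y) \<partial>lborel)"
    using nn_integral_eq_integral[OF IF] F0 by simp
  have [measurable]: "F \<in> borel_measurable borel" using IF by simp
  have [measurable]: "p \<in> borel_measurable borel" by (rule borel_measurable_continuous_onI[OF p])
  define Q where "Q = {0..2*pi} \<times> {-\<kappa>..\<kappa>}"
  define H where "H x = indicator Q x *\<^sub>R ((p (fst x) + snd x) * norm (w (polar (p (fst x) + snd x) (fst x))))" for x :: "real \<times> real"
  have Hc: "continuous_on Q (\<lambda>x. (p (fst x) + snd x) * norm (w (polar (p (fst x) + snd x) (fst x))))"
  proof -
    have pf: "continuous_on Q (\<lambda>x. p (fst x))"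
      by (rule continuous_on_compose2[OF p]) (auto intro!: continuous_intros)
    have "continuous_on Q (\<lambda>x. w (polar (p (fst x) + snd x) (fst x)))"
    proof (rule continuous_on_compose2[OF w])
      show "continuous_on Q (\<lambda>x. polar (p (fst x) + snd x) (fst x))"
        unfolding polar_def by (intro continuous_intros pf)
    qed (auto simp: Q_def intro!: S(1))
    thus ?thesis by (intro continuous_intros pf)
  qed
  have "closed Q" unfolding Q_def by (intro closed_Times) auto
  hence Hm: "H \<in> borel_measurable (borel :: (real \<times> real) measure)"
    unfolding H_def by (intro borel_measurable_continuous_on_indicator Hc borel_closed)
  have Hm'[measurable]: "H \<in> borel_measurable (borel \<Otimes>\<^sub>M borel)"
    using Hm by (simp add: borel_prod)
  have inner: "(\<integral>\<^sup>+r. ennreal r * indicator {0<..} r * ennreal (F (polar r \<theta>)) \<partial>lborel) * indicator {0<..<2*pi} \<theta>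
     \<le> (\<integral>\<^sup>+t. ennreal (H (\<theta>, t)) \<partial>lborel)" for \<theta>
  proof (cases "\<theta> \<in> {0<..<2*pi}")
    case True
    have pm: "(\<lambda>r. polar r \<theta>) \<in> borel_measurable borel"
      unfolding polar_def by (intro borel_measurable_continuous_onI continuous_intros)
    note [measurable] = pm
    have "(\<integral>\<^sup>+r. ennreal r * indicator {0<..} r * ennreal (F (polar r \<theta>)) \<partial>lborel)
       = (\<integral>\<^sup>+t. ennreal (p \<theta> + t) * indicator {0<..} (p \<theta> + t) * ennreal (F (polar (p \<theta> + t) \<theta>)) \<partial>lborel)"
      by (subst nn_integral_real_affine[where c = 1 and t = "p \<theta>"]) auto
    also have "\<dots> \<le> (\<integral>\<^sup>+t. ennreal (H (\<theta>, t)) \<partial>lborel)"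
    proof (rule nn_integral_mono)
      fix t :: real
      show "ennreal (p \<theta> + t) * indicator {0<..} (p \<theta> + t) * ennreal (F (polar (p \<theta> + t) \<theta>)) \<le> ennreal (H (\<theta>, t))"
      proof (cases "p \<theta> + t > 0 \<and> polar (p \<theta> + t) \<theta> \<in> K")
        case in_K: True
        hence "\<bar>t\<bar> \<le> \<kappa>" using tube[of "p \<theta> + t" \<theta>] True by auto
        hence "(\<theta>, t) \<in> Q" using True by (auto simp: Q_def)
        thus ?thesis using in_K by (simp add: H_def F_def ennreal_mult)
      qed (auto simp: F_def indicator_def)
    qed
    finally show ?thesis using True by simp
  qed simp
  have row: "(\<integral>\<^sup>+\<theta>. ennreal (H (\<theta>, t)) \<partial>lborel) \<le> ennreal c * indicator {-\<kappa>..\<kappa>} t" for t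
  proof (cases "\<bar>t\<bar> \<le> \<kappa>")
    case True
    have "(\<integral>\<^sup>+\<theta>. ennreal (H (\<theta>, t)) \<partial>lborel) = (\<integral>\<^sup>+\<theta>. ennreal (indicator {0..2*pi} \<theta> *\<^sub>R ((p \<theta> + t) * norm (w (polar (p \<theta> + t) \<theta>)))) \<partial>lborel)"
      using True by (intro nn_integral_cong) (auto simp: H_def Q_def indicator_def)
    also have "\<dots> = ennreal (LBINT \<theta>:{0..2*pi}. (p \<theta> + t) * norm (w (polar (p \<theta> + t) \<theta>)))"
      unfolding set_lebesgue_integral_def
    proof (rule nn_integral_eq_integral)
      have pc: "continuous_on {0..2*pi} p" by (rule continuous_on_subset[OF p]) simp
      have "continuous_on {0..2*pi} (\<lambda>\<theta>. w (polar (p \<theta> + t) \<theta>))"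
        by (rule continuous_on_compose2[OF w])
          (use S(1)[OF True] in \<open>auto simp: polar_def intro!: continuous_intros pc\<close>)
      thus "integrable lborel (\<lambda>\<theta>. indicator {0..2*pi} \<theta> *\<^sub>R ((p \<theta> + t) * norm (w (polar (p \<theta> + t) \<theta>))))"
        by (intro borel_integrable_compact compact_Icc continuous_intros pc)
      have "0 \<le> p \<theta> + t" for \<theta> using S(2)[OF True, of \<theta>] by simp
      thus "AE \<theta> in lborel. 0 \<le> indicator {0..2*pi} \<theta> *\<^sub>R ((p \<theta> + t) * norm (w (polar (p \<theta> + t) \<theta>)))"
        by (auto intro!: AE_I2 mult_nonneg_nonneg)
    qed
    also have "\<dots> \<le> ennreal c" by (rule ennreal_leI[OF c[OF True]])
    finally show ?thesis using True by (simp add: indicator_def abs_le_iff)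
  next
    case False
    hence "(\<theta>, t) \<notin> Q" for \<theta> by (auto simp: Q_def abs_le_iff)
    hence "H (\<theta>, t) = 0" for \<theta> by (simp add: H_def)
    thus ?thesis by simp
  qed
  have "(\<integral>\<^sup>+y. ennreal (F y) \<partial>lborel) \<le> (\<integral>\<^sup>+\<theta>. \<integral>\<^sup>+t. ennreal (H (\<theta>, t)) \<partial>lborel \<partial>lborel)"
    by (subst nn_integral_polar) (auto intro!: nn_integral_mono inner)
  also have "\<dots> = (\<integral>\<^sup>+t. \<integral>\<^sup>+\<theta>. ennreal (H (\<theta>, t)) \<partial>lborel \<partial>lborel)"
    by (rule lborel_pair.Fubini'[symmetric]) (simp add: case_prod_beta)
  also have "\<dots> \<le> (\<integral>\<^sup>+t. ennreal c * indicator {-\<kappa>..\<kappa>} t \<partial>lborel)"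
    by (intro nn_integral_mono row)
  also have "\<dots> = ennreal c * ennreal (2 * \<kappa>)"
    using \<kappa> by (subst nn_integral_cmult_indicator) auto
  also have "\<dots> = ennreal (2 * \<kappa> * c)"
    using \<kappa> by (simp add: ennreal_mult'[symmetric] ennreal_mult''[symmetric] mult.commute)
  finally have "ennreal (integral K (\<lambda>y. norm (w y))) \<le> ennreal (2 * \<kappa> * c)" using eq by simp
  moreover have "0 \<le> c"
  proof -
    have "0 \<le> p \<theta>" for \<theta> using S(2)[of 0 \<theta>] \<kappa> by simp
    hence "0 \<le> (LBINT \<theta>:{0..2*pi}. (p \<theta> + 0) * norm (w (polar (p \<theta> + 0) \<theta>)))"
      unfolding set_lebesgue_integral_def
      by (intro Bochner_Integration.integral_nonneg) (auto intro!: mult_nonneg_nonneg)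
    also have "\<dots> \<le> c" by (rule c) (use \<kappa> in simp)
    finally show ?thesis .
  qed
  ultimately show "integral K (\<lambda>y. norm (w y)) \<le> 2 * \<kappa> * c"
    using \<kappa> by (subst (asm) ennreal_le_iff) auto
qed

text \<open>The arc length density dominates \<open>q\<close>, and \<open>2 a \<xi> \<le> a\<^sup>2 + \<xi>\<^sup>2\<close> linearises the \<open>L\<^sup>2\<close> bound with a
  result that is again proportional to \<open>\<xi>\<close>.\<close>

lemma curve_L1_le_L2:
  assumes q: "continuous_on UNIV q" "continuous_on UNIV (deriv q)" "\<And>\<theta>. 0 < q \<theta>" "\<And>\<theta>. q \<theta> \<le> M"
    and a: "continuous_on {0..2*pi} (\<lambda>\<theta>. f (q \<theta>) \<theta>)" and \<xi>: "\<xi> > 0" and L: "L2_curve q f \<le> \<xi>"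
  shows "(LBINT \<theta>:{0..2*pi}. q \<theta> * norm (f (q \<theta>) \<theta>)) \<le> \<xi> * (1 + 2 * pi * M) / 2"
proof -
  define s where "s \<theta> = sqrt ((q \<theta>)\<^sup>2 + (deriv q \<theta>)\<^sup>2)" for \<theta>
  define J where "J = (LBINT \<theta>:{0..2*pi}. (norm (f (q \<theta>) \<theta>))\<^sup>2 * s \<theta>)"
  have qc: "continuous_on {0..2*pi} q" "continuous_on {0..2*pi} (deriv q)"
    using q(1,2) by (auto intro: continuous_on_subset)
  have sc: "continuous_on {0..2*pi} s" unfolding s_def by (intro continuous_intros qc)
  have J0: "J \<ge> 0" unfolding J_def set_lebesgue_integral_def
    by (intro Bochner_Integration.integral_nonneg) (auto simp: s_def)
  have "sqrt J \<le> \<xi>" using L unfolding L2_curve_def J_def s_def .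
  hence J: "J \<le> \<xi>\<^sup>2" using J0 \<xi> by (simp add: real_le_rsqrt sqrt_le_D)
  have "(LBINT \<theta>:{0..2*pi}. q \<theta> * norm (f (q \<theta>) \<theta>)) \<le>
      (LBINT \<theta>:{0..2*pi}. 1 / (2 * \<xi>) * ((norm (f (q \<theta>) \<theta>))\<^sup>2 * s \<theta>) + \<xi> * M / 2)"
  proof (rule set_integral_mono)
    show "set_integrable lborel {0..2*pi} (\<lambda>\<theta>. q \<theta> * norm (f (q \<theta>) \<theta>))"
      "set_integrable lborel {0..2*pi} (\<lambda>\<theta>. 1 / (2 * \<xi>) * ((norm (f (q \<theta>) \<theta>))\<^sup>2 * s \<theta>) + \<xi> * M / 2)"
      by (intro borel_integrable_atLeastAtMost' continuous_intros qc sc a)+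
    fix \<theta>
    define x where "x = norm (f (q \<theta>) \<theta>)"
    have qs: "q \<theta> \<le> s \<theta>" unfolding s_def using q(3)[of \<theta>] by (intro real_le_rsqrt) auto
    have "0 \<le> (x - \<xi>)\<^sup>2" by simp
    hence "2 * x * \<xi> \<le> x\<^sup>2 + \<xi>\<^sup>2" by (simp add: power2_eq_square algebra_simps)
    hence "q \<theta> * (2 * x * \<xi>) \<le> q \<theta> * (x\<^sup>2 + \<xi>\<^sup>2)" using q(3)[of \<theta>] by (intro mult_left_mono) auto
    also have "\<dots> = x\<^sup>2 * q \<theta> + \<xi>\<^sup>2 * q \<theta>" by (simp add: algebra_simps)
    also have "\<dots> \<le> x\<^sup>2 * s \<theta> + \<xi>\<^sup>2 * M" using qs q(4)[of \<theta>] by (intro add_mono mult_left_mono) auto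
    finally have "2 * \<xi> * (q \<theta> * x) \<le> x\<^sup>2 * s \<theta> + \<xi>\<^sup>2 * M" by (simp add: mult_ac)
    hence "q \<theta> * x \<le> (x\<^sup>2 * s \<theta> + \<xi>\<^sup>2 * M) / (2 * \<xi>)" using \<xi> by (simp add: pos_le_divide_eq mult.commute)
    also have "\<dots> = 1 / (2 * \<xi>) * (x\<^sup>2 * s \<theta>) + \<xi> * M / 2" using \<xi> by (simp add: field_simps power2_eq_square)
    finally show "q \<theta> * norm (f (q \<theta>) \<theta>) \<le> 1 / (2 * \<xi>) * ((norm (f (q \<theta>) \<theta>))\<^sup>2 * s \<theta>) + \<xi> * M / 2"
      by (simp add: x_def)
  qed
  also have "\<dots> = 1 / (2 * \<xi>) * J + (LBINT \<theta>:{0..2*pi}. \<xi> * M / 2)"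
  proof (subst set_integral_add)
    show "set_integrable lborel {0..2*pi} (\<lambda>\<theta>. 1 / (2 * \<xi>) * ((norm (f (q \<theta>) \<theta>))\<^sup>2 * s \<theta>))"
      "set_integrable lborel {0..2*pi} (\<lambda>\<theta>. \<xi> * M / 2)"
      by (intro borel_integrable_atLeastAtMost' continuous_intros sc a)+
  qed (simp add: J_def)
  also have "(LBINT \<theta>:{0..2*pi}. \<xi> * M / 2) = \<xi> * (pi * M)" by (simp add: LBINT_const_circle)
  also have "1 / (2 * \<xi>) * J \<le> 1 / (2 * \<xi>) * \<xi>\<^sup>2" using J \<xi> by (intro mult_left_mono) auto
  also have "1 / (2 * \<xi>) * \<xi>\<^sup>2 = \<xi> / 2" using \<xi> by (simp add: power2_eq_square)
  finally show ?thesis by (simp add: algebra_simps)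
qed

text \<open>Within a large disc, the points whose radial distance from the curve is at least \<open>\<kappa>\<close> form a compact
  set that misses the curve, so a neighbourhood of the curve lies in the tube.\<close>

lemma ex_tube_neighbourhood:
  fixes p :: "real \<Rightarrow> real"
  assumes p: "continuous_on UNIV p" "\<And>\<theta>. p (\<theta> + 2 * pi) = p \<theta>" "\<And>\<theta>. p \<theta> > 0" and \<kappa>: "\<kappa> > 0"
    and \<Gamma>: "compact \<Gamma>" "\<Gamma> = {polar (p \<theta>) \<theta> |\<theta>. True}" and S: "open S" "\<Gamma> \<subseteq> S"
  shows "\<exists>d>0. {x. infdist x \<Gamma> \<le> d} \<subseteq> S \<and>
    (\<forall>r \<theta>. r > 0 \<longrightarrow> \<theta> \<in> {0<..<2*pi} \<longrightarrow> infdist (polar r \<theta>) \<Gamma> \<le> d \<longrightarrow> \<bar>r - p \<theta>\<bar> \<le> \<kappa>)"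
proof -
  obtain M where M: "\<And>x. x \<in> \<Gamma> \<Longrightarrow> norm x < M"
    using compact_imp_bounded[OF \<Gamma>(1)] unfolding bounded_pos_less by blast
  have pper: "p (\<theta> + 2 * pi * of_nat n) = p \<theta>" for \<theta> n
  proof (induction n)
    case (Suc n)
    have "p (\<theta> + 2 * pi * of_nat (Suc n)) = p ((\<theta> + 2 * pi * of_nat n) + 2 * pi)" by (simp add: algebra_simps)
    thus ?case using p(2) Suc by simp
  qed simp
  have pperi: "p (\<theta> + 2 * pi * of_int n) = p \<theta>" for \<theta> n
  proof (cases "n \<ge> 0")
    case True
    thus ?thesis using pper[of \<theta> "nat n"] by simp
  next
    case False
    thus ?thesis using pper[of "\<theta> + 2 * pi * of_int n" "nat (- n)"] by (simp add: algebra_simps)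
  qed
  define A where "A = ({0..M} \<times> {0..2*pi}) \<inter> {x. \<kappa> \<le> \<bar>fst x - p (snd x)\<bar>}"
  define Tc where "Tc = (\<lambda>x. polar (fst x) (snd x)) ` A"
  have "compact A"
  proof -
    have "continuous_on UNIV (\<lambda>x::real \<times> real. p (snd x))"
      by (rule continuous_on_compose2[OF p(1)]) (auto intro!: continuous_intros)
    hence "closed {x. \<kappa> \<le> \<bar>fst x - p (snd x)\<bar>}" by (intro closed_Collect_le continuous_intros)
    thus ?thesis unfolding A_def by (intro compact_Int_closed compact_Times) auto
  qed
  hence "compact Tc" unfolding Tc_def polar_def by (intro compact_continuous_image continuous_intros)
  hence cT: "closed Tc" by (rule compact_imp_closed)
  have disj: "x \<notin> Tc" if "x \<in> \<Gamma>" for x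
  proof
    assume "x \<in> Tc"
    then obtain r \<theta> where r: "x = polar r \<theta>" "r \<ge> 0" "\<kappa> \<le> \<bar>r - p \<theta>\<bar>" by (auto simp: Tc_def A_def)
    obtain t where t: "x = polar (p t) t" using \<open>x \<in> \<Gamma>\<close> \<Gamma>(2) by blast
    have "\<bar>r\<bar> = \<bar>p t\<bar>" using r(1) t norm_polar by metis
    hence "r > 0" using p(3)[of t] r(2) by linarith
    have e: "polar r \<theta> = polar (p t) t" using r(1) t by simp
    have "r = p t" by (rule polar_eq_polar(1)[OF e \<open>r > 0\<close> p(3)])
    moreover obtain n :: int where "\<theta> = t + 2 * pi * n" using polar_eq_polar(2)[OF e \<open>r > 0\<close> p(3)] by blast
    ultimately show False using r(3) \<kappa> pperi[of t n] by simp
  qed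
  define B where "B = S \<inter> (- Tc) \<inter> ball 0 M"
  have "open B" unfolding B_def using S cT by (intro open_Int) auto
  moreover have "\<Gamma> \<subseteq> B" using S(2) disj M by (auto simp: B_def)
  moreover have "\<Gamma> \<noteq> {}" using \<Gamma>(2) by auto
  ultimately obtain d where d: "d > 0" "{x. infdist x \<Gamma> \<le> d} \<subseteq> B"
    using compact_in_open_separated[of \<Gamma> B] \<Gamma>(1) by metis
  have "\<bar>r - p \<theta>\<bar> \<le> \<kappa>" if r: "r > 0" "\<theta> \<in> {0<..<2*pi}" "infdist (polar r \<theta>) \<Gamma> \<le> d" for r \<theta>
  proof (rule ccontr)
    assume n: "\<not> ?thesis"
    have "polar r \<theta> \<in> B" using d r by blast
    hence "r < M" "polar r \<theta> \<notin> Tc" using r by (auto simp: B_def)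
    moreover have "(r, \<theta>) \<in> A" using r n \<open>r < M\<close> by (auto simp: A_def)
    ultimately show False by (force simp: Tc_def)
  qed
  thus ?thesis using d by (intro exI[of _ d]) (auto simp: B_def)
qed

section \<open>Regularity of the approximate fields near the curve\<close>

definition radially_regular :: "(real \<Rightarrow> real \<Rightarrow> complex^2) \<Rightarrow> real \<Rightarrow> real \<Rightarrow> real \<Rightarrow> bool" where
  "radially_regular F r \<theta> b \<longleftrightarrow>
     ((\<lambda>s. F s \<theta>) has_vector_derivative radial_deriv F r \<theta>) (at r) \<and>
     (\<exists>g2. ((\<lambda>s. radial_deriv F s \<theta>) has_vector_derivative g2) (at r) \<and> norm g2 \<le> b) \<and>
     norm (F r \<theta>) \<le> b \<and> norm (radial_deriv F r \<theta>) \<le> b \<and>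
     isCont (\<lambda>x. F (fst x) (snd x)) (r, \<theta>) \<and> isCont (\<lambda>x. radial_deriv F (fst x) (snd x)) (r, \<theta>)"

text \<open>The interior estimate in terms of the radial derivative of a function of \<open>r\<close> and \<open>\<theta>\<close>, which need
  agree with the field only for positive \<open>r\<close>.\<close>

theorem polar_field_regularity:
  assumes k: "0 < k" "k < k'" and d: "d > 0"
  shows "\<exists>C>0. \<forall>S f F r \<theta> I. two_wave_field k k' S f \<longrightarrow> (\<forall>s>0. \<forall>t. F s t = f (polar s t)) \<longrightarrow>
     r > 0 \<longrightarrow> cball (polar r \<theta>) d \<subseteq> S \<longrightarrow> integral (cball (polar r \<theta>) d) (\<lambda>y. norm (f y)) \<le> I \<longrightarrow>
     radially_regular F r \<theta> (C * I)"
proof -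
  obtain C where C: "C > 0" and est: "\<forall>S f. two_wave_field k k' S f \<longrightarrow> (\<forall>r \<theta>. cball (polar r \<theta>) d \<subseteq> S \<longrightarrow>
     (\<exists>\<sigma>>0. \<exists>g1 g2.
        (\<forall>s t. polar s t \<in> ball (polar r \<theta>) \<sigma> \<longrightarrow> ((\<lambda>s. f (polar s t)) has_vector_derivative g1 s t) (at s)) \<and>
        ((\<lambda>s. g1 s \<theta>) has_vector_derivative g2) (at r) \<and>
        continuous_on UNIV (\<lambda>(s, t). g1 s t) \<and>
        norm (f (polar r \<theta>)) \<le> C * integral (cball (polar r \<theta>) d) (\<lambda>y. norm (f y)) \<and>
        norm (g1 r \<theta>) \<le> C * integral (cball (polar r \<theta>) d) (\<lambda>y. norm (f y)) \<and>
        norm g2 \<le> C * integral (cball (polar r \<theta>) d) (\<lambda>y. norm (f y))))"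
    using two_wave_radial_estimate[OF k d] by (elim exE conjE) (rule that)
  show ?thesis
    unfolding radially_regular_def
  proof (rule exI[of _ C], intro conjI allI impI)
    show "C > 0" by (rule C)
    fix S :: "(real^2) set" and f and F :: "real \<Rightarrow> real \<Rightarrow> complex^2" and r \<theta> I :: real
    assume f: "two_wave_field k k' S f" and F: "\<forall>s>0. \<forall>t. F s t = f (polar s t)"
      and r: "r > 0" and sub: "cball (polar r \<theta>) d \<subseteq> S"
      and I: "integral (cball (polar r \<theta>) d) (\<lambda>y. norm (f y)) \<le> I"
    from est[rule_format, OF f sub] obtain \<sigma> g1 g2 where \<sigma>: "\<sigma> > 0"
      and g: "\<forall>s t. polar s t \<in> ball (polar r \<theta>) \<sigma> \<longrightarrow> ((\<lambda>s. f (polar s t)) has_vector_derivative g1 s t) (at s)"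
      and g2: "((\<lambda>s. g1 s \<theta>) has_vector_derivative g2) (at r)"
      and cont: "continuous_on UNIV (\<lambda>(s, t). g1 s t)"
      and b: "norm (f (polar r \<theta>)) \<le> C * integral (cball (polar r \<theta>) d) (\<lambda>y. norm (f y))"
        "norm (g1 r \<theta>) \<le> C * integral (cball (polar r \<theta>) d) (\<lambda>y. norm (f y))"
        "norm g2 \<le> C * integral (cball (polar r \<theta>) d) (\<lambda>y. norm (f y))"
      by (elim exE conjE) (rule that)
    have CI: "C * integral (cball (polar r \<theta>) d) (\<lambda>y. norm (f y)) \<le> C * I"
      using I C by (intro mult_left_mono) auto
    have dF: "((\<lambda>s. F s t) has_vector_derivative g1 s t) (at s)" if "s > 0" "polar s t \<in> ball (polar r \<theta>) \<sigma>" for s t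
      by (rule has_vector_derivative_transform_within_open[OF g[rule_format, OF that(2)], of "{0<..}"])
        (use that F in auto)
    have rd: "radial_deriv F s t = g1 s t" if "s > 0" "polar s t \<in> ball (polar r \<theta>) \<sigma>" for s t
      using vector_derivative_at[OF dF[OF that]] by (simp add: radial_deriv_def)
    have x0: "polar r \<theta> \<in> ball (polar r \<theta>) \<sigma>" using \<sigma> by simp
    show "((\<lambda>s. F s \<theta>) has_vector_derivative radial_deriv F r \<theta>) (at r)"
      using dF[OF r x0] rd[OF r x0] by simp
    define W where "W = {x::real \<times> real. 0 < fst x} \<inter> (\<lambda>x. polar (fst x) (snd x)) -` ball (polar r \<theta>) \<sigma>"
    have W: "open W"
      unfolding W_def polar_def
      by (intro open_Int open_Collect_less open_vimage continuous_intros open_ball)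
    have Wr: "(r, \<theta>) \<in> W" using r x0 by (simp add: W_def)
    have evW: "\<forall>\<^sub>F x in nhds (r, \<theta>). x \<in> W" by (rule eventually_nhds_in_open[OF W Wr])
    show "\<exists>g2. ((\<lambda>s. radial_deriv F s \<theta>) has_vector_derivative g2) (at r) \<and> norm g2 \<le> C * I"
    proof (intro exI conjI)
      have "open ({0<..} \<inter> (\<lambda>s. polar s \<theta>) -` ball (polar r \<theta>) \<sigma>)"
        unfolding polar_def by (intro open_Int open_vimage continuous_intros open_ball open_greaterThan)
      thus "((\<lambda>s. radial_deriv F s \<theta>) has_vector_derivative g2) (at r)"
        by (rule has_vector_derivative_transform_within_open[OF g2])
          (auto simp: r \<sigma> rd)
      show "norm g2 \<le> C * I" using b(3) CI by linarith
    qed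
    show "norm (F r \<theta>) \<le> C * I" using b(1) CI F r by auto
    show "norm (radial_deriv F r \<theta>) \<le> C * I" using b(2) CI rd[OF r x0] by simp
    have "isCont f (polar r \<theta>)"
    proof -
      have "continuous_on (ball (polar r \<theta>) d) f"
        by (rule continuous_on_subset[OF two_wave_field_continuous[OF f]]) (use sub in auto)
      thus ?thesis using d by (simp add: continuous_on_eq_continuous_at)
    qed
    hence "isCont (\<lambda>x. f (polar (fst x) (snd x))) (r, \<theta>)"
    proof (rule isCont_o2[rotated, of "\<lambda>x. polar (fst x) (snd x)" "(r, \<theta>)" f, simplified])
      have "continuous_on UNIV (\<lambda>x::real \<times> real. polar (fst x) (snd x))"
        unfolding polar_def by (intro continuous_intros)
      thus "isCont (\<lambda>x. polar (fst x) (snd x)) (r, \<theta>)"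
        by (simp add: continuous_on_eq_continuous_at)
    qed
    moreover have "\<forall>\<^sub>F x in nhds (r, \<theta>). F (fst x) (snd x) = f (polar (fst x) (snd x))"
      using evW by eventually_elim (use F in \<open>auto simp: W_def\<close>)
    ultimately show "isCont (\<lambda>x. F (fst x) (snd x)) (r, \<theta>)"
      by (simp add: isCont_cong)
    have "isCont (\<lambda>(s, t). g1 s t) (r, \<theta>)"
      using cont by (simp add: continuous_on_eq_continuous_at)
    moreover have "\<forall>\<^sub>F x in nhds (r, \<theta>). radial_deriv F (fst x) (snd x) = (\<lambda>(s, t). g1 s t) x"
      using evW by eventually_elim (use rd in \<open>auto simp: W_def\<close>)
    ultimately show "isCont (\<lambda>x. radial_deriv F (fst x) (snd x)) (r, \<theta>)"
      by (simp add: isCont_cong)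
  qed
qed

text \<open>Continuity of the iterates makes their \<open>L\<^sup>2\<close> norms meaningful: the integral of a function that is not
  integrable has the default value zero, so that without it a stopping criterion could hold vacuously.\<close>

lemma newton_continuous:
  assumes p0: "continuous_on UNIV p0"
    and near: "\<And>m \<theta>. \<bar>newton u p0 m \<theta> - p \<theta>\<bar> \<le> \<eta>"
    and u: "\<And>r \<theta>. \<bar>r - p \<theta>\<bar> \<le> \<eta> \<Longrightarrow> isCont (\<lambda>x. u (fst x) (snd x)) (r, \<theta>)"
      "\<And>r \<theta>. \<bar>r - p \<theta>\<bar> \<le> \<eta> \<Longrightarrow> isCont (\<lambda>x. radial_deriv u (fst x) (snd x)) (r, \<theta>)"
      "\<And>r \<theta>. \<bar>r - p \<theta>\<bar> \<le> \<eta> \<Longrightarrow> radial_deriv u r \<theta> \<noteq> 0"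
  shows "continuous_on UNIV (newton u p0 m)"
proof (induction m)
  case (Suc m)
  have c: "isCont (newton u p0 m) \<theta>" for \<theta>
    using Suc by (simp add: continuous_on_eq_continuous_at)
  have pair: "isCont (\<lambda>\<theta>. (newton u p0 m \<theta>, \<theta>)) \<theta>" for \<theta>
    by (intro isCont_Pair c) simp
  have 1: "isCont (\<lambda>\<theta>. u (newton u p0 m \<theta>) \<theta>) \<theta>" for \<theta>
    using isCont_o2[OF pair u(1)[OF near]] by simp
  have 2: "isCont (\<lambda>\<theta>. radial_deriv u (newton u p0 m \<theta>) \<theta>) \<theta>" for \<theta>
    using isCont_o2[OF pair u(2)[OF near]] by simp
  have "isCont (newton u p0 (Suc m)) \<theta>" for \<theta>
    unfolding newton.simps Re_vquot
    by (intro continuous_diff c continuous_divide continuous_inner continuous_power continuous_norm 1 2)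
      (use u(3)[OF near] in simp)
  thus ?case by (simp add: continuous_on_eq_continuous_at)
qed (use p0 in simp)

lemma truncation_eventually_ge:
  assumes "R > 0" "\<gamma> > 0"
  shows "\<forall>\<^sub>F \<delta> in at_right 0. of_int (truncation R \<gamma> \<delta>) \<ge> (c::real)"
proof -
  define L where "L = ln ((R + \<gamma>) / R)"
  have L: "L > 0" unfolding L_def using assms by (intro ln_gt_zero) (simp add: field_simps)
  have "\<forall>\<^sub>F \<delta> in at_right 0. \<delta> \<in> {0<..<exp (- (L * c))}"
    by (rule eventually_at_right_real) simp
  thus ?thesis
  proof eventually_elim
    case (elim \<delta>)
    hence "ln \<delta> \<le> - (L * c)" using ln_less_cancel_iff[of \<delta> "exp (- (L * c))"] by simp
    hence "L * c \<le> ln (1 / \<delta>)" using elim by (simp add: ln_div)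
    hence "c \<le> ln (1 / \<delta>) / L" using L by (simp add: pos_le_divide_eq mult.commute)
    also have "\<dots> \<le> of_int (truncation R \<gamma> \<delta>)" unfolding truncation_def L_def by (rule le_of_int_ceiling)
    finally show ?case .
  qed
qed

section \<open>Local convergence of the Newton iteration\<close>

theorem theorem7:
  fixes D :: "(real^2) set" and \<rho> R \<gamma> \<epsilon> \<kappa> lam \<mu> \<omega> kp ks :: real
    and z pol :: "real^2"
    and v ui :: "real^2 \<Rightarrow> complex^2" and \<phi>p \<phi>s :: "real^2 \<Rightarrow> complex"
    and vdata :: "real \<Rightarrow> real \<Rightarrow> complex^2" and c :: "real \<Rightarrow> int \<Rightarrow> complex^2"
    and u :: "real \<Rightarrow> real \<Rightarrow> complex^2"
    and vN uN :: "real \<Rightarrow> real \<Rightarrow> real \<Rightarrow> complex^2"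
    and N :: "real \<Rightarrow> int"
    and \<xi>2 \<xi>3 C1 :: "real \<Rightarrow> real"
    and p :: "real \<Rightarrow> real" and U :: "(real \<Rightarrow> real) set"
  assumes lame: "\<mu> > 0" "lam + \<mu> > 0" "\<omega> > 0"
    and wavenumbers: "kp = \<omega> / sqrt (lam + 2 * \<mu>)" "ks = \<omega> / sqrt \<mu>"
    and obstacle: "open D" "connected D" "D \<noteq> {}" "bounded D" "simply_connected D"
      "\<rho> > 0" "D \<subseteq> ball 0 \<rho>" "connected (ball 0 \<rho> - closure D)"
      "R > 0" "ball 0 R \<subseteq> D"
    and boundary: "real_analytic p" "\<And>\<theta>. p (\<theta> + 2 * pi) = p \<theta>" "\<And>\<theta>. p \<theta> > 0"
      "frontier D = {polar (p \<theta>) \<theta> |\<theta>. True}"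
    and source: "z \<in> sphere 0 \<rho>" "z \<notin> closure D" "norm pol = 1"
    and incident: "ui = incident_field \<mu> \<omega> kp ks z pol"
    and scattering: "navier_on lam \<mu> \<omega> (- closure D) v"
      "\<And>x. x \<in> frontier D \<Longrightarrow> ui x + v x = 0"
      "kupradze_sommerfeld kp ks v"
    and potentials: "radiating_potential kp R \<phi>p" "radiating_potential ks R \<phi>s"
      "\<And>x. norm x > R \<Longrightarrow> v x = grad \<phi>p x + curl \<phi>s x"
    and total: "u = (\<lambda>r \<theta>. ui (polar r \<theta>) + v (polar r \<theta>))"
    and hankel_nonzero: "\<And>n. hankel1 n (kp * \<rho>) \<noteq> 0" "\<And>n. hankel1 n (ks * \<rho>) \<noteq> 0"
    and data: "\<And>\<delta>. \<delta> \<in> {0<..<1} \<Longrightarrow> square_integrable_0_2pi (vdata \<delta>)"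
      "\<And>\<delta>. \<delta> \<in> {0<..<1} \<Longrightarrow>
         L2_curve (\<lambda>_. \<rho>) (\<lambda>r \<theta>. v (polar r \<theta>) - vdata \<delta> \<theta>)
           \<le> \<delta> * L2_curve (\<lambda>_. \<rho>) (\<lambda>r \<theta>. v (polar r \<theta>))"
    and coefficients: "\<And>n. invertible (mode_system kp ks R \<rho> n)"
      "\<And>\<delta> n. \<delta> \<in> {0<..<1} \<Longrightarrow> mode_system kp ks R \<rho> n *v c \<delta> n = mode_data \<rho> (vdata \<delta>) n"
    and approximation: "N = truncation R \<gamma>"
      "vN = (\<lambda>\<delta>. mode_sum kp ks R (N \<delta>) (c \<delta>))"
      "uN = (\<lambda>\<delta> r \<theta>. ui (polar r \<theta>) + vN \<delta> r \<theta>)"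
    and neighbourhood: "\<kappa> > 0" "U = curve_nbhd p \<kappa>"
    and assumption2: "\<epsilon> > 0" "\<And>q \<theta>. q \<in> U \<Longrightarrow> norm (radial_deriv u (q \<theta>) \<theta>) \<ge> 4 * \<epsilon>"
    and assumption3: "\<gamma> > 0" "\<And>q \<theta>. q \<in> U \<Longrightarrow> q \<theta> \<ge> R + \<gamma>"
    and error_functions: "(\<xi>2 \<longlongrightarrow> 0) (at_right 0)" "(\<xi>3 \<longlongrightarrow> 0) (at_right 0)"
    and errors: "\<And>\<delta> p0 m. \<lbrakk>\<delta> \<in> {0<..<1}; of_int (N \<delta>) \<ge> 4 * ks * \<rho> + 1;
            \<forall>j\<le>m. newton (uN \<delta>) p0 j \<in> U\<rbrakk> \<Longrightarrow>
         L2_curve (newton (uN \<delta>) p0 m) (\<lambda>r \<theta>. v (polar r \<theta>) - vN \<delta> r \<theta>) \<le> \<xi>2 \<delta> \<and>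
         L2_curve (newton (uN \<delta>) p0 m)
           (\<lambda>r \<theta>. radial_deriv (\<lambda>r \<theta>. v (polar r \<theta>)) r \<theta> - radial_deriv (vN \<delta>) r \<theta>) \<le> \<xi>3 \<delta>"
    and lower_bound: "\<forall>\<^sub>F \<delta> in at_right 0. \<forall>q\<in>U. \<forall>\<theta>. norm (radial_deriv (uN \<delta>) (q \<theta>) \<theta>) \<ge> 2 * \<epsilon>"
    and tolerance: "C1 = (\<lambda>\<delta>. 4 * \<xi>2 \<delta> / (\<epsilon> - 2 * \<xi>3 \<delta>))"
  shows "\<exists>\<eta>>0. \<forall>p0 \<in> curve_nbhd p \<eta>.
           (\<forall>\<^sub>F \<delta> in at_right 0. \<xi>2 \<delta> > 0 \<longrightarrow> (\<exists>m. stop_crit (uN \<delta>) p0 (C1 \<delta>) m)) \<and>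
           ((\<lambda>\<delta>. L2_circle (\<lambda>\<theta>. newton_stopped (uN \<delta>) p0 (C1 \<delta>) \<theta> - p \<theta>)) \<longlongrightarrow> 0)
             (at 0 within {\<delta>. \<delta> > 0 \<and> (\<exists>m. stop_crit (uN \<delta>) p0 (C1 \<delta>) m)})"
proof -
  have kp: "kp > 0" and ks: "ks > 0" and kk: "kp < ks"
  proof -
    have l: "0 < lam + 2 * \<mu>" using lame by linarith
    show "kp > 0" "ks > 0" using lame l by (simp_all add: wavenumbers)
    have "sqrt \<mu> < sqrt (lam + 2 * \<mu>)" using lame by simp
    thus "kp < ks" unfolding wavenumbers using lame l by (intro divide_strict_left_mono) auto
  qed
  obtain p' where p': "\<And>t. (p has_real_derivative p' t) (at t)" "continuous_on UNIV p'"
    using real_analytic_derivative[OF boundary(1)] by blast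
  have pc: "continuous_on UNIV p"
    by (intro continuous_at_imp_continuous_on ballI DERIV_isCont[OF p'(1)])
  have shift: "(\<lambda>\<theta>. p \<theta> + t) \<in> U" if "\<bar>t\<bar> \<le> \<kappa>" for t
  proof -
    have d: "((\<lambda>\<theta>. p \<theta> + t) has_real_derivative p' \<theta>) (at \<theta>)" for \<theta>
      by (auto intro!: derivative_eq_intros p')
    have "(\<lambda>\<theta>. p \<theta> + t) C1_differentiable_on UNIV"
      unfolding C1_differentiable_on_def
      using d p'(2) by (auto simp: has_real_derivative_iff_has_vector_derivative intro!: exI[of _ p'])
    thus ?thesis
      using that boundary(2) neighbourhood(1) unfolding neighbourhood(2) curve_nbhd_def
      by (simp add: DERIV_imp_deriv[OF d] DERIV_imp_deriv[OF p'(1)])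
  qed
  have shift_ge: "p \<theta> + t \<ge> R + \<gamma>" if "\<bar>t\<bar> \<le> \<kappa>" for t \<theta>
    using assumption3(2)[OF shift[OF that]] .
  have R0: "R > 0" by (rule obstacle(9))
  have shift_pos: "p \<theta> + t > R" "p \<theta> + t > 0" if "\<bar>t\<bar> \<le> \<kappa>" for t \<theta>
    using shift_ge[OF that, of \<theta>] R0 assumption3(1) by auto
  define \<Gamma> where "\<Gamma> = frontier D"
  have \<Gamma>: "compact \<Gamma>" "\<Gamma> = {polar (p \<theta>) \<theta> |\<theta>. True}"
    unfolding \<Gamma>_def by (rule compact_frontier_bounded[OF obstacle(4)], rule boundary(4))
  have p_le: "p \<theta> \<le> \<rho>" for \<theta>
  proof -
    have "polar (p \<theta>) \<theta> \<in> closure D" using \<Gamma> by (auto simp: \<Gamma>_def frontier_def)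
    moreover have "closure D \<subseteq> cball 0 \<rho>"
      by (rule closure_minimal) (use obstacle(7) in auto)
    ultimately have "norm (polar (p \<theta>) \<theta>) \<le> \<rho>" by auto
    thus ?thesis using boundary(3)[of \<theta>] by simp
  qed
  \<comment> \<open>the scattered field and its approximation live on \<open>S\<close>; the total field also has to avoid the source\<close>
  define S where "S = {x::real^2. R < norm x}"
  define S' where "S' = S - {z}"
  have So: "open S" unfolding S_def by (intro open_Collect_less continuous_intros)
  have S'o: "open S'" unfolding S'_def using So by (intro open_Diff) auto
  have "\<Gamma> \<subseteq> S'"
  proof
    fix x assume x: "x \<in> \<Gamma>"
    then obtain \<theta> where \<theta>: "x = polar (p \<theta>) \<theta>" using \<Gamma>(2) by blast
    have "norm x > R" using shift_pos[of 0 \<theta>] neighbourhood(1) by (simp add: \<theta>)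
    moreover have "x \<noteq> z" using x source(2) by (auto simp: \<Gamma>_def frontier_def)
    ultimately show "x \<in> S'" by (simp add: S'_def S_def)
  qed
  from ex_tube_neighbourhood[OF pc boundary(2,3) neighbourhood(1) \<Gamma> S'o this]
  obtain d0 where d0: "d0 > 0" "{x. infdist x \<Gamma> \<le> d0} \<subseteq> S'"
    and tube: "\<And>r \<theta>. r > 0 \<Longrightarrow> \<theta> \<in> {0<..<2*pi} \<Longrightarrow> infdist (polar r \<theta>) \<Gamma> \<le> d0 \<Longrightarrow> \<bar>r - p \<theta>\<bar> \<le> \<kappa>"
    by blast
  define K where "K = {x. infdist x \<Gamma> \<le> d0}"
  have K: "compact K" unfolding K_def by (rule compact_infdist_le) (use \<Gamma> d0 in auto)
  have KS': "K \<subseteq> S'" and KS: "K \<subseteq> S" using d0(2) by (auto simp: K_def S'_def)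
  define d where "d = d0 / 2"
  have d: "d > 0" using d0 by (simp add: d_def)
  have cballK: "cball (polar r \<theta>) d \<subseteq> K" if "\<bar>r - p \<theta>\<bar> \<le> d" for r \<theta>
  proof
    fix y assume "y \<in> cball (polar r \<theta>) d"
    hence "dist y (polar (p \<theta>) \<theta>) \<le> d + dist (polar r \<theta>) (polar (p \<theta>) \<theta>)"
      using dist_triangle[of y "polar (p \<theta>) \<theta>" "polar r \<theta>"] by (simp add: dist_commute)
    also have "dist (polar r \<theta>) (polar (p \<theta>) \<theta>) = \<bar>r - p \<theta>\<bar>"
      by (simp add: dist_norm polar_def flip: scaleR_diff_left)
    finally have "dist y (polar (p \<theta>) \<theta>) \<le> d0" using that by (simp add: d_def)
    moreover have "infdist y \<Gamma> \<le> dist y (polar (p \<theta>) \<theta>)" by (rule infdist_le) (use \<Gamma>(2) in auto)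
    ultimately show "y \<in> K" by (simp add: K_def)
  qed

  define W where "W \<delta> = mode_field kp ks R (N \<delta>) (c \<delta>)" for \<delta>
  define w where "w \<delta> x = v x - W \<delta> x" for \<delta> x
  have vN: "vN \<delta> r \<theta> = W \<delta> (polar r \<theta>)" if "r > 0" for \<delta> r \<theta>
    unfolding approximation(2) W_def by (rule mode_sum_eq_mode_field[OF kp ks that])
  have fields: "two_wave_field kp ks S v" "two_wave_field kp ks S (W \<delta>)" "two_wave_field kp ks (- {z}) ui" for \<delta>
  proof -
    show "two_wave_field kp ks S v"
      by (rule grad_plus_curl_two_wave[OF _ _ So])
        (use potentials kp ks in \<open>auto simp: radiating_potential_def S_def\<close>)
    have "S \<subseteq> - {0}" using R0 by (auto simp: S_def)
    thus "two_wave_field kp ks S (W \<delta>)"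
      unfolding W_def by (rule two_wave_field_subset[OF mode_field_two_wave[OF kp ks]])
    show "two_wave_field kp ks (- {z}) ui"
      unfolding incident by (rule incident_field_two_wave[OF kp ks])
  qed
  have w_field: "two_wave_field kp ks S (w \<delta>)" for \<delta>
    unfolding w_def by (rule two_wave_field_add_diff(2)[OF fields(1,2)])
  have S'sub: "S' \<subseteq> S" "S' \<subseteq> - {z}" by (auto simp: S'_def)
  define uW where "uW \<delta> x = ui x + W \<delta> x" for \<delta> x
  have uW_field: "two_wave_field kp ks S' (uW \<delta>)" for \<delta>
    unfolding uW_def
    by (rule two_wave_field_add_diff(1)[OF two_wave_field_subset[OF fields(3) S'sub(2)] two_wave_field_subset[OF fields(2) S'sub(1)]])
  define u0 where "u0 x = ui x + v x" for x
  have u0_field: "two_wave_field kp ks S' u0"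
    unfolding u0_def
    by (rule two_wave_field_add_diff(1)[OF two_wave_field_subset[OF fields(3) S'sub(2)] two_wave_field_subset[OF fields(1) S'sub(1)]])
  have uN: "uN \<delta> r \<theta> = uW \<delta> (polar r \<theta>)" if "r > 0" for \<delta> r \<theta>
    unfolding approximation(3) uW_def using vN[OF that] by simp

  \<comment> \<open>adding \<open>\<delta>\<close> makes the error bound positive even where \<open>\<xi>2\<close> vanishes\<close>
  define \<xi> where "\<xi> \<delta> = \<xi>2 \<delta> + \<delta>" for \<delta>
  define M where "M = \<rho> + \<kappa>"
  define A where "A = \<kappa> * (1 + 2 * pi * M)"
  have A0: "A \<ge> 0" using neighbourhood(1) obstacle(6) by (simp add: A_def M_def)
  have tube_error: "integral K (\<lambda>y. norm (w \<delta> y)) \<le> A * \<xi> \<delta>" "\<xi> \<delta> > 0"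
    if \<delta>: "\<delta> \<in> {0<..<1}" "of_int (N \<delta>) \<ge> 4 * ks * \<rho> + 1" for \<delta>
  proof -
    \<comment> \<open>the error estimate for the zeroth iterate, started at an arbitrary curve of the neighbourhood\<close>
    have L2: "L2_curve q (\<lambda>r \<theta>. v (polar r \<theta>) - vN \<delta> r \<theta>) \<le> \<xi>2 \<delta>" if "q \<in> U" for q
      using errors[OF \<delta>, of 0 q] that by simp
    have pU: "p \<in> U" using shift[of 0] neighbourhood(1) by simp
    have "0 \<le> L2_curve p (\<lambda>r \<theta>. v (polar r \<theta>) - vN \<delta> r \<theta>)"
      unfolding L2_curve_def set_lebesgue_integral_def
      by (intro real_sqrt_ge_zero Bochner_Integration.integral_nonneg) auto
    hence "\<xi>2 \<delta> \<ge> 0" using L2[OF pU] by linarith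
    thus \<xi>0: "\<xi> \<delta> > 0" using \<delta> by (simp add: \<xi>_def)
    have curve: "(LBINT \<theta>:{0..2*pi}. (p \<theta> + t) * norm (w \<delta> (polar (p \<theta> + t) \<theta>))) \<le> \<xi> \<delta> * (1 + 2 * pi * M) / 2"
      if t: "\<bar>t\<bar> \<le> \<kappa>" for t
    proof -
      define q where "q \<theta> = p \<theta> + t" for \<theta>
      have qU: "q \<in> U" unfolding q_def[abs_def] by (rule shift[OF t])
      have dq: "deriv q \<theta> = p' \<theta>" for \<theta>
        unfolding q_def[abs_def] by (rule DERIV_imp_deriv) (auto intro!: derivative_eq_intros p')
      have qc: "continuous_on T q" for T
        unfolding q_def[abs_def] by (intro continuous_intros continuous_on_subset[OF pc]) auto
      have f: "v (polar (q \<theta>) \<theta>) - vN \<delta> (q \<theta>) \<theta> = w \<delta> (polar (q \<theta>) \<theta>)" for \<theta>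
        using vN[OF shift_pos(2)[OF t, of \<theta>]] by (simp add: w_def q_def)
      have "(LBINT \<theta>:{0..2*pi}. q \<theta> * norm ((\<lambda>r \<theta>. v (polar r \<theta>) - vN \<delta> r \<theta>) (q \<theta>) \<theta>)) \<le> \<xi> \<delta> * (1 + 2 * pi * M) / 2"
      proof (rule curve_L1_le_L2)
        show "continuous_on UNIV (deriv q)" using p'(2) by (simp add: dq[abs_def])
        show "0 < q \<theta>" for \<theta> using shift_pos(2)[OF t] by (simp add: q_def)
        show "q \<theta> \<le> M" for \<theta> using p_le[of \<theta>] t by (simp add: q_def M_def)
        show "continuous_on {0..2*pi} (\<lambda>\<theta>. v (polar (q \<theta>) \<theta>) - vN \<delta> (q \<theta>) \<theta>)"
          unfolding f
        proof (rule continuous_on_compose2[OF two_wave_field_continuous[OF w_field]])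
          show "continuous_on {0..2*pi} (\<lambda>\<theta>. polar (q \<theta>) \<theta>)"
            unfolding polar_def by (intro continuous_intros qc)
          have "polar (q \<theta>) \<theta> \<in> S" for \<theta>
            using shift_pos[OF t, of \<theta>] by (simp add: S_def q_def)
          thus "(\<lambda>\<theta>. polar (q \<theta>) \<theta>) ` {0..2*pi} \<subseteq> S" by auto
        qed
        show "L2_curve q (\<lambda>r \<theta>. v (polar r \<theta>) - vN \<delta> r \<theta>) \<le> \<xi> \<delta>"
          using L2[OF qU] \<delta> by (simp add: \<xi>_def)
      qed (use qc \<xi>0 in auto)
      thus ?thesis by (simp add: f q_def[symmetric])
    qed
    have "integral K (\<lambda>y. norm (w \<delta> y)) \<le> 2 * \<kappa> * (\<xi> \<delta> * (1 + 2 * pi * M) / 2)"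
    proof (rule tube_integral_le(2)[OF pc neighbourhood(1) two_wave_field_continuous[OF w_field] K KS _ _ _ curve])
      show "\<bar>r - p \<theta>\<bar> \<le> \<kappa>" if "r > 0" "\<theta> \<in> {0<..<2*pi}" "polar r \<theta> \<in> K" for r \<theta>
        using tube[OF that(1,2)] that(3) by (simp add: K_def)
      show "polar (p \<theta> + t) \<theta> \<in> S" "p \<theta> + t > 0" if "\<bar>t\<bar> \<le> \<kappa>" for t \<theta>
        using shift_pos[OF that, of \<theta>] by (simp_all add: S_def)
    qed
    also have "\<dots> = A * \<xi> \<delta>" by (simp add: A_def)
    finally show "integral K (\<lambda>y. norm (w \<delta> y)) \<le> A * \<xi> \<delta>" .
  qed

  obtain C where C: "C > 0" and reg: "\<forall>S f F r \<theta> I. two_wave_field kp ks S f \<longrightarrow> (\<forall>s>0. \<forall>t. F s t = f (polar s t)) \<longrightarrow>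
     r > 0 \<longrightarrow> cball (polar r \<theta>) d \<subseteq> S \<longrightarrow> integral (cball (polar r \<theta>) d) (\<lambda>y. norm (f y)) \<le> I \<longrightarrow>
     radially_regular F r \<theta> (C * I)"
    using polar_field_regularity[OF kp kk d] by (elim exE conjE) (rule that)
  define Iu where "Iu = integral K (\<lambda>y. norm (u0 y))"
  have intK: "(\<lambda>y. norm (f y)) integrable_on T" if "two_wave_field kp ks S0 f" "T \<subseteq> S0" "compact T" for f S0 T
    by (intro integrable_on_compact_continuous that continuous_intros
        continuous_on_subset[OF two_wave_field_continuous[OF that(1)]])
  have Iu0: "Iu \<ge> 0" unfolding Iu_def by (intro integral_nonneg intK[OF u0_field KS' K]) auto
  \<comment> \<open>bounds the approximate total field and its radial derivatives as soon as the error in the tube is at most one\<close>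
  define B where "B = C * (Iu + 1)"
  have B0: "B > 0" using C Iu0 by (simp add: B_def)
  have pos: "r > 0" if "\<bar>r - p \<theta>\<bar> \<le> \<kappa>" for r \<theta>
    using shift_pos(2)[OF that, of \<theta>] by simp
  have loc: "integral (cball (polar r \<theta>) d) (\<lambda>y. norm (f y)) \<le> integral K (\<lambda>y. norm (f y))"
    if "\<bar>r - p \<theta>\<bar> \<le> d" "two_wave_field kp ks S0 f" "K \<subseteq> S0" for r \<theta> f S0
    by (intro integral_subset_le intK[OF that(2)] cballK that K) (use cballK[OF that(1)] that(3) in auto)
  have at_p: "norm (uN \<delta> (p \<theta>) \<theta>) \<le> C * (A * \<xi> \<delta>)"
    if \<delta>: "\<delta> \<in> {0<..<1}" "of_int (N \<delta>) \<ge> 4 * ks * \<rho> + 1" for \<delta> \<theta>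
  proof -
    have p0: "p \<theta> > 0" by (rule boundary(3))
    have "polar (p \<theta>) \<theta> \<in> frontier D" using \<Gamma> by (auto simp: \<Gamma>_def)
    \<comment> \<open>the exact total field vanishes on the boundary\<close>
    hence "uN \<delta> (p \<theta>) \<theta> = - w \<delta> (polar (p \<theta>) \<theta>)"
      using scattering(2)[of "polar (p \<theta>) \<theta>"] uN[OF p0, of \<delta> \<theta>]
      by (simp add: uW_def w_def eq_neg_iff_add_eq_0[symmetric] algebra_simps)
    moreover have "norm ((\<lambda>s t. w \<delta> (polar s t)) (p \<theta>) \<theta>) \<le> C * (A * \<xi> \<delta>)"
    proof -
      have "integral (cball (polar (p \<theta>) \<theta>) d) (\<lambda>y. norm (w \<delta> y)) \<le> A * \<xi> \<delta>"
        using loc[OF _ w_field KS, of "p \<theta>" \<theta> \<delta>] tube_error(1)[OF \<delta>] d by simp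
      moreover have "cball (polar (p \<theta>) \<theta>) d \<subseteq> S" using cballK[of "p \<theta>" \<theta>] KS d by simp
      ultimately show ?thesis
        using reg[rule_format, OF w_field[of \<delta>] _ p0, of "\<lambda>s t. w \<delta> (polar s t)" \<theta> "A * \<xi> \<delta>"]
          by (simp add: radially_regular_def)
    qed
    ultimately show ?thesis by simp
  qed
  have near_p: "radially_regular (uN \<delta>) r \<theta> B"
    if \<delta>: "\<delta> \<in> {0<..<1}" "of_int (N \<delta>) \<ge> 4 * ks * \<rho> + 1" "A * \<xi> \<delta> \<le> 1"
      and r: "\<bar>r - p \<theta>\<bar> \<le> d" "\<bar>r - p \<theta>\<bar> \<le> \<kappa>" for \<delta> r \<theta>
  proof -
    have "integral K (\<lambda>y. norm (uW \<delta> y)) \<le> integral K (\<lambda>y. norm (u0 y) + norm (w \<delta> y))"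
    proof (rule integral_le)
      show "norm (uW \<delta> y) \<le> norm (u0 y) + norm (w \<delta> y)" for y
        using norm_triangle_ineq4[of "u0 y" "w \<delta> y"] by (simp add: uW_def u0_def w_def)
    qed (intro integrable_add intK[OF uW_field KS' K] intK[OF u0_field KS' K] intK[OF w_field KS K])+
    also have "\<dots> = Iu + integral K (\<lambda>y. norm (w \<delta> y))"
      unfolding Iu_def by (intro Henstock_Kurzweil_Integration.integral_add intK[OF u0_field KS' K] intK[OF w_field KS K])
    also have "\<dots> \<le> Iu + 1" using tube_error(1)[OF \<delta>(1,2)] \<delta>(3) by simp
    finally have "integral (cball (polar r \<theta>) d) (\<lambda>y. norm (uW \<delta> y)) \<le> Iu + 1"
      using loc[OF r(1) uW_field KS', of \<delta>] by linarith
    moreover have "cball (polar r \<theta>) d \<subseteq> S'" using cballK[OF r(1)] KS' by auto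
    moreover have "\<forall>s>0. \<forall>t. uN \<delta> s t = uW \<delta> (polar s t)" using uN by simp
    ultimately show ?thesis
      unfolding B_def using reg uW_field[of \<delta>] pos[OF r(2)] by blast
  qed

  \<comment> \<open>iterates at this distance from \<open>p\<close> stay in the tube, and \<open>6 B\<^sup>2 \<eta> \<le> \<epsilon>\<^sup>2\<close> uses up only a part of
    the bound \<open>(2 \<epsilon>)\<^sup>2\<close> in the contraction condition and leaves room for the error\<close>
  define \<eta> where "\<eta> = min (min d \<kappa>) (\<epsilon>\<^sup>2 / (6 * B\<^sup>2))"
  have \<epsilon>0: "\<epsilon> > 0" by (rule assumption2(1))
  have \<eta>: "\<eta> > 0" "\<eta> \<le> d" "\<eta> \<le> \<kappa>" using d neighbourhood(1) \<epsilon>0 B0 by (auto simp: \<eta>_def)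
  have \<eta>B: "6 * B * (B * \<eta>) \<le> \<epsilon>\<^sup>2"
  proof -
    have "\<eta> \<le> \<epsilon>\<^sup>2 / (6 * B\<^sup>2)" by (simp add: \<eta>_def)
    hence "\<eta> * (6 * B\<^sup>2) \<le> \<epsilon>\<^sup>2" using B0 by (simp add: pos_le_divide_eq)
    thus ?thesis by (simp add: power2_eq_square mult_ac)
  qed
  define e where "e \<delta> = C * (A * \<xi> \<delta>)" for \<delta>
  have \<xi>lim: "(\<xi> \<longlongrightarrow> 0) (at_right 0)"
  proof -
    have "((\<lambda>\<delta>. \<xi>2 \<delta> + \<delta>) \<longlongrightarrow> 0 + 0) (at_right 0)"
      by (intro tendsto_add error_functions(1) tendsto_ident_at)
    thus ?thesis by (simp add: \<xi>_def[abs_def])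
  qed
  have elim0: "(e \<longlongrightarrow> 0) (at_right 0)"
    unfolding e_def[abs_def] using tendsto_mult_left[OF tendsto_mult_left[OF \<xi>lim, of A], of C] by simp
  define good where "good \<delta> \<longleftrightarrow> \<delta> \<in> {0<..<1} \<and> of_int (N \<delta>) \<ge> 4 * ks * \<rho> + 1 \<and> A * \<xi> \<delta> \<le> 1 \<and>
     (\<forall>q\<in>U. \<forall>\<theta>. norm (radial_deriv (uN \<delta>) (q \<theta>) \<theta>) \<ge> 2 * \<epsilon>) \<and> 6 * B * e \<delta> \<le> \<epsilon>\<^sup>2 \<and> e \<delta> / (2 * \<epsilon>) \<le> \<eta> / 2" for \<delta>
  have ev_good: "\<forall>\<^sub>F \<delta> in at_right 0. good \<delta>"
  proof -
    have "\<forall>\<^sub>F \<delta> in at_right 0. A * \<xi> \<delta> < 1"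
      by (rule order_tendstoD(2)[of _ 0]) (use tendsto_mult_left[OF \<xi>lim, of A] in auto)
    moreover have "\<forall>\<^sub>F \<delta> in at_right 0. 6 * B * e \<delta> < \<epsilon>\<^sup>2"
      by (rule order_tendstoD(2)[of _ 0]) (use tendsto_mult_left[OF elim0, of "6 * B"] \<epsilon>0 in auto)
    moreover have "\<forall>\<^sub>F \<delta> in at_right 0. e \<delta> / (2 * \<epsilon>) < \<eta> / 2"
      by (rule order_tendstoD(2)[of _ 0]) (use tendsto_divide[OF elim0 tendsto_const, of "2 * \<epsilon>"] \<epsilon>0 \<eta> in auto)
    moreover have "\<forall>\<^sub>F \<delta> in at_right 0. \<delta> \<in> {0<..<1::real}"
      by (rule eventually_at_right_real) simp
    moreover have "\<forall>\<^sub>F \<delta> in at_right 0. of_int (N \<delta>) \<ge> 4 * ks * \<rho> + 1"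
      unfolding approximation(1) by (rule truncation_eventually_ge[OF R0 assumption3(1)])
    ultimately show ?thesis using lower_bound
      by eventually_elim (unfold good_def, intro conjI; simp)
  qed

  have iteration: "\<And>m \<theta>. \<bar>newton (uN \<delta>) p0 m \<theta> - p \<theta>\<bar> \<le> \<eta>"
      "\<And>m \<theta>. \<bar>newton (uN \<delta>) p0 (Suc m) \<theta> - newton (uN \<delta>) p0 m \<theta>\<bar> \<le> 2 * \<eta> / 2 ^ m"
      "\<And>m \<theta>. \<bar>newton (uN \<delta>) p0 (Suc m) \<theta> - p \<theta>\<bar> \<le> \<bar>newton (uN \<delta>) p0 (Suc m) \<theta> - newton (uN \<delta>) p0 m \<theta>\<bar> + 2 * (e \<delta> / (2 * \<epsilon>))"
      "\<And>m. continuous_on UNIV (newton (uN \<delta>) p0 m)"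
    if p0: "p0 \<in> curve_nbhd p \<eta>" and good: "good \<delta>" for p0 \<delta>
  proof -
    have \<delta>: "\<delta> \<in> {0<..<1}" "of_int (N \<delta>) \<ge> 4 * ks * \<rho> + 1" "A * \<xi> \<delta> \<le> 1"
      and e\<delta>: "6 * B * e \<delta> \<le> \<epsilon>\<^sup>2" "e \<delta> / (2 * \<epsilon>) \<le> \<eta> / 2"
      using good by (auto simp: good_def)
    have lowU: "\<forall>q\<in>U. \<forall>\<theta>. 2 * \<epsilon> \<le> norm (radial_deriv (uN \<delta>) (q \<theta>) \<theta>)"
      using good unfolding good_def by blast
    have lower: "2 * \<epsilon> \<le> norm (radial_deriv (uN \<delta>) r \<theta>)" if "\<bar>r - p \<theta>\<bar> \<le> \<eta>" for r \<theta>
    proof -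
      \<comment> \<open>the parallel curve through the given point\<close>
      have "(\<lambda>\<theta>'. p \<theta>' + (r - p \<theta>)) \<in> U" by (rule shift) (use that \<eta> in auto)
      with lowU have "\<forall>\<theta>'. 2 * \<epsilon> \<le> norm (radial_deriv (uN \<delta>) (p \<theta>' + (r - p \<theta>)) \<theta>')"
        by (rule bspec)
      from this[rule_format, of \<theta>] show ?thesis by simp
    qed
    note near = near_p[OF \<delta>, unfolded radially_regular_def]
    have contr: "\<bar>(r - Re (vquot (uN \<delta> r \<theta>) (radial_deriv (uN \<delta>) r \<theta>)))
          - (s - Re (vquot (uN \<delta> s \<theta>) (radial_deriv (uN \<delta>) s \<theta>)))\<bar> \<le> \<bar>r - s\<bar> / 2"
      "\<bar>(p \<theta> - Re (vquot (uN \<delta> (p \<theta>) \<theta>) (radial_deriv (uN \<delta>) (p \<theta>) \<theta>))) - p \<theta>\<bar> \<le> e \<delta> / (2 * \<epsilon>)"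
      if r: "\<bar>r - p \<theta>\<bar> \<le> \<eta>" and s: "\<bar>s - p \<theta>\<bar> \<le> \<eta>" for r s \<theta>
    proof -
      have "\<exists>g2. \<forall>r. \<bar>r - p \<theta>\<bar> \<le> \<eta> \<longrightarrow> ((\<lambda>s. radial_deriv (uN \<delta>) s \<theta>) has_vector_derivative g2 r) (at r) \<and> norm (g2 r) \<le> B"
        using near[of _ \<theta>] \<eta> by (intro choice) (meson order_trans)
      then obtain g2 where g2: "\<And>r. \<bar>r - p \<theta>\<bar> \<le> \<eta> \<Longrightarrow> ((\<lambda>s. radial_deriv (uN \<delta>) s \<theta>) has_vector_derivative g2 r) (at r)"
         "\<And>r. \<bar>r - p \<theta>\<bar> \<le> \<eta> \<Longrightarrow> norm (g2 r) \<le> B" by blast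
      have a: "6 * B * (e \<delta> + B * \<eta>) \<le> (2 * \<epsilon>)\<^sup>2"
      proof -
        have "6 * B * (e \<delta> + B * \<eta>) \<le> \<epsilon>\<^sup>2 + \<epsilon>\<^sup>2" using \<eta>B e\<delta>(1) by (simp add: distrib_left)
        also have "\<dots> \<le> (2 * \<epsilon>)\<^sup>2" by (simp add: power_mult_distrib)
        finally show ?thesis .
      qed
      have N1: "((\<lambda>s. uN \<delta> s \<theta>) has_vector_derivative radial_deriv (uN \<delta>) r \<theta>) (at r)"
        "norm (radial_deriv (uN \<delta>) r \<theta>) \<le> B" if "\<bar>r - p \<theta>\<bar> \<le> \<eta>" for r
        using near[of r \<theta>] that \<eta> by auto
      have ep: "norm (uN \<delta> (p \<theta>) \<theta>) \<le> e \<delta>" unfolding e_def by (rule at_p[OF \<delta>(1,2)])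
      have "2 * \<epsilon> > 0" using \<epsilon>0 by simp
      note nc = newton_map_contraction[where g = "\<lambda>s. uN \<delta> s \<theta>" and g' = "\<lambda>s. radial_deriv (uN \<delta>) s \<theta>" and p = "p \<theta>",
          OF N1(1) g2(1) N1(2) g2(2) this lower ep a \<eta>(1) r s]
      show "\<bar>(r - Re (vquot (uN \<delta> r \<theta>) (radial_deriv (uN \<delta>) r \<theta>)))
          - (s - Re (vquot (uN \<delta> s \<theta>) (radial_deriv (uN \<delta>) s \<theta>)))\<bar> \<le> \<bar>r - s\<bar> / 2"
        unfolding Re_vquot by (rule nc(1))
      show "\<bar>(p \<theta> - Re (vquot (uN \<delta> (p \<theta>) \<theta>) (radial_deriv (uN \<delta>) (p \<theta>) \<theta>))) - p \<theta>\<bar> \<le> e \<delta> / (2 * \<epsilon>)"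
        unfolding Re_vquot by (rule nc(2))
    qed
    have p0': "\<bar>p0 \<theta> - p \<theta>\<bar> \<le> \<eta>" for \<theta> using p0 by (simp add: curve_nbhd_def)
    have p0c: "continuous_on UNIV p0"
      using p0 by (simp add: curve_nbhd_def C1_differentiable_imp_continuous_on)
    have pp: "\<bar>p \<theta> - p \<theta>\<bar> \<le> \<eta>" for \<theta> using \<eta> by simp
    note it = contraction_iterates[where T = "\<lambda>r. r - Re (vquot (uN \<delta> r \<theta>) (radial_deriv (uN \<delta>) r \<theta>))"
        and x = "\<lambda>m. newton (uN \<delta>) p0 m \<theta>" and p = "p \<theta>" and \<eta> = \<eta> and e = "e \<delta> / (2 * \<epsilon>)" for \<theta>,
        OF contr(1) contr(2)[OF pp pp] e\<delta>(2)]
    show 1: "\<bar>newton (uN \<delta>) p0 m \<theta> - p \<theta>\<bar> \<le> \<eta>" for m \<theta>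
      by (rule it(1)) (use p0' in auto)
    show "\<bar>newton (uN \<delta>) p0 (Suc m) \<theta> - newton (uN \<delta>) p0 m \<theta>\<bar> \<le> 2 * \<eta> / 2 ^ m" for m \<theta>
      by (rule it(2)) (use p0' in auto)
    show "\<bar>newton (uN \<delta>) p0 (Suc m) \<theta> - p \<theta>\<bar> \<le> \<bar>newton (uN \<delta>) p0 (Suc m) \<theta> - newton (uN \<delta>) p0 m \<theta>\<bar> + 2 * (e \<delta> / (2 * \<epsilon>))" for m \<theta>
      by (rule it(3)) (use p0' in auto)
    show "continuous_on UNIV (newton (uN \<delta>) p0 m)" for m
    proof (rule newton_continuous[OF p0c 1])
      fix r \<theta> assume r: "\<bar>r - p \<theta>\<bar> \<le> \<eta>"
      show "isCont (\<lambda>x. uN \<delta> (fst x) (snd x)) (r, \<theta>)" "isCont (\<lambda>x. radial_deriv (uN \<delta>) (fst x) (snd x)) (r, \<theta>)"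
        using near[of r \<theta>] r \<eta> by auto
      show "radial_deriv (uN \<delta>) r \<theta> \<noteq> 0" using lower[OF r] \<epsilon>0 by auto
    qed
  qed

  have C1lim: "(C1 \<longlongrightarrow> 0) (at_right 0)"
  proof -
    have "((\<lambda>\<delta>. 4 * \<xi>2 \<delta> / (\<epsilon> - 2 * \<xi>3 \<delta>)) \<longlongrightarrow> 4 * 0 / (\<epsilon> - 2 * 0)) (at_right 0)"
      using \<epsilon>0 by (intro tendsto_intros error_functions) simp
    thus ?thesis by (simp add: tolerance)
  qed
  have ev_den: "\<forall>\<^sub>F \<delta> in at_right 0. \<epsilon> - 2 * \<xi>3 \<delta> > 0"
  proof -
    have "((\<lambda>\<delta>. \<epsilon> - 2 * \<xi>3 \<delta>) \<longlongrightarrow> \<epsilon> - 2 * 0) (at_right 0)"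
      by (intro tendsto_intros error_functions)
    thus ?thesis by (rule order_tendstoD(1)) (use \<epsilon>0 in simp)
  qed
  show ?thesis
  proof (intro exI[of _ \<eta>] conjI ballI)
    show "\<eta> > 0" by (rule \<eta>)
    fix p0 assume p0: "p0 \<in> curve_nbhd p \<eta>"
    note it = iteration[OF p0]
    have cont: "continuous_on {0..2*pi} (newton (uN \<delta>) p0 m)" if "good \<delta>" for \<delta> m
      by (rule continuous_on_subset[OF it(4)[OF that]]) simp
    have pc0: "continuous_on {0..2*pi} p" by (rule continuous_on_subset[OF pc]) simp
    show "\<forall>\<^sub>F \<delta> in at_right 0. \<xi>2 \<delta> > 0 \<longrightarrow> (\<exists>m. stop_crit (uN \<delta>) p0 (C1 \<delta>) m)"
      using ev_good ev_den
    proof eventually_elim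
      case (elim \<delta>)
      show ?case
      proof
        assume "\<xi>2 \<delta> > 0"
        hence C1: "C1 \<delta> > 0" using elim by (simp add: tolerance)
        have "((\<lambda>m. 2 * \<eta> * sqrt (2 * pi) * (1 / 2) ^ m) \<longlongrightarrow> 2 * \<eta> * sqrt (2 * pi) * 0) sequentially"
          by (intro tendsto_intros LIMSEQ_realpow_zero) auto
        hence "\<forall>\<^sub>F m in sequentially. 2 * \<eta> * sqrt (2 * pi) * (1 / 2) ^ m < C1 \<delta>"
          by (rule order_tendstoD(2)) (use C1 in simp)
        then obtain m where m: "2 * \<eta> * sqrt (2 * pi) * (1 / 2) ^ m < C1 \<delta>"
          using eventually_happens'[OF sequentially_bot] by blast
        have "L2_circle (\<lambda>\<theta>. newton (uN \<delta>) p0 (Suc m) \<theta> - newton (uN \<delta>) p0 m \<theta>) \<le> 2 * \<eta> / 2 ^ m * sqrt (2 * pi)"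
          by (rule L2_circle_le)
            (use it(2)[OF elim(1)] \<eta>(1) in \<open>auto intro!: continuous_on_diff cont elim simp del: newton.simps\<close>)
        also have "\<dots> = 2 * \<eta> * sqrt (2 * pi) * (1 / 2) ^ m" by (simp add: power_divide)
        finally show "\<exists>m. stop_crit (uN \<delta>) p0 (C1 \<delta>) m"
          unfolding stop_crit_def using m by (meson less_imp_le order_trans)
      qed
    qed
    define A0 where "A0 = {\<delta>. \<delta> > 0 \<and> (\<exists>m. stop_crit (uN \<delta>) p0 (C1 \<delta>) m)}"
    define b where "b \<delta> = sqrt (2 * (C1 \<delta>)\<^sup>2 + 16 * pi * (e \<delta> / (2 * \<epsilon>))\<^sup>2)" for \<delta>
    have le: "at 0 within A0 \<le> at_right 0"
      by (rule at_le) (auto simp: A0_def)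
    have "(b \<longlongrightarrow> sqrt (2 * 0\<^sup>2 + 16 * pi * (0 / (2 * \<epsilon>))\<^sup>2)) (at_right 0)"
      unfolding b_def[abs_def] using \<epsilon>0 by (intro tendsto_intros C1lim elim0) auto
    hence blim: "(b \<longlongrightarrow> 0) (at 0 within A0)" using le by (auto intro: tendsto_mono)
    have "\<forall>\<^sub>F \<delta> in at 0 within A0. \<delta> \<in> A0" by (simp add: eventually_at_filter)
    moreover have "\<forall>\<^sub>F \<delta> in at 0 within A0. good \<delta>" using ev_good le by (rule filter_leD[rotated])
    ultimately have "\<forall>\<^sub>F \<delta> in at 0 within A0.
        norm (L2_circle (\<lambda>\<theta>. newton_stopped (uN \<delta>) p0 (C1 \<delta>) \<theta> - p \<theta>)) \<le> b \<delta>"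
    proof eventually_elim
      case (elim \<delta>)
      define m where "m = (LEAST m. stop_crit (uN \<delta>) p0 (C1 \<delta>) m)"
      have "\<exists>m. stop_crit (uN \<delta>) p0 (C1 \<delta>) m" using elim by (simp add: A0_def)
      hence stop: "stop_crit (uN \<delta>) p0 (C1 \<delta>) m" unfolding m_def by (rule LeastI_ex)
      have ns: "newton_stopped (uN \<delta>) p0 (C1 \<delta>) = newton (uN \<delta>) p0 (Suc m)"
        by (simp only: newton_stopped_def m_def)
      have "L2_circle (\<lambda>\<theta>. newton (uN \<delta>) p0 (Suc m) \<theta> - p \<theta>) \<le> b \<delta>"
        unfolding b_def
        by (rule L2_circle_triangle[OF continuous_on_diff[OF cont cont] continuous_on_diff[OF cont pc0] _ stop[unfolded stop_crit_def]])
          (use elim it(3) in auto)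
      moreover have "0 \<le> L2_circle f" for f
        unfolding L2_circle_def set_lebesgue_integral_def
        by (intro real_sqrt_ge_zero Bochner_Integration.integral_nonneg) auto
      ultimately show ?case unfolding ns by simp
    qed
    from Lim_null_comparison[OF this blim]
    show "((\<lambda>\<delta>. L2_circle (\<lambda>\<theta>. newton_stopped (uN \<delta>) p0 (C1 \<delta>) \<theta> - p \<theta>)) \<longlongrightarrow> 0)
       (at 0 within {\<delta>. \<delta> > 0 \<and> (\<exists>m. stop_crit (uN \<delta>) p0 (C1 \<delta>) m)})"
      unfolding A0_def .
  qed
qed

end
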